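(* Let $\beta\ne0$ and let $\gamma=\gamma(\beta,\phi;t)$, $0\le t\le T$, be a noncontinuable shortest arc in $(SL(2),\delta)$. Then: 1) If $|\beta|\ge\frac{2}{\sqrt3}$ then $T=\frac{2\pi}{\sqrt{\beta^2-1}}$. 2) If $\beta^2=1$ then $T\in(2\pi,3\pi)$ and $T$ satisfies the system of equations $$\cos\frac T2=\frac{-1}{\sqrt{1+(T/2)^2}},\qquad \sin\frac T2=\frac{-T/2}{\sqrt{1+(T/2)^2}}.$$ 3) If $\beta^2<1$ then $T\in\left(\frac{2\pi}{|\beta|},\frac{3\pi}{|\beta|}\right)$ and $T$ satisfies the system of equations $$\cos kx=\frac{-1}{\sqrt{1+k^2\tanh^2x}},\qquad \sin kx=\frac{-k\tanh x}{\sqrt{1+k^2\tanh^2x}},$$ where $k=\frac{|\beta|}{\sqrt{1-\beta^2}}$ and $x=\frac{T\sqrt{1-\beta^2}}{2}=\frac{T}{2\sqrt{1+k^2}}$. 4) If $|\beta|=\frac{3}{2\sqrt2}$ then $T=2\sqrt2\,\pi$. 5) If $\frac{3}{2\sqrt2}<|\beta|<\frac{2}{\sqrt3}$ then $$\frac{3\pi}{|\beta|}<T<2\pi\left(|\beta|+\sqrt{\beta^2-1}\right)<\frac{4\pi}{|\beta|}$$ and $T$ satisfies the system of equations $$\cos kx=\frac{1}{\sqrt{1+k^2\tan^2x}},\qquad \sin kx=\frac{k\tan x}{\sqrt{1+k^2\tan^2x}}<0,$$ where $k=\frac{|\beta|}{\sqrt{\beta^2-1}}$ and $x=\frac{T\sqrt{\beta^2-1}}{2}=\frac{T}{2\sqrt{k^2-1}}$.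 6) If $1<|\beta|<\frac{3}{2\sqrt2}$ then $$\frac{2\pi}{|\beta|}<2\pi\left(|\beta|+\sqrt{\beta^2-1}\right)<T<\frac{3\pi}{|\beta|}$$ and $T$ satisfies the system of equations $$\cos kx=\frac{-1}{\sqrt{1+k^2\tan^2x}},\qquad \sin kx=\frac{-k\tan x}{\sqrt{1+k^2\tan^2x}}<0,$$ where $k=\frac{|\beta|}{\sqrt{\beta^2-1}}$ and $x=\frac{T\sqrt{\beta^2-1}}{2}=\frac{T}{2\sqrt{k^2-1}}$.
   Context: Let $e_{ij}$ be the $2\times2$ matrix units, $p_1=\frac12(e_{11}-e_{22})$, $p_2=\frac12(e_{12}+e_{21})$, and denote by $\kappa=\frac12(e_{21}-e_{12})$ the third basis element of $\mathfrak{sl}(2)$ (in the claim, $k$ denotes only the real numbers defined there). $\delta$ is the left-invariant sub-Riemannian metric (Carnot–Carathéodory distance) on $SL(2)$ (real $2\times2$ matrices with determinant 1, unit $e$) defined by the left-invariant distribution $D$ with $D(e)=\operatorname{Lin}(p_1,p_2)$ and the scalar product on $D(e)$ with orthonormal basis $p_1,p_2$. The geodesics (locally shortest curves) parametrized by arclength starting at $e$ are $$\gamma(\beta,\phi;t)=\exp\bigl(t(\cos\phi\, p_1+\sin\phi\, p_2+\beta\kappa)\bigr)\exp(-t\beta\kappa),\quad \beta,\phi\in\mathbb{R}.$$ A shortest arc is a curve whose length equals the $\delta$-distance between its endpoints. The shortest arc $\gamma(\beta,\phi;t)$, $0\le t\le T$, $T>0$, is noncontinuable if for no $T'>T$ the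 segment $\gamma(\beta,\phi;t)$, $0\le t\le T'$, is a shortest arc. *)

theory Defs
  imports "HOL-Analysis.Analysis"
begin

type_synonym mat2 = "real^2^2"

definition SL2 :: "mat2 set" where
  "SL2 = {g. det g = 1}"

definition p1 :: mat2 where
  "p1 = (1/2) *\<^sub>R vector [vector [1, 0], vector [0, -1]]"

definition p2 :: mat2 where
  "p2 = (1/2) *\<^sub>R vector [vector [0, 1], vector [1, 0]]"

definition kappa :: mat2 where
  "kappa = (1/2) *\<^sub>R vector [vector [0, -1], vector [1, 0]]"

text \<open>The product of the type class ring on vectors is componentwise, so the library
  functions \<open>^\<close> and \<open>exp\<close> are not the matrix ones; powers are iterated \<open>**\<close>.\<close>

definition mexp :: "mat2 \<Rightarrow> mat2" where
  "mexp A = (\<Sum>n. (1 / fact n) *\<^sub>R (((**) A ^^ n) (mat 1)))"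

lemma summable_mexp: "summable (\<lambda>n. (1 / fact n) *\<^sub>R (((**) A ^^ n) (mat 1)))" for A :: mat2
proof -
  have "linear (\<lambda>B :: mat2. A ** B)"
    by (rule linearI)
      (simp_all add: vec_eq_iff matrix_matrix_mult_def sum_2 algebra_simps)
  then obtain K where K: "K > 0" "\<And>B :: mat2. norm (A ** B) \<le> norm B * K"
    using bounded_linear.pos_bounded linear_conv_bounded_linear by metis
  have bound: "norm (((**) A ^^ n) (mat 1 :: mat2)) \<le> norm (mat 1 :: mat2) * K ^ n" for n
  proof (induction n)
    case (Suc n)
    have "norm (((**) A ^^ Suc n) (mat 1 :: mat2)) \<le> norm (((**) A ^^ n) (mat 1 :: mat2)) * K"
      using K(2) by simp
    also have "\<dots> \<le> (norm (mat 1 :: mat2) * K ^ n) * K"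
      using Suc K(1) by (intro mult_right_mono) auto
    finally show ?case by (simp add: mult_ac)
  qed simp
  have "summable (\<lambda>n. norm (mat 1 :: mat2) * (inverse (fact n) * K ^ n))"
    by (intro summable_mult summable_exp)
  then show ?thesis
    by (rule summable_comparison_test')
      (use bound in \<open>auto simp: divide_simps mult_ac\<close>)
qed

text \<open>The left-invariant distribution: left translates of the span of \<open>p1\<close> and \<open>p2\<close>.\<close>

definition distrib_D :: "mat2 \<Rightarrow> mat2 set" where
  "distrib_D g = (\<lambda>A. g ** A) ` span {p1, p2}"

text \<open>The scalar product at the unit is twice the Frobenius product \<open>\<bullet>\<close> of matrices;
  by the lemma below it is the one on the span for which \<open>p1\<close>, \<open>p2\<close> are orthonormal.\<close>

definition sr_inner :: "mat2 \<Rightarrow> mat2 \<Rightarrow> mat2 \<Rightarrow> real" where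
  "sr_inner g v w = 2 * ((matrix_inv g ** v) \<bullet> (matrix_inv g ** w))"

lemma matrix_inv_mat_1: "matrix_inv (mat 1 :: mat2) = mat 1"
  unfolding matrix_inv_def by (rule some_equality) simp_all

lemma sr_inner_orthonormal:
  "sr_inner (mat 1) p1 p1 = 1" "sr_inner (mat 1) p2 p2 = 1" "sr_inner (mat 1) p1 p2 = 0"
  by (simp_all add: sr_inner_def matrix_inv_mat_1 p1_def p2_def inner_vec_def UNIV_2)

definition sr_speed :: "(real \<Rightarrow> mat2) \<Rightarrow> real \<Rightarrow> real" where
  "sr_speed c t = sqrt (sr_inner (c t) (vector_derivative c (at t)) (vector_derivative c (at t)))"

text \<open>Piecewise continuously differentiable curves in the group, tangent to the distribution.
  The library notion allows the derivative to be unbounded at the break points, and the integral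
  of a non-integrable function is \<open>0\<close> by convention; hence the integrability condition,
  which holds automatically if the derivative has one-sided limits at the break points.\<close>

definition horizontal_on :: "(real \<Rightarrow> mat2) \<Rightarrow> real \<Rightarrow> real \<Rightarrow> bool" where
  "horizontal_on c a b \<longleftrightarrow>
     c piecewise_C1_differentiable_on {a..b} \<and> c ` {a..b} \<subseteq> SL2 \<and>
     (\<exists>S. finite S \<and> (\<forall>t\<in>{a..b} - S. vector_derivative c (at t) \<in> distrib_D (c t))) \<and>
     sr_speed c integrable_on {a..b}"

definition sr_length :: "(real \<Rightarrow> mat2) \<Rightarrow> real \<Rightarrow> real \<Rightarrow> real" where
  "sr_length c a b = integral {a..b} (sr_speed c)"

text \<open>The Carnot--Caratheodory distance, meaningful for arguments in \<open>SL2\<close>; there the set below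
  is nonempty since \<open>p1\<close>, \<open>p2\<close> generate the Lie algebra.\<close>

definition cc_dist :: "mat2 \<Rightarrow> mat2 \<Rightarrow> real" where
  "cc_dist g h = Inf {sr_length c 0 1 | c. horizontal_on c 0 1 \<and> c 0 = g \<and> c 1 = h}"

definition shortest_arc :: "(real \<Rightarrow> mat2) \<Rightarrow> real \<Rightarrow> real \<Rightarrow> bool" where
  "shortest_arc c a b \<longleftrightarrow> horizontal_on c a b \<and> sr_length c a b = cc_dist (c a) (c b)"

definition noncontinuable_shortest_arc :: "(real \<Rightarrow> mat2) \<Rightarrow> real \<Rightarrow> bool" where
  "noncontinuable_shortest_arc c T \<longleftrightarrow>
     T > 0 \<and> shortest_arc c 0 T \<and> \<not> (\<exists>T'>T. shortest_arc c 0 T')"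

definition geod :: "real \<Rightarrow> real \<Rightarrow> real \<Rightarrow> mat2" where
  "geod \<beta> \<phi> t =
     mexp (t *\<^sub>R (cos \<phi> *\<^sub>R p1 + sin \<phi> *\<^sub>R p2 + \<beta> *\<^sub>R kappa)) ** mexp (- (t * \<beta>) *\<^sub>R kappa)"

end

theory Submission
  imports Defs
begin

text \<open>Write a real matrix as the map \<open>v \<mapsto> A v + B cnj v\<close> of the complex plane. The group becomes the
  set of pairs with \<open>\<bar>A\<bar>\<^sup>2 - \<bar>B\<bar>\<^sup>2 = 1\<close>, and a curve is horizontal exactly if \<open>A' = B cnj u / 2\<close> and
  \<open>B' = A u / 2\<close> for a control \<open>u\<close>, whose modulus is the speed. Conjugation by rotations preserves two
  quantities: \<open>\<bar>B\<bar> = sinh (r / 2)\<close>, where \<open>r\<close> is the hyperbolic distance from the start to the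
  projection of the curve to the hyperbolic plane, and \<open>z = - 2 arg A\<close>, continued along the curve,
  which is the signed hyperbolic area between the projected curve and the segment back to the
  start. The metric problem is thus Dido's problem in the hyperbolic plane: to reach a given point
  around a given area by a shortest curve. The only difference is that the end point determines the
  area modulo \<open>4 \<pi>\<close> only.

  Lower bounds of lengths come from the separated solutions \<open>b z \<plusminus> P\<^sub>b\<close> of the eikonal equation,
  where \<open>P\<^sub>b = \<integral>\<^sub>0\<^sup>r sqrt (1 - b\<^sup>2 tanh\<^sup>2 (\<rho> / 2)) d\<rho>\<close>: along a horizontal curve they grow at most
  at unit rate, as long as \<open>b tanh (r / 2) \<le> 1\<close> (\<open>calibration_estimate\<close>). With the sign \<open>+\<close> up to the
  point farthest from the start, where \<open>\<bar>B\<bar> = X\<close>, and the sign \<open>-\<close> from there on, every curve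
  with end values \<open>x = \<bar>B\<bar>\<close> and \<open>z\<close> is at least as long as
  \<open>b \<bar>z\<bar> + 2 P\<^sub>b(X) - P\<^sub>b(x)\<close>, for each multiplier \<open>b\<close> that is admissible up to \<open>X\<close>. Whatever \<open>X\<close> is,
  one of these multipliers makes this at least the length of the geodesic with the same end values,
  provided that this geodesic has not gone beyond a full circle (\<open>competitor_bound\<close>). The optimisation
  over \<open>b\<close> needs no derivative in \<open>b\<close>: the tangent inequality for \<open>P\<^sub>b\<close> is the calibration estimate
  applied to the geodesic itself.

  Hence the arc of \<open>geod \<beta> \<phi>\<close> up to the time \<open>t\<close> is shortest if the projected circle is
  traversed at most once and the area is at most \<open>2 \<pi>\<close>; for then every competitor, whose area may differ by a
  multiple of \<open>4 \<pi>\<close>, encloses at least as much in absolute value (\<open>cc_dist_geod_eq\<close>). Beyond the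
  first time at which one of these conditions breaks down, the arc is not shortest
  (\<open>cc_dist_geod_less\<close>). An area above \<open>2 \<pi>\<close> can be replaced by a smaller one with the same end
  point, and after a full circle the estimate above has a term to spare because the curve came back
  to \<open>\<bar>B\<bar> = 0\<close>. In either case the better competitor is again a geodesic, and it exists since
  geodesics take all pairs of values \<open>(x, z)\<close> (\<open>geodesic_through\<close>).

  So the time \<open>T\<close> of the theorem is \<open>2 \<pi> / sqrt (\<beta>\<^sup>2 - 1)\<close>, for \<open>\<bar>\<beta>\<bar> > 1\<close>, or the time at which the area is \<open>2 \<pi>\<close>,
  whichever comes first. The full circle encloses the area \<open>2 \<pi> (\<bar>\<beta>\<bar> / sqrt (\<beta>\<^sup>2 - 1) - 1)\<close>, which is at
  most \<open>2 \<pi>\<close> exactly for \<open>\<bar>\<beta>\<bar> \<ge> 2 / sqrt 3\<close>, and the half circle encloses half of it, which is \<open>2 \<pi>\<close> for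
  \<open>\<bar>\<beta>\<bar> = 3 / (2 sqrt 2)\<close>. When the area is \<open>2 \<pi>\<close>, \<open>A\<close> is real and negative. This is the
  system of equations for \<open>T\<close> in each of the remaining cases, and the bounds on \<open>T\<close> locate the angle.\<close>

section \<open>The profile functions of a geodesic\<close>

text \<open>The function \<open>cosh (sqrt q)\<close> as an entire power series, which for negative \<open>q\<close> is
  \<open>cos (sqrt (- q))\<close>; likewise \<open>sinhc_root\<close> is \<open>sinh (sqrt q) / sqrt q\<close>. They treat \<open>\<bar>\<beta>\<bar> < 1\<close>, \<open>\<bar>\<beta>\<bar> = 1\<close>
  and \<open>\<bar>\<beta>\<bar> > 1\<close> at once, and continuity across \<open>\<bar>\<beta>\<bar> = 1\<close> is built in.\<close>
definition cosh_root :: "real \<Rightarrow> real" where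
  "cosh_root q = (\<Sum>n. q ^ n / fact (2 * n))"

definition sinhc_root :: "real \<Rightarrow> real" where
  "sinhc_root q = (\<Sum>n. q ^ n / fact (2 * n + 1))"

lemma cosh_root_power2: "(\<lambda>n. (s\<^sup>2) ^ n / fact (2 * n)) sums cosh s" for s :: real
proof -
  have "(\<lambda>n. (\<lambda>m. if even m then s ^ m /\<^sub>R fact m else 0) (2 * n)) sums cosh s"
    by (subst sums_mono_reindex) (auto simp: strict_mono_def cosh_converges elim!: evenE)
  then show ?thesis by (simp add: power_mult divide_inverse_commute)
qed

lemma cosh_root_neg_power2: "(\<lambda>n. (- s\<^sup>2) ^ n / fact (2 * n)) sums cos s" for s :: real
  using cos_paired[of s] by (simp add: power_mult power_minus[of "s\<^sup>2"])

lemma sinhc_root_power2: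
  fixes s :: real
  assumes "s \<noteq> 0"
  shows "(\<lambda>n. (s\<^sup>2) ^ n / fact (2 * n + 1)) sums (sinh s / s)"
proof -
  have "(\<lambda>n. (\<lambda>m. if even m then 0 else s ^ m /\<^sub>R fact m) (2 * n + 1)) sums sinh s"
    by (subst sums_mono_reindex) (auto simp: strict_mono_def sinh_converges elim!: oddE)
  from sums_divide[OF this, of s]
  have "(\<lambda>n. s ^ (2 * n + 1) / fact (2 * n + 1) / s) sums (sinh s / s)"
    by (simp add: divide_inverse_commute del: fact_Suc)
  then show ?thesis using assms by (simp add: power_mult del: fact_Suc)
qed

lemma sinhc_root_neg_power2:
  fixes s :: real
  assumes "s \<noteq> 0"
  shows "(\<lambda>n. (- s\<^sup>2) ^ n / fact (2 * n + 1)) sums (sin s / s)"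
proof -
  have "(- 1) ^ n / fact (2 * n + 1) * s ^ (2 * n + 1) / s = (- s\<^sup>2) ^ n / fact (2 * n + 1)" for n
    using assms by (simp add: power_mult power_minus[of "s\<^sup>2"] del: fact_Suc)
  then show ?thesis using sums_divide[OF sin_paired[of s], of s] by (simp only:)
qed

lemma real_cases_square:
  fixes q :: real
  obtains "q = 0" | s where "s > 0" "q = s\<^sup>2" | s where "s > 0" "q = - s\<^sup>2"
proof -
  consider "q = 0" | "q > 0" | "q < 0" by linarith
  then show thesis
    using that(1) that(2)[of "sqrt q"] that(3)[of "sqrt (- q)"] by cases auto
qed

lemma cosh_root_sums: "(\<lambda>n. q ^ n / fact (2 * n)) sums cosh_root q"
proof -
  have "summable (\<lambda>n. q ^ n / fact (2 * n))"
  proof (cases q rule: real_cases_square)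
    case 1 then show ?thesis using cosh_root_power2[of 0] by (auto simp: sums_iff)
  next
    case (2 s) then show ?thesis using cosh_root_power2[of s] by (auto simp: sums_iff)
  next
    case (3 s) then show ?thesis using cosh_root_neg_power2[of s] by (auto simp: sums_iff)
  qed
  then show ?thesis by (simp add: cosh_root_def summable_sums)
qed

lemma sinhc_root_0_sums: "(\<lambda>n. 0 ^ n / fact (2 * n + 1)) sums (1 :: real)"
proof -
  have "(\<lambda>n. (1 / fact (2 * n + 1)) * 0 ^ n) sums (1 / fact (2 * 0 + 1) :: real)"
    by (rule powser_sums_zero)
  then show ?thesis by (simp del: fact_Suc)
qed

lemma sinhc_root_sums: "(\<lambda>n. q ^ n / fact (2 * n + 1)) sums sinhc_root q"
proof -
  have "summable (\<lambda>n. q ^ n / fact (2 * n + 1))"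
  proof (cases q rule: real_cases_square)
    case 1 then show ?thesis using sinhc_root_0_sums by (auto simp: sums_iff)
  next
    case (2 s) then show ?thesis using sinhc_root_power2[of s] by (auto simp: sums_iff)
  next
    case (3 s) then show ?thesis using sinhc_root_neg_power2[of s] by (auto simp: sums_iff)
  qed
  then show ?thesis by (simp add: sinhc_root_def summable_sums)
qed

lemma cosh_root_eq: "cosh_root (s\<^sup>2) = cosh s" "cosh_root (- s\<^sup>2) = cos s"
  using cosh_root_power2[of s] cosh_root_neg_power2[of s] by (auto simp: cosh_root_def sums_iff)

lemma sinhc_root_0 [simp]: "sinhc_root 0 = 1"
  using sinhc_root_0_sums sinhc_root_sums[of 0] sums_unique2 by blast

lemma sinhc_root_eq:
  assumes "s \<noteq> 0"
  shows "sinhc_root (s\<^sup>2) = sinh s / s" "sinhc_root (- s\<^sup>2) = sin s / s"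
  using sinhc_root_power2[OF assms] sinhc_root_neg_power2[OF assms]
  by (auto simp: sinhc_root_def sums_iff)

lemma isCont_cosh_root: "isCont cosh_root q"
proof -
  have "isCont (\<lambda>q. \<Sum>n. (1 / fact (2 * n)) * q ^ n) q"
    by (rule isCont_powser_converges_everywhere)
      (use cosh_root_sums in \<open>auto simp: sums_iff\<close>)
  then show ?thesis by (simp add: cosh_root_def[abs_def])
qed

lemma isCont_sinhc_root: "isCont sinhc_root q"
proof -
  have "isCont (\<lambda>q. \<Sum>n. (1 / fact (2 * n + 1)) * q ^ n) q"
    by (rule isCont_powser_converges_everywhere)
      (use sinhc_root_sums in \<open>auto simp: sums_iff\<close>)
  then show ?thesis by (simp add: sinhc_root_def[abs_def])
qed

lemma cosh_root_0 [simp]: "cosh_root 0 = 1"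
  using cosh_root_eq(1)[of 0] by simp

lemma cosh_root_sinhc_root: "(cosh_root q)\<^sup>2 - q * (sinhc_root q)\<^sup>2 = 1"
proof (cases q rule: real_cases_square)
  case (2 s)
  then show ?thesis using hyperbolic_pythagoras[of s]
    by (simp add: cosh_root_eq sinhc_root_eq power_divide)
next
  case (3 s)
  then show ?thesis using sin_cos_squared_add[of s]
    by (simp add: cosh_root_eq sinhc_root_eq power_divide)
qed simp

lemma sinhc_root_pos:
  assumes "q > - pi\<^sup>2"
  shows "sinhc_root q > 0"
proof (cases q rule: real_cases_square)
  case (3 s)
  with assms have "s < pi" using power2_less_imp_less[of s pi] by auto
  with 3 show ?thesis by (simp add: sinhc_root_eq sin_gt_zero)
qed (auto simp: sinhc_root_eq)

text \<open>The exponential of \<open>t (cos \<phi> p1 + sin \<phi> p2 + \<beta> kappa)\<close> is \<open>geo_c \<beta> t\<close> times the identity plus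
  \<open>2 geo_s \<beta> t\<close> times the matrix in parentheses, whose square is the scalar \<open>(1 - \<beta>\<^sup>2) / 4\<close>.\<close>
definition geo_c :: "real \<Rightarrow> real \<Rightarrow> real" where
  "geo_c \<beta> t = cosh_root ((1 - \<beta>\<^sup>2) * t\<^sup>2 / 4)"

definition geo_s :: "real \<Rightarrow> real \<Rightarrow> real" where
  "geo_s \<beta> t = t / 2 * sinhc_root ((1 - \<beta>\<^sup>2) * t\<^sup>2 / 4)"

lemma geo_s_minus [simp]: "geo_s (- \<beta>) t = geo_s \<beta> t"
  and geo_s_abs [simp]: "geo_s \<bar>\<beta>\<bar> t = geo_s \<beta> t"
  by (simp_all add: geo_s_def)

lemma geo_0 [simp]: "geo_c \<beta> 0 = 1" "geo_s \<beta> 0 = 0"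
  by (simp_all add: geo_c_def geo_s_def)

lemma geo_c_s: "(geo_c \<beta> t)\<^sup>2 - (1 - \<beta>\<^sup>2) * (geo_s \<beta> t)\<^sup>2 = 1"
  using cosh_root_sinhc_root[of "(1 - \<beta>\<^sup>2) * t\<^sup>2 / 4"]
  by (simp add: geo_c_def geo_s_def power_mult_distrib power_divide)

lemma geo_elliptic:
  assumes "\<bar>\<beta>\<bar> > 1"
  defines "\<omega> \<equiv> sqrt (\<beta>\<^sup>2 - 1)"
  shows "geo_c \<beta> t = cos (\<omega> * t / 2)" "geo_s \<beta> t = sin (\<omega> * t / 2) / \<omega>"
proof -
  have w: "\<omega> > 0" "\<omega>\<^sup>2 = \<beta>\<^sup>2 - 1"
    using assms abs_square_le_1[of \<beta>] by (auto simp: \<omega>_def linorder_not_le[symmetric])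
  have q: "(1 - \<beta>\<^sup>2) * t\<^sup>2 / 4 = - (\<omega> * t / 2)\<^sup>2"
    by (simp add: power_mult_distrib power_divide w(2) left_diff_distrib diff_divide_distrib)
  show "geo_c \<beta> t = cos (\<omega> * t / 2)" unfolding geo_c_def q cosh_root_eq ..
  show "geo_s \<beta> t = sin (\<omega> * t / 2) / \<omega>"
    unfolding geo_s_def q using w sinhc_root_eq(2)[of "\<omega> * t / 2"] by (cases "t = 0") auto
qed

lemma geo_parabolic:
  assumes "\<bar>\<beta>\<bar> = 1"
  shows "geo_c \<beta> t = 1" "geo_s \<beta> t = t / 2"
proof -
  have "\<beta>\<^sup>2 = 1" using assms by (simp add: abs_square_eq_1)
  then show "geo_c \<beta> t = 1" "geo_s \<beta> t = t / 2" by (simp_all add: geo_c_def geo_s_def)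
qed

lemma geo_hyperbolic:
  assumes "\<bar>\<beta>\<bar> < 1"
  defines "\<nu> \<equiv> sqrt (1 - \<beta>\<^sup>2)"
  shows "geo_c \<beta> t = cosh (\<nu> * t / 2)" "geo_s \<beta> t = sinh (\<nu> * t / 2) / \<nu>"
proof -
  have w: "\<nu> > 0" "\<nu>\<^sup>2 = 1 - \<beta>\<^sup>2"
    using assms abs_square_less_1[of \<beta>] by (auto simp: \<nu>_def)
  have q: "(1 - \<beta>\<^sup>2) * t\<^sup>2 / 4 = (\<nu> * t / 2)\<^sup>2"
    by (simp add: power_mult_distrib power_divide w(2) left_diff_distrib diff_divide_distrib)
  show "geo_c \<beta> t = cosh (\<nu> * t / 2)" unfolding geo_c_def q cosh_root_eq ..
  show "geo_s \<beta> t = sinh (\<nu> * t / 2) / \<nu>"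
    unfolding geo_s_def q using w sinhc_root_eq(1)[of "\<nu> * t / 2"] by (cases "t = 0") auto
qed

lemma geo_deriv:
  shows geo_c_deriv: "((\<lambda>t. geo_c \<beta> t) has_real_derivative (1 - \<beta>\<^sup>2) / 2 * geo_s \<beta> t) (at t)"
    and geo_s_deriv: "((\<lambda>t. geo_s \<beta> t) has_real_derivative geo_c \<beta> t / 2) (at t)"
proof -
  consider "\<bar>\<beta>\<bar> < 1" | "\<bar>\<beta>\<bar> = 1" | "\<bar>\<beta>\<bar> > 1" by linarith
  then have "((\<lambda>t. geo_c \<beta> t) has_real_derivative (1 - \<beta>\<^sup>2) / 2 * geo_s \<beta> t) (at t) \<and>
    ((\<lambda>t. geo_s \<beta> t) has_real_derivative geo_c \<beta> t / 2) (at t)"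
  proof cases
    case 1
    define \<nu> where "\<nu> = sqrt (1 - \<beta>\<^sup>2)"
    have eq: "\<nu> > 0" "1 - \<beta>\<^sup>2 = \<nu>\<^sup>2"
      using 1 abs_square_less_1[of \<beta>] by (auto simp: \<nu>_def)
    have "((\<lambda>t. cosh (\<nu> * t / 2)) has_real_derivative (\<nu> / 2 * sinh (\<nu> * t / 2))) (at t)"
      "((\<lambda>t. sinh (\<nu> * t / 2) / \<nu>) has_real_derivative \<nu> / 2 * cosh (\<nu> * t / 2) / \<nu>) (at t)"
      by (auto intro!: derivative_eq_intros)
    with eq(1) show ?thesis unfolding geo_hyperbolic[OF 1] \<nu>_def[symmetric] eq(2)
      by (simp add: power2_eq_square)
  next
    case 2
    then have "\<beta>\<^sup>2 = 1" by (simp add: abs_square_eq_1)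
    then show ?thesis unfolding geo_parabolic[OF 2]
      by (auto intro!: derivative_eq_intros)
  next
    case 3
    define \<omega> where "\<omega> = sqrt (\<beta>\<^sup>2 - 1)"
    have eq: "\<omega> > 0" "1 - \<beta>\<^sup>2 = - \<omega>\<^sup>2"
      using 3 abs_square_le_1[of \<beta>] by (auto simp: \<omega>_def linorder_not_le[symmetric])
    have "((\<lambda>t. cos (\<omega> * t / 2)) has_real_derivative - (\<omega> / 2 * sin (\<omega> * t / 2))) (at t)"
      "((\<lambda>t. sin (\<omega> * t / 2) / \<omega>) has_real_derivative \<omega> / 2 * cos (\<omega> * t / 2) / \<omega>) (at t)"
      by (auto intro!: derivative_eq_intros)
    with eq(1) show ?thesis unfolding geo_elliptic[OF 3] \<omega>_def[symmetric] eq(2)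
      by (simp add: power2_eq_square)
  qed
  then show "((\<lambda>t. geo_c \<beta> t) has_real_derivative (1 - \<beta>\<^sup>2) / 2 * geo_s \<beta> t) (at t)"
    "((\<lambda>t. geo_s \<beta> t) has_real_derivative geo_c \<beta> t / 2) (at t)" by auto
qed

lemma continuous_on_geo [continuous_intros]:
  "continuous_on A (geo_c \<beta>)" "continuous_on A (geo_s \<beta>)"
  by (rule DERIV_continuous_on, rule has_field_derivative_at_within, rule geo_deriv)+

section \<open>The area enclosed by a geodesic\<close>

text \<open>The area coordinate \<open>z\<close> along a geodesic. Defining it as an integral makes it continuous in \<open>t\<close>
  for all times, whereas a formula by the arctangent needs a choice of branch.\<close>
definition geo_z :: "real \<Rightarrow> real \<Rightarrow> real" where
  "geo_z \<beta> t = integral {0..t} (\<lambda>s. \<beta> * (geo_s \<beta> s)\<^sup>2 / (1 + (geo_s \<beta> s)\<^sup>2))"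

text \<open>The argument of \<open>geo_c \<beta> t + \<i> \<beta> geo_s \<beta> t\<close>, continued from \<open>0\<close>; see \<open>geo_polar\<close>.\<close>
definition geo_psi :: "real \<Rightarrow> real \<Rightarrow> real" where
  "geo_psi \<beta> t = (\<beta> * t - geo_z \<beta> t) / 2"

text \<open>The quantity \<open>1 + x\<^sup>2\<close> with \<open>x = \<bar>B\<bar>\<close> is \<open>\<bar>A\<bar>\<^sup>2\<close>; it occurs in almost every denominator.\<close>
lemma one_plus_square_pos [simp]: "1 + x\<^sup>2 > 0" "1 + x\<^sup>2 \<noteq> 0" for x :: real
  by (simp_all add: add_pos_nonneg add_nonneg_eq_0_iff)

lemma one_plus_square_not_neg [simp]: "\<not> 1 + x\<^sup>2 < 0" for x :: real
  by (simp add: not_less add_nonneg_nonneg)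

lemma square_gt_1: "\<beta>\<^sup>2 > 1" if "\<beta> > 1" for \<beta> :: real
  using that by (simp add: one_less_power)

lemma geo_z_0 [simp]: "geo_z \<beta> 0 = 0" and geo_psi_0 [simp]: "geo_psi \<beta> 0 = 0"
  by (simp_all add: geo_z_def geo_psi_def)

lemma geo_z_minus [simp]: "geo_z (- \<beta>) t = - geo_z \<beta> t"
  by (simp add: geo_z_def)

lemma geo_z_deriv_within:
  assumes "t \<in> {0..T}"
  shows "(geo_z \<beta> has_real_derivative \<beta> * (geo_s \<beta> t)\<^sup>2 / (1 + (geo_s \<beta> t)\<^sup>2)) (at t within {0..T})"
  unfolding geo_z_def[abs_def] has_real_derivative_iff_has_vector_derivative
  by (rule integral_has_vector_derivative) (use assms in \<open>auto intro!: continuous_intros\<close>)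

lemma at_within_Icc_interior:
  fixes t :: real
  assumes "0 < t"
  shows "at t within {0..t + 1} = at t"
  using assms by (simp add: at_within_Icc_at)

lemma geo_z_deriv:
  assumes "0 < t"
  shows "(geo_z \<beta> has_real_derivative \<beta> * (geo_s \<beta> t)\<^sup>2 / (1 + (geo_s \<beta> t)\<^sup>2)) (at t)"
  using geo_z_deriv_within[of t "t + 1"] assms at_within_Icc_interior[OF assms] by simp

lemma continuous_on_geo_z: "continuous_on {0..T} (geo_z \<beta>)"
  using geo_z_deriv_within by (rule DERIV_continuous_on)

lemma geo_psi_deriv_within:
  assumes "t \<in> {0..T}"
  shows "(geo_psi \<beta> has_real_derivative \<beta> / (2 * (1 + (geo_s \<beta> t)\<^sup>2))) (at t within {0..T})"
proof -
  have "(geo_psi \<beta> has_real_derivative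
      (\<beta> - \<beta> * (geo_s \<beta> t)\<^sup>2 / (1 + (geo_s \<beta> t)\<^sup>2)) / 2) (at t within {0..T})"
    unfolding geo_psi_def[abs_def]
    by (rule DERIV_cdivide, rule DERIV_diff[OF _ geo_z_deriv_within[OF assms]])
      (auto intro!: derivative_eq_intros)
  also have "(\<beta> - \<beta> * (geo_s \<beta> t)\<^sup>2 / (1 + (geo_s \<beta> t)\<^sup>2)) / 2 = \<beta> / (2 * (1 + (geo_s \<beta> t)\<^sup>2))"
    by (simp add: field_simps)
  finally show ?thesis .
qed

lemma continuous_on_geo_psi: "continuous_on {0..T} (geo_psi \<beta>)"
  using geo_psi_deriv_within by (rule DERIV_continuous_on)

lemma geo_psi_strict_mono:
  assumes "\<beta> > 0" "0 \<le> s" "s < t"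
  shows "geo_psi \<beta> s < geo_psi \<beta> t"
proof (rule DERIV_pos_imp_increasing_open[OF \<open>s < t\<close>])
  show "\<exists>y. (geo_psi \<beta> has_real_derivative y) (at x) \<and> y > 0" if "s < x" "x < t" for x
    using geo_psi_deriv_within[of x "x + 1"] at_within_Icc_interior[of x] that assms
    by (intro exI[of _ "\<beta> / (2 * (1 + (geo_s \<beta> x)\<^sup>2))"])
      (auto intro!: divide_pos_pos simp del: distrib_left_numeral)
  show "continuous_on {s..t} (geo_psi \<beta>)"
    by (rule continuous_on_subset[OF continuous_on_geo_psi[of t]]) (use assms in auto)
qed

lemma geo_psi_mono: "\<beta> > 0 \<Longrightarrow> 0 \<le> s \<Longrightarrow> s \<le> t \<Longrightarrow> geo_psi \<beta> s \<le> geo_psi \<beta> t"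
  using geo_psi_strict_mono[of \<beta> s t] by (cases "s = t") auto

lemma geo_z_mono:
  assumes "\<beta> \<ge> 0" "0 \<le> s" "s \<le> t"
  shows "geo_z \<beta> s \<le> geo_z \<beta> t"
proof (rule DERIV_nonneg_imp_increasing_open[OF \<open>s \<le> t\<close>])
  show "\<exists>y. (geo_z \<beta> has_real_derivative y) (at x) \<and> 0 \<le> y" if "s < x" "x < t" for x
    using geo_z_deriv[of x \<beta>] that assms
    by (intro exI[of _ "\<beta> * (geo_s \<beta> x)\<^sup>2 / (1 + (geo_s \<beta> x)\<^sup>2)"]) auto
  show "continuous_on {s..t} (geo_z \<beta>)"
    by (rule continuous_on_subset[OF continuous_on_geo_z[of t]]) (use assms in auto)
qed

lemma geo_z_nonneg: "\<beta> \<ge> 0 \<Longrightarrow> 0 \<le> t \<Longrightarrow> 0 \<le> geo_z \<beta> t"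
  using geo_z_mono[of \<beta> 0 t] by simp

text \<open>The logarithmic derivative of the left-hand side is \<open>geo_s geo_c / (2 (1 + geo_s\<^sup>2))\<close>, which is that of
  the modulus, plus \<open>\<i> \<beta> / (2 (1 + geo_s\<^sup>2))\<close>, which is \<open>\<i>\<close> times the derivative of \<open>geo_psi\<close>. To avoid
  complex quotients the proof follows the real and imaginary part of the left-hand side, rotated by
  \<open>- geo_psi\<close>.\<close>
lemma geo_polar:
  assumes "t \<ge> 0"
  shows "Complex (geo_c \<beta> t) (\<beta> * geo_s \<beta> t) = sqrt (1 + (geo_s \<beta> t)\<^sup>2) * cis (geo_psi \<beta> t)"
proof -
  define A B N where "A = (\<lambda>s. geo_c \<beta> s * cos (geo_psi \<beta> s) + \<beta> * geo_s \<beta> s * sin (geo_psi \<beta> s))"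
    and "B = (\<lambda>s. \<beta> * geo_s \<beta> s * cos (geo_psi \<beta> s) - geo_c \<beta> s * sin (geo_psi \<beta> s))"
    and "N = (\<lambda>s. sqrt (1 + (geo_s \<beta> s)\<^sup>2))"
  have Npos: "N s > 0" "(N s)\<^sup>2 = 1 + (geo_s \<beta> s)\<^sup>2" for s by (simp_all add: N_def)
  \<comment> \<open>The common logarithmic derivative of \<open>A\<close>, \<open>B\<close> and \<open>N\<close>.\<close>
  define k where "k = (\<lambda>s. geo_s \<beta> s * geo_c \<beta> s / (2 * (1 + (geo_s \<beta> s)\<^sup>2)))"
  have dN: "(N has_real_derivative k s * N s) (at s within {0..t})" for s
  proof -
    have "(N has_real_derivative inverse (sqrt (1 + (geo_s \<beta> s)\<^sup>2)) / 2 * (2 * geo_s \<beta> s * (geo_c \<beta> s / 2))) (at s)"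
      unfolding N_def
      by (rule DERIV_chain'[OF _ DERIV_real_sqrt]) (auto intro!: derivative_eq_intros geo_s_deriv)
    moreover have "inverse (N s) / 2 * (2 * geo_s \<beta> s * (geo_c \<beta> s / 2)) = k s * N s"
      using Npos[of s] by (simp add: k_def field_simps flip: Npos(2)) (simp add: power2_eq_square)
    ultimately show ?thesis by (simp add: N_def has_field_derivative_at_within)
  qed
  note ds = has_field_derivative_at_within[OF geo_s_deriv] has_field_derivative_at_within[OF geo_c_deriv]
    geo_psi_deriv_within
  have cf: "(1 - \<beta>\<^sup>2) / 2 * geo_s \<beta> s + \<beta> * geo_s \<beta> s * (\<beta> / (2 * (1 + (geo_s \<beta> s)\<^sup>2))) = k s * geo_c \<beta> s"
    "\<beta> * (geo_c \<beta> s / 2) - geo_c \<beta> s * (\<beta> / (2 * (1 + (geo_s \<beta> s)\<^sup>2))) = k s * (\<beta> * geo_s \<beta> s)" for s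
  proof -
    define q where "q = 1 + (geo_s \<beta> s)\<^sup>2"
    have q: "q > 0" "(geo_s \<beta> s)\<^sup>2 = q - 1" by (simp_all add: q_def)
    have C: "(geo_c \<beta> s)\<^sup>2 = 1 + (1 - \<beta>\<^sup>2) * (q - 1)"
      using geo_c_s[of \<beta> s] q by simp
    have "k s * geo_c \<beta> s = geo_s \<beta> s * (geo_c \<beta> s)\<^sup>2 / (2 * q)"
      by (simp add: k_def q_def power2_eq_square)
    then show "(1 - \<beta>\<^sup>2) / 2 * geo_s \<beta> s + \<beta> * geo_s \<beta> s * (\<beta> / (2 * (1 + (geo_s \<beta> s)\<^sup>2))) = k s * geo_c \<beta> s"
      unfolding C q_def[symmetric] using q(1) by (simp add: field_simps power2_eq_square)
    have "k s * (\<beta> * geo_s \<beta> s) = \<beta> * geo_c \<beta> s * (geo_s \<beta> s)\<^sup>2 / (2 * q)"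
      by (simp add: k_def q_def power2_eq_square)
    then show "\<beta> * (geo_c \<beta> s / 2) - geo_c \<beta> s * (\<beta> / (2 * (1 + (geo_s \<beta> s)\<^sup>2))) = k s * (\<beta> * geo_s \<beta> s)"
      unfolding q(2) q_def[symmetric] using q(1) by (simp add: field_simps power2_eq_square)
  qed
  have dA: "(A has_real_derivative k s * A s) (at s within {0..t})" if "s \<in> {0..t}" for s
  proof -
    let ?p = "\<beta> / (2 * (1 + (geo_s \<beta> s)\<^sup>2))"
    have "(A has_real_derivative
        ((1 - \<beta>\<^sup>2) / 2 * geo_s \<beta> s + \<beta> * geo_s \<beta> s * ?p) * cos (geo_psi \<beta> s) +
        (\<beta> * (geo_c \<beta> s / 2) - geo_c \<beta> s * ?p) * sin (geo_psi \<beta> s)) (at s within {0..t})"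
      unfolding A_def by (rule derivative_eq_intros ds that refl)+ (simp add: algebra_simps)
    then show ?thesis unfolding cf by (simp add: A_def algebra_simps)
  qed
  have dB: "(B has_real_derivative k s * B s) (at s within {0..t})" if "s \<in> {0..t}" for s
  proof -
    let ?p = "\<beta> / (2 * (1 + (geo_s \<beta> s)\<^sup>2))"
    have "(B has_real_derivative
        (\<beta> * (geo_c \<beta> s / 2) - geo_c \<beta> s * ?p) * cos (geo_psi \<beta> s) -
        ((1 - \<beta>\<^sup>2) / 2 * geo_s \<beta> s + \<beta> * geo_s \<beta> s * ?p) * sin (geo_psi \<beta> s)) (at s within {0..t})"
      unfolding B_def by (rule derivative_eq_intros ds that refl)+ (simp add: algebra_simps)
    then show ?thesis unfolding cf by (simp add: B_def algebra_simps)
  qed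
  have quot: "X t / N t = X 0 / N 0" if dX: "\<And>s. s \<in> {0..t} \<Longrightarrow> (X has_real_derivative k s * X s) (at s within {0..t})" for X
  proof -
    have "((\<lambda>s. X s / N s) has_real_derivative 0) (at s within {0..t})" if "s \<in> {0..t}" for s
      using DERIV_divide[OF dX[OF that] dN] Npos(1)[of s] by simp
    then obtain c where "\<forall>s\<in>{0..t}. X s / N s = c"
      using has_field_derivative_zero_constant[of "{0..t}" "\<lambda>s. X s / N s"] by auto
    then show ?thesis using assms by auto
  qed
  have "A t = N t" "B t = 0"
    using quot[OF dA] quot[OF dB] Npos(1)[of t] by (auto simp: A_def B_def N_def)
  have "geo_c \<beta> t = A t * cos (geo_psi \<beta> t) - B t * sin (geo_psi \<beta> t)"
    "\<beta> * geo_s \<beta> t = A t * sin (geo_psi \<beta> t) + B t * cos (geo_psi \<beta> t)"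
    unfolding A_def B_def
    using sin_cos_squared_add[of "geo_psi \<beta> t"] by algebra+
  with \<open>A t = N t\<close> \<open>B t = 0\<close> show ?thesis by (simp add: complex_eq_iff N_def)
qed

lemma geo_cos_sin_psi:
  assumes "t \<ge> 0"
  shows "geo_c \<beta> t = sqrt (1 + (geo_s \<beta> t)\<^sup>2) * cos (geo_psi \<beta> t)"
    "\<beta> * geo_s \<beta> t = sqrt (1 + (geo_s \<beta> t)\<^sup>2) * sin (geo_psi \<beta> t)"
  using geo_polar[OF assms, of \<beta>] by (simp_all add: complex_eq_iff)

text \<open>A continuous angle that starts at \<open>0\<close> cannot leave the interval around \<open>0\<close> on which the cosine is
  positive. This is how branches of angles are fixed below.\<close>
lemma abs_less_pi_half:
  fixes f :: "real \<Rightarrow> real"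
  assumes "continuous_on {0..t} f" "f 0 = 0" "0 \<le> t" "\<And>s. s \<in> {0..t} \<Longrightarrow> cos (f s) > 0"
  shows "\<bar>f t\<bar> < pi / 2"
proof (rule ccontr)
  assume "\<not> \<bar>f t\<bar> < pi / 2"
  moreover have "continuous_on {0..t} (\<lambda>s. \<bar>f s\<bar>)" using assms(1) by (intro continuous_intros)
  ultimately obtain s where s: "0 \<le> s" "s \<le> t" "\<bar>f s\<bar> = pi / 2"
    using IVT'[of "\<lambda>s. \<bar>f s\<bar>" 0 "pi / 2" t] assms(2,3) by auto
  have "cos (f s) = cos \<bar>f s\<bar>" by simp
  also have "\<dots> = 0" unfolding s(3) by simp
  finally show False using assms(4)[of s] s by simp
qed

lemma geo_psi_less_pi_half:
  assumes "t \<ge> 0" "\<And>s. s \<in> {0..t} \<Longrightarrow> geo_c \<beta> s > 0"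
  shows "\<bar>geo_psi \<beta> t\<bar> < pi / 2"
proof (rule abs_less_pi_half[OF continuous_on_geo_psi])
  fix s assume "s \<in> {0..t}"
  then show "cos (geo_psi \<beta> s) > 0"
    using geo_cos_sin_psi(1)[of s \<beta>] assms(2)[of s] by (auto simp: zero_less_mult_iff)
qed (use assms in auto)

lemma geo_c_pos_if_le_1:
  assumes "\<bar>\<beta>\<bar> \<le> 1"
  shows "geo_c \<beta> t > 0"
  using assms geo_hyperbolic(1)[of \<beta> t] geo_parabolic(1)[of \<beta> t] by (cases "\<bar>\<beta>\<bar> = 1") auto

text \<open>For \<open>\<beta> > 1\<close> the angle \<open>geo_psi\<close> stays close to the angle \<open>\<omega> t / 2\<close>, as the vectors with coordinates
  \<open>(cos (\<omega> t / 2), sin (\<omega> t / 2))\<close> and \<open>(geo_c, \<beta> geo_s)\<close> have positive scalar product. So its values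
  at half turns follow without counting windings.\<close>
lemma geo_elliptic_psi:
  assumes "\<beta> > 1" "t \<ge> 0"
  defines "\<omega> \<equiv> sqrt (\<beta>\<^sup>2 - 1)"
  shows "\<bar>geo_psi \<beta> t - \<omega> * t / 2\<bar> < pi / 2"
proof (rule abs_less_pi_half[of t "\<lambda>t. geo_psi \<beta> t - \<omega> * t / 2"])
  have w: "\<omega> > 0" using square_gt_1[of \<beta>] assms by (simp add: \<omega>_def)
  show "continuous_on {0..t} (\<lambda>t. geo_psi \<beta> t - \<omega> * t / 2)"
    by (intro continuous_on_diff continuous_on_geo_psi) (auto intro!: continuous_intros)
  fix s assume s: "s \<in> {0..t}"
  let ?N = "sqrt (1 + (geo_s \<beta> s)\<^sup>2)"
  have e: "geo_c \<beta> s = cos (\<omega> * s / 2)" "geo_s \<beta> s = sin (\<omega> * s / 2) / \<omega>"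
    using geo_elliptic[of \<beta> s] assms by (auto simp: \<omega>_def)
  have "?N * cos (geo_psi \<beta> s - \<omega> * s / 2) = geo_c \<beta> s * cos (\<omega> * s / 2) + \<beta> * geo_s \<beta> s * sin (\<omega> * s / 2)"
    using geo_cos_sin_psi[of s \<beta>] s by (simp add: cos_diff algebra_simps)
  also have "\<dots> = (cos (\<omega> * s / 2))\<^sup>2 + \<beta> / \<omega> * (sin (\<omega> * s / 2))\<^sup>2"
    unfolding e by (simp add: power2_eq_square)
  also have "\<dots> > 0"
    using w assms(1) sin_cos_squared_add[of "\<omega> * s / 2"]
    by (cases "sin (\<omega> * s / 2) = 0")
      (auto intro!: add_nonneg_pos mult_pos_pos divide_pos_pos )
  finally show "cos (geo_psi \<beta> s - \<omega> * s / 2) > 0"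
    by (auto simp: zero_less_mult_iff)
qed (use assms in auto)

lemma geo_psi_half_turn:
  assumes "\<beta> > 1"
  shows "geo_psi \<beta> (pi / sqrt (\<beta>\<^sup>2 - 1)) = pi / 2"
    and "geo_psi \<beta> (2 * pi / sqrt (\<beta>\<^sup>2 - 1)) = pi"
proof -
  define \<omega> where "\<omega> = sqrt (\<beta>\<^sup>2 - 1)"
  have w: "\<omega> > 0" using square_gt_1[of \<beta>] assms by (simp add: \<omega>_def)
  have 1: "\<bar>geo_psi \<beta> (pi / \<omega>) - pi / 2\<bar> < pi / 2" "\<bar>geo_psi \<beta> (2 * pi / \<omega>) - pi\<bar> < pi / 2"
    using geo_elliptic_psi[OF assms, of "pi / \<omega>"] geo_elliptic_psi[OF assms, of "2 * pi / \<omega>"] w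
      square_gt_1[OF assms]
    by (auto simp: \<omega>_def)
  have e: "geo_c \<beta> (pi / \<omega>) = 0" "geo_s \<beta> (2 * pi / \<omega>) = 0"
    using geo_elliptic[of \<beta> "pi / \<omega>"] geo_elliptic[of \<beta> "2 * pi / \<omega>"] w assms square_gt_1[OF assms] by (auto simp: \<omega>_def)
  have "cos (geo_psi \<beta> (pi / \<omega>)) = 0"
    using geo_cos_sin_psi(1)[of "pi / \<omega>" \<beta>] e w by auto
  then show "geo_psi \<beta> (pi / sqrt (\<beta>\<^sup>2 - 1)) = pi / 2"
    using 1(1) cos_inj_pi[of "geo_psi \<beta> (pi / \<omega>)" "pi / 2"] by (auto simp: \<omega>_def abs_if split: if_splits)
  have "sin (geo_psi \<beta> (2 * pi / \<omega>) - pi) = 0"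
    using geo_cos_sin_psi(2)[of "2 * pi / \<omega>" \<beta>] e w by (auto simp: sin_diff)
  then show "geo_psi \<beta> (2 * pi / sqrt (\<beta>\<^sup>2 - 1)) = pi"
    using 1(2) sin_eq_0_pi[of "geo_psi \<beta> (2 * pi / \<omega>) - pi"] by (auto simp: \<omega>_def abs_if split: if_splits)
qed

text \<open>These are the areas of half a disc and of a full disc whose boundary circle has geodesic
  curvature \<open>\<beta>\<close>.\<close>
lemma geo_z_turn:
  assumes "\<beta> > 1"
  defines "\<omega> \<equiv> sqrt (\<beta>\<^sup>2 - 1)"
  shows "geo_z \<beta> (pi / \<omega>) = pi * (\<beta> / \<omega> - 1)" "geo_z \<beta> (2 * pi / \<omega>) = 2 * pi * (\<beta> / \<omega> - 1)"
proof -
  have z: "geo_z \<beta> t = \<beta> * t - 2 * geo_psi \<beta> t" for t by (simp add: geo_psi_def field_simps)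
  show "geo_z \<beta> (pi / \<omega>) = pi * (\<beta> / \<omega> - 1)" "geo_z \<beta> (2 * pi / \<omega>) = 2 * pi * (\<beta> / \<omega> - 1)"
    unfolding z \<omega>_def geo_psi_half_turn[OF assms(1)] by (simp_all add: algebra_simps)
qed

section \<open>The radial part of the calibrations\<close>

text \<open>With \<open>x = sinh (r / 2)\<close> this is \<open>\<integral>\<^sub>0\<^sup>r sqrt (1 - \<beta>\<^sup>2 tanh\<^sup>2 (\<rho> / 2)) d\<rho>\<close>, the radial part of a separated solution of
  the eikonal equation. In the variable \<open>x\<close> the condition \<open>\<beta> tanh (r / 2) \<le> 1\<close> reads
  \<open>1 + (1 - \<beta>\<^sup>2) x\<^sup>2 \<ge> 0\<close>; beyond it the integrand is continued by \<open>0\<close>.\<close>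
definition cal_P :: "real \<Rightarrow> real \<Rightarrow> real" where
  "cal_P \<beta> x = integral {0..x} (\<lambda>s. 2 * sqrt (max 0 (1 + (1 - \<beta>\<^sup>2) * s\<^sup>2)) / (1 + s\<^sup>2))"

lemma cal_P_0 [simp]: "cal_P \<beta> 0 = 0"
  and cal_P_minus [simp]: "cal_P (- \<beta>) x = cal_P \<beta> x"
  by (simp_all add: cal_P_def)

lemma cal_P_deriv_within:
  assumes "x \<in> {0..X}"
  shows "(cal_P \<beta> has_real_derivative 2 * sqrt (max 0 (1 + (1 - \<beta>\<^sup>2) * x\<^sup>2)) / (1 + x\<^sup>2)) (at x within {0..X})"
  unfolding cal_P_def[abs_def] has_real_derivative_iff_has_vector_derivative
  by (rule integral_has_vector_derivative) (use assms in \<open>auto intro!: continuous_intros\<close>)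

lemma cal_P_deriv:
  assumes "x > 0"
  shows "(cal_P \<beta> has_real_derivative 2 * sqrt (max 0 (1 + (1 - \<beta>\<^sup>2) * x\<^sup>2)) / (1 + x\<^sup>2)) (at x)"
  using cal_P_deriv_within[of x "x + 1"] assms at_within_Icc_interior[OF assms] by simp

lemma continuous_on_cal_P: "continuous_on {0..X} (cal_P \<beta>)"
  using cal_P_deriv_within by (rule DERIV_continuous_on)

lemma cal_P_mono:
  assumes "0 \<le> x" "x \<le> y"
  shows "cal_P \<beta> x \<le> cal_P \<beta> y"
proof (rule DERIV_nonneg_imp_increasing_open[OF \<open>x \<le> y\<close>])
  show "\<exists>d. (cal_P \<beta> has_real_derivative d) (at s) \<and> 0 \<le> d" if "x < s" "s < y" for s
    using cal_P_deriv[of s \<beta>] that assms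
    by (intro exI[of _ "2 * sqrt (max 0 (1 + (1 - \<beta>\<^sup>2) * s\<^sup>2)) / (1 + s\<^sup>2)"]) auto
  show "continuous_on {x..y} (cal_P \<beta>)"
    by (rule continuous_on_subset[OF continuous_on_cal_P[of y]]) (use assms in auto)
qed

lemma admissible_mono:
  fixes x y :: real
  assumes "0 \<le> x" "x \<le> y" "1 + (1 - \<beta>\<^sup>2) * y\<^sup>2 \<ge> 0"
  shows "1 + (1 - \<beta>\<^sup>2) * x\<^sup>2 \<ge> 0"
proof (cases "1 - \<beta>\<^sup>2 \<ge> 0")
  case False
  then have "(1 - \<beta>\<^sup>2) * y\<^sup>2 \<le> (1 - \<beta>\<^sup>2) * x\<^sup>2"
    using assms by (intro mult_left_mono_neg power_mono) auto
  with assms show ?thesis by linarith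
qed simp

lemma cal_P_pos:
  assumes "x > 0" "1 + (1 - \<beta>\<^sup>2) * x\<^sup>2 \<ge> 0"
  shows "cal_P \<beta> x > 0"
proof -
  have "cal_P \<beta> 0 < cal_P \<beta> x"
  proof (rule DERIV_pos_imp_increasing_open[OF assms(1)])
    fix s assume s: "0 < s" "s < x"
    have "1 + (1 - \<beta>\<^sup>2) * s\<^sup>2 > 0"
    proof (cases "1 - \<beta>\<^sup>2 \<ge> 0")
      case True
      then show ?thesis by (simp add: add_pos_nonneg)
    next
      case False
      then have "(1 - \<beta>\<^sup>2) * x\<^sup>2 < (1 - \<beta>\<^sup>2) * s\<^sup>2"
        using s by (intro mult_strict_left_mono_neg power_strict_mono) auto
      with assms show ?thesis by linarith
    qed
    then show "\<exists>d. (cal_P \<beta> has_real_derivative d) (at s) \<and> 0 < d"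
      using cal_P_deriv[of s \<beta>] s
      by (intro exI[of _ "2 * sqrt (max 0 (1 + (1 - \<beta>\<^sup>2) * s\<^sup>2)) / (1 + s\<^sup>2)"]) auto
  qed (rule continuous_on_cal_P)
  then show ?thesis by simp
qed

lemma geo_s_mono:
  assumes "0 \<le> s" "s \<le> t" "\<And>r. r \<in> {0..t} \<Longrightarrow> geo_c \<beta> r \<ge> 0"
  shows "geo_s \<beta> s \<le> geo_s \<beta> t"
proof (rule DERIV_nonneg_imp_increasing_open[OF \<open>s \<le> t\<close>])
  show "\<exists>d. (geo_s \<beta> has_real_derivative d) (at r) \<and> 0 \<le> d" if "s < r" "r < t" for r
    using geo_s_deriv[of \<beta> r] that assms by (intro exI[of _ "geo_c \<beta> r / 2"]) auto
qed (rule continuous_on_geo)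

text \<open>The calibration with multiplier \<open>\<beta>\<close> is exact along the geodesic of curvature \<open>\<beta>\<close> while it moves
  away from the axis: \<open>\<beta>\<close> is the momentum conjugate to \<open>z\<close>, and the derivative of \<open>cal_P \<beta>\<close> with respect
  to \<open>r\<close> is the radial momentum.\<close>
lemma outgoing_time_eq:
  assumes "0 \<le> t" "\<And>r. r \<in> {0..t} \<Longrightarrow> geo_c \<beta> r \<ge> 0"
  shows "t = \<beta> * geo_z \<beta> t + cal_P \<beta> (geo_s \<beta> t)"
proof -
  define f where "f = (\<lambda>s. \<beta> * geo_z \<beta> s + (cal_P \<beta> \<circ> geo_s \<beta>) s - s)"
  have "(f has_real_derivative 0) (at s within {0..t})" if s: "s \<in> {0..t}" for s
  proof -
    let ?S = "geo_s \<beta> s" and ?C = "geo_c \<beta> s"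
    have sub: "geo_s \<beta> ` {0..t} \<subseteq> {0..geo_s \<beta> t}"
      using geo_s_mono[of 0 _ \<beta>] geo_s_mono[of _ t \<beta>] assms by fastforce
    have "?C\<^sup>2 = 1 + (1 - \<beta>\<^sup>2) * ?S\<^sup>2" using geo_c_s[of \<beta> s] by simp
    then have "sqrt (max 0 (1 + (1 - \<beta>\<^sup>2) * ?S\<^sup>2)) = ?C"
      using assms(2)[OF s] by (metis max_absorb2 real_sqrt_unique zero_le_power2)
    then have P: "(cal_P \<beta> has_real_derivative 2 * ?C / (1 + ?S\<^sup>2)) (at ?S within geo_s \<beta> ` {0..t})"
      using DERIV_subset[OF cal_P_deriv_within sub, of ?S \<beta>] subsetD[OF sub imageI[OF s]] by simp
    have "(f has_real_derivative \<beta> * (\<beta> * ?S\<^sup>2 / (1 + ?S\<^sup>2)) + 2 * ?C / (1 + ?S\<^sup>2) * (?C / 2) - 1) (at s within {0..t})"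
      unfolding f_def
      by (intro DERIV_diff DERIV_add DERIV_cmult geo_z_deriv_within DERIV_image_chain[OF P]
        has_field_derivative_at_within[OF geo_s_deriv] DERIV_ident s)
    also have "\<beta> * (\<beta> * ?S\<^sup>2 / (1 + ?S\<^sup>2)) + 2 * ?C / (1 + ?S\<^sup>2) * (?C / 2) - 1 = (\<beta>\<^sup>2 * ?S\<^sup>2 + ?C\<^sup>2) / (1 + ?S\<^sup>2) - 1"
    proof -
      have "\<beta> * (\<beta> * ?S\<^sup>2 / q) + 2 * ?C / q * (?C / 2) - 1 = (\<beta>\<^sup>2 * ?S\<^sup>2 + ?C\<^sup>2) / q - 1" for q
        by (simp add: power2_eq_square add_divide_distrib)
      then show ?thesis .
    qed
    also have "\<beta>\<^sup>2 * ?S\<^sup>2 + ?C\<^sup>2 = 1 + ?S\<^sup>2" using geo_c_s[of \<beta> s] by (simp add: algebra_simps)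
    finally show ?thesis by simp
  qed
  then obtain c where "\<forall>s\<in>{0..t}. f s = c"
    using has_field_derivative_zero_constant[of "{0..t}" f] by auto
  then have "f t = f 0" using assms(1) by simp
  then show ?thesis by (simp add: f_def)
qed

text \<open>The value of the radial part at the turning point, obtained from the time and the area of a half
  circle instead of an evaluation of the integral.\<close>
lemma cal_P_turning:
  assumes "\<beta> > 1"
  defines "\<omega> \<equiv> sqrt (\<beta>\<^sup>2 - 1)"
  shows "2 * cal_P \<beta> (1 / \<omega>) = 2 * pi * (\<beta> - \<omega>)"
proof -
  have w: "\<omega> > 0" "\<omega>\<^sup>2 = \<beta>\<^sup>2 - 1" using square_gt_1[of \<beta>] assms by (simp_all add: \<omega>_def)
  have e: "geo_c \<beta> t = cos (\<omega> * t / 2)" "geo_s \<beta> t = sin (\<omega> * t / 2) / \<omega>" for t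
    using geo_elliptic[of \<beta> t] assms by (auto simp: \<omega>_def)
  have "pi / \<omega> = \<beta> * geo_z \<beta> (pi / \<omega>) + cal_P \<beta> (geo_s \<beta> (pi / \<omega>))"
  proof (rule outgoing_time_eq)
    fix r assume "r \<in> {0..pi / \<omega>}"
    then have "0 \<le> \<omega> * r" "\<omega> * r \<le> pi" using w by (auto simp: field_simps)
    then show "geo_c \<beta> r \<ge> 0" unfolding e by (intro cos_ge_zero) auto
  qed (use w in simp)
  moreover have "geo_s \<beta> (pi / \<omega>) = 1 / \<omega>" using w by (simp add: e)
  ultimately have "2 * cal_P \<beta> (1 / \<omega>) = 2 * (pi / \<omega> - \<beta> * (pi * (\<beta> / \<omega> - 1)))"
    using geo_z_turn(1)[OF assms(1)] by (simp add: \<omega>_def)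
  also have "\<dots> = 2 * pi * (\<beta> - (\<beta>\<^sup>2 - 1) / \<omega>)"
    using w(1) by (simp add: field_simps power2_eq_square)
  also have "(\<beta>\<^sup>2 - 1) / \<omega> = \<omega>" unfolding w(2)[symmetric] using w(1) by (simp add: power2_eq_square)
  finally show ?thesis .
qed

section \<open>Complex coordinates and horizontal curves\<close>

text \<open>The coordinates \<open>A\<close> and \<open>B\<close> of the map \<open>v \<mapsto> A v + B cnj v\<close> that a matrix defines on the complex plane.\<close>
definition coordA :: "mat2 \<Rightarrow> complex" where
  "coordA g = Complex ((g $ 1 $ 1 + g $ 2 $ 2) / 2) ((g $ 2 $ 1 - g $ 1 $ 2) / 2)"

definition coordB :: "mat2 \<Rightarrow> complex" where
  "coordB g = Complex ((g $ 1 $ 1 - g $ 2 $ 2) / 2) ((g $ 1 $ 2 + g $ 2 $ 1) / 2)"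

definition mat_of :: "complex \<Rightarrow> complex \<Rightarrow> mat2" where
  "mat_of a b = vector [vector [Re a + Re b, Im b - Im a], vector [Im a + Im b, Re a - Re b]]"

lemma coord_mat_of [simp]: "coordA (mat_of a b) = a" "coordB (mat_of a b) = b"
  by (simp_all add: coordA_def coordB_def mat_of_def complex_eq_iff)

lemma mat_of_coord [simp]: "mat_of (coordA g) (coordB g) = g"
  by (simp add: coordA_def coordB_def mat_of_def vec_eq_iff forall_2 field_simps)

lemma mat2_eqI: "coordA g = coordA h \<Longrightarrow> coordB g = coordB h \<Longrightarrow> g = h"
  by (metis mat_of_coord)

lemma linear_coord: "linear coordA" "linear coordB"
  by (auto intro!: linearI simp: coordA_def coordB_def complex_eq_iff field_simps)

lemma bounded_linear_coord: "bounded_linear coordA" "bounded_linear coordB"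
  using linear_coord by (simp_all add: linear_conv_bounded_linear)

lemma coord_mult:
  "coordA (g ** h) = coordA g * coordA h + coordB g * cnj (coordB h)"
  "coordB (g ** h) = coordA g * coordB h + coordB g * cnj (coordA h)"
  by (simp_all add: coordA_def coordB_def matrix_matrix_mult_def sum_2 complex_eq_iff field_simps)

lemma coord_mat_1 [simp]: "coordA (mat 1) = 1" "coordB (mat 1) = 0"
  by (simp_all add: coordA_def coordB_def mat_def complex_eq_iff)

lemma det_coord: "det g = (cmod (coordA g))\<^sup>2 - (cmod (coordB g))\<^sup>2"
  unfolding cmod_power2 det_2 by (simp add: coordA_def coordB_def power_divide field_simps) (simp add: power2_eq_square algebra_simps)

lemma SL2_norm_coord: "g \<in> SL2 \<Longrightarrow> (cmod (coordA g))\<^sup>2 = 1 + (cmod (coordB g))\<^sup>2"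
  by (simp add: SL2_def det_coord)

lemma coord_linear [simp]:
  "coordA (g + h) = coordA g + coordA h" "coordB (g + h) = coordB g + coordB h"
  "coordA (x *\<^sub>R g) = x * coordA g" "coordB (x *\<^sub>R g) = x * coordB g"
  using linear_coord by (simp_all add: linear_add linear_scale scaleR_conv_of_real[where 'a = complex])

lemma coord_basis [simp]:
  "coordA p1 = 0" "coordB p1 = 1 / 2" "coordA p2 = 0" "coordB p2 = \<i> / 2"
  "coordA kappa = \<i> / 2" "coordB kappa = 0"
  by (simp_all add: coordA_def coordB_def p1_def p2_def kappa_def complex_eq_iff)

lemma inner_coord: "g \<bullet> g = 2 * ((cmod (coordA g))\<^sup>2 + (cmod (coordB g))\<^sup>2)" for g :: mat2
  unfolding cmod_power2 by (simp add: inner_vec_def UNIV_2 coordA_def coordB_def power_divide field_simps) (simp add: power2_eq_square algebra_simps)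

lemma span_p: "v \<in> span {p1, p2} \<longleftrightarrow> (\<exists>x y. v = x *\<^sub>R p1 + y *\<^sub>R p2)"
  by (auto simp: span_insert algebra_simps)

lemma matrix_inv_SL2:
  assumes "g \<in> SL2"
  shows "matrix_inv g ** g = mat 1"
proof -
  have "invertible g" using assms by (simp add: invertible_det_nz SL2_def)
  then show ?thesis unfolding invertible_def matrix_inv_def by (rule someI2_ex) simp
qed

lemma sr_inner_translate:
  assumes "g \<in> SL2" "coordA v = coordB g * cnj u / 2" "coordB v = coordA g * u / 2"
  shows "sr_inner g v v = (cmod u)\<^sup>2"
proof -
  have "v = g ** mat_of 0 (u / 2)"
    by (rule mat2_eqI) (simp_all add: coord_mult assms)
  then have "matrix_inv g ** v = mat_of 0 (u / 2)"
    by (simp add: matrix_mul_assoc matrix_inv_SL2[OF assms(1)])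
  then show ?thesis by (simp add: sr_inner_def inner_coord norm_divide power_divide)
qed

lemma distrib_D_iff:
  "v \<in> distrib_D g \<longleftrightarrow> (\<exists>u. coordA v = coordB g * cnj u / 2 \<and> coordB v = coordA g * u / 2)"
proof
  assume "v \<in> distrib_D g"
  then obtain x y where "v = g ** (x *\<^sub>R p1 + y *\<^sub>R p2)" by (auto simp: distrib_D_def span_p)
  then show "\<exists>u. coordA v = coordB g * cnj u / 2 \<and> coordB v = coordA g * u / 2"
    by (intro exI[of _ "Complex x y"]) (simp add: coord_mult complex_eq_iff)
next
  assume "\<exists>u. coordA v = coordB g * cnj u / 2 \<and> coordB v = coordA g * u / 2"
  then obtain u where u: "coordA v = coordB g * cnj u / 2" "coordB v = coordA g * u / 2" by blast
  have "v = g ** (Re u *\<^sub>R p1 + Im u *\<^sub>R p2)"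
    by (rule mat2_eqI) (simp_all add: coord_mult u complex_eq_iff)
  then show "v \<in> distrib_D g" unfolding distrib_D_def using span_p by blast
qed

lemma sr_speed_nonneg: "sr_speed c t \<ge> 0"
  by (simp add: sr_speed_def sr_inner_def)

text \<open>Outside a finite set, a horizontal curve has a control \<open>u\<close> that determines both its velocity
  and its speed.\<close>
lemma horizontal_onE:
  assumes "horizontal_on c a b"
  obtains S u where "finite S"
    "\<And>t. t \<in> {a..b} - S \<Longrightarrow> ((\<lambda>t. coordA (c t)) has_vector_derivative coordB (c t) * cnj (u t) / 2) (at t)"
    "\<And>t. t \<in> {a..b} - S \<Longrightarrow> ((\<lambda>t. coordB (c t)) has_vector_derivative coordA (c t) * u t / 2) (at t)"
    "\<And>t. t \<in> {a..b} - S \<Longrightarrow> sr_speed c t = cmod (u t)"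
proof -
  obtain S1 where S1: "finite S1" "c C1_differentiable_on {a..b} - S1"
    using assms by (auto simp: horizontal_on_def piecewise_C1_differentiable_on_def)
  obtain S2 where S2: "finite S2" "\<And>t. t \<in> {a..b} - S2 \<Longrightarrow> vector_derivative c (at t) \<in> distrib_D (c t)"
    using assms by (auto simp: horizontal_on_def)
  have "\<exists>u. ((\<lambda>t. coordA (c t)) has_vector_derivative coordB (c t) * cnj u / 2) (at t) \<and>
    ((\<lambda>t. coordB (c t)) has_vector_derivative coordA (c t) * u / 2) (at t) \<and> sr_speed c t = cmod u"
    if t: "t \<in> {a..b} - (S1 \<union> S2)" for t
  proof -
    let ?v = "vector_derivative c (at t)"
    have d: "(c has_vector_derivative ?v) (at t)"
      using S1(2) t by (auto simp: C1_differentiable_on_eq vector_derivative_works)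
    obtain u where u: "coordA ?v = coordB (c t) * cnj u / 2" "coordB ?v = coordA (c t) * u / 2"
      using S2(2)[of t] t by (auto simp: distrib_D_iff)
    have "c t \<in> SL2" using assms t by (auto simp: horizontal_on_def)
    from sr_inner_translate[OF this u] have "sr_speed c t = cmod u" by (simp add: sr_speed_def)
    with bounded_linear.has_vector_derivative[OF bounded_linear_coord(1) d]
      bounded_linear.has_vector_derivative[OF bounded_linear_coord(2) d] u
    show ?thesis by auto
  qed
  then obtain u where "\<And>t. t \<in> {a..b} - (S1 \<union> S2) \<Longrightarrow>
      ((\<lambda>t. coordA (c t)) has_vector_derivative coordB (c t) * cnj (u t) / 2) (at t) \<and>
      ((\<lambda>t. coordB (c t)) has_vector_derivative coordA (c t) * u t / 2) (at t) \<and> sr_speed c t = cmod (u t)"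
    by metis
  with S1(1) S2(1) show thesis by (intro that[of "S1 \<union> S2" u]) blast+
qed

section \<open>Calibrations and the length of horizontal curves\<close>

text \<open>Locally the lift is \<open>z t - 2 Im (Ln (A s / A t))\<close>, because by continuity the argument of
  \<open>A s / A t\<close> is the principal one for \<open>s\<close> near \<open>t\<close>; and \<open>Ln\<close> is differentiable at \<open>1\<close>.\<close>
lemma argument_lift_deriv:
  fixes A :: "real \<Rightarrow> complex" and z :: "real \<Rightarrow> real"
  assumes t: "a < t" "t < b" and A: "(A has_vector_derivative A') (at t)"
    and z: "continuous_on {a..b} z" and lift: "\<And>s. s \<in> {a..b} \<Longrightarrow> A s = cmod (A s) * cis (- z s / 2)"
    and nz: "\<And>s. s \<in> {a..b} \<Longrightarrow> A s \<noteq> 0"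
  shows "(z has_real_derivative - 2 * Im (A' / A t)) (at t)"
proof -
  have "isCont z t" using z t by (simp add: continuous_on_interior)
  then have "eventually (\<lambda>s. dist (z s) (z t) < 2 * pi) (nhds t)"
    by (auto simp: isCont_def tendsto_iff eventually_at_filter elim!: allE[of _ "2 * pi"] elim: eventually_mono)
  moreover have "eventually (\<lambda>s. s \<in> {a<..<b}) (nhds t)"
    using t by (intro eventually_nhds_in_open) auto
  ultimately have ev: "eventually (\<lambda>s. z t - 2 * Im (Ln (A s / A t)) = z s) (nhds t)"
  proof eventually_elim
    case (elim s)
    have "A s / A t = (cmod (A s) * cis (- z s / 2)) / (cmod (A t) * cis (- z t / 2))"
      using lift[of s] lift[of t] t elim by simp
    also have "\<dots> = of_real (cmod (A s) / cmod (A t)) * cis ((z t - z s) / 2)"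
      by (simp add: cis_divide diff_divide_distrib flip: times_divide_times_eq)
    also have "\<dots> = exp (Complex (ln (cmod (A s) / cmod (A t))) ((z t - z s) / 2))"
      using nz[of s] nz[of t] t elim by (simp add: exp_eq_polar)
    finally have "Ln (A s / A t) = Complex (ln (cmod (A s) / cmod (A t))) ((z t - z s) / 2)"
      using elim(1) by (simp add: dist_real_def abs_if split: if_splits)
    then show ?case by (simp add: field_simps)
  qed
  have nzt: "A t \<noteq> 0" using nz[of t] t by simp
  have "((\<lambda>s. A s / A t) has_vector_derivative A' / A t) (at t)"
    by (rule has_vector_derivative_divide[OF A])
  from field_vector_diff_chain_at[OF this, of Ln 1]
  have "((\<lambda>s. Ln (A s / A t)) has_vector_derivative A' / A t) (at t)"
    using nzt has_field_derivative_Ln[of 1] by (simp add: o_def)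
  from bounded_linear.has_vector_derivative[OF bounded_linear_Im this]
  have "((\<lambda>s. Im (Ln (A s / A t))) has_real_derivative Im (A' / A t)) (at t)"
    by (simp add: has_real_derivative_iff_has_vector_derivative)
  then have "((\<lambda>s. z t - 2 * Im (Ln (A s / A t))) has_real_derivative - 2 * Im (A' / A t)) (at t)"
    using DERIV_diff[OF DERIV_const DERIV_cmult[of _ _ _ _ 2]] by fastforce
  then show ?thesis using DERIV_cong_ev[OF refl ev refl] by simp
qed

text \<open>The differential \<open>\<beta> dz + \<rho> dP\<close> has norm at most \<open>1\<close>. With \<open>Y = y\<close> this is the Cauchy-Schwarz
  inequality, and the norm is then exactly \<open>1\<close>. A larger \<open>Y\<close> only makes the radial component smaller,
  which leaves room for the regularisation in the next lemma.\<close>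
lemma calibration_ineq:
  fixes \<beta> \<rho> y Y I R U :: real
  assumes "0 \<le> y" "y \<le> Y" "0 < Y" "1 + (1 - \<beta>\<^sup>2) * y \<ge> 0" "I\<^sup>2 + R\<^sup>2 = y * (1 + y) * U\<^sup>2" "0 \<le> U" "\<rho>\<^sup>2 = 1"
  shows "\<beta> * (I / (1 + y)) + \<rho> * (2 * sqrt (max 0 (1 + (1 - \<beta>\<^sup>2) * Y)) / (1 + Y) * (R / (2 * sqrt Y))) \<le> U"
proof (rule power2_le_imp_le)
  define G where "G = sqrt (max 0 (1 + (1 - \<beta>\<^sup>2) * Y)) / ((1 + Y) * sqrt Y)"
  have bound: "(\<beta>\<^sup>2 / (1 + y)\<^sup>2 + G\<^sup>2) * (y * (1 + y)) \<le> 1"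
  proof -
    have "G\<^sup>2 = max 0 (1 + (1 - \<beta>\<^sup>2) * Y) / ((1 + Y)\<^sup>2 * Y)"
      using assms by (simp add: G_def power_divide power_mult_distrib)
    also have "\<dots> * y \<le> (1 + (1 - \<beta>\<^sup>2) * y) / (1 + y)\<^sup>2"
    proof (cases "1 + (1 - \<beta>\<^sup>2) * Y \<ge> 0")
      case True
      have "\<beta>\<^sup>2 * y \<le> \<beta>\<^sup>2 * Y" using assms by (intro mult_left_mono) auto
      then have 1: "(1 + (1 - \<beta>\<^sup>2) * Y) / (1 + Y) \<le> (1 + (1 - \<beta>\<^sup>2) * y) / (1 + y)"
        using assms by (simp add: divide_simps algebra_simps)
      have "(1 + (1 - \<beta>\<^sup>2) * Y) / ((1 + Y)\<^sup>2 * Y) * y = (1 + (1 - \<beta>\<^sup>2) * Y) / (1 + Y) * ((1 / (1 + Y)) * (y / Y))"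
        by (simp add: power2_eq_square)
      also have "\<dots> \<le> (1 + (1 - \<beta>\<^sup>2) * y) / (1 + y) * ((1 / (1 + y)) * 1)"
        using 1 assms True by (intro mult_mono) (auto simp: divide_simps)
      finally show ?thesis using True by (simp add: power2_eq_square)
    qed (use assms in simp)
    finally have "(\<beta>\<^sup>2 / (1 + y)\<^sup>2 * y + G\<^sup>2 * y) * (1 + y)
        \<le> (\<beta>\<^sup>2 / (1 + y)\<^sup>2 * y + (1 + (1 - \<beta>\<^sup>2) * y) / (1 + y)\<^sup>2) * (1 + y)"
      using assms by (intro mult_right_mono add_left_mono) auto
    also have "\<dots> = 1"
    proof -
      have "\<beta>\<^sup>2 / (1 + y)\<^sup>2 * y + (1 + (1 - \<beta>\<^sup>2) * y) / (1 + y)\<^sup>2 = (1 + y) / (1 + y)\<^sup>2"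
        by (simp add: algebra_simps flip: add_divide_distrib)
      then show ?thesis using assms(1) by (simp add: power2_eq_square)
    qed
    finally show ?thesis by (simp add: distrib_right mult.assoc)
  qed
  have "\<beta> * (I / (1 + y)) + \<rho> * (2 * sqrt (max 0 (1 + (1 - \<beta>\<^sup>2) * Y)) / (1 + Y) * (R / (2 * sqrt Y)))
      = (\<beta> / (1 + y)) * I + (\<rho> * G) * R"
    by (simp add: G_def)
  moreover have "((\<beta> / (1 + y)) * I + (\<rho> * G) * R)\<^sup>2 \<le> ((\<beta> / (1 + y))\<^sup>2 + (\<rho> * G)\<^sup>2) * (I\<^sup>2 + R\<^sup>2)"
  proof -
    have "(p * I + q * R)\<^sup>2 + (p * R - q * I)\<^sup>2 = (p\<^sup>2 + q\<^sup>2) * (I\<^sup>2 + R\<^sup>2)" for p q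
      by algebra
    then show ?thesis using zero_le_power2[of "(\<beta> / (1 + y)) * R - (\<rho> * G) * I"]
      by (metis add.right_neutral add_left_mono)
  qed
  moreover have "((\<beta> / (1 + y))\<^sup>2 + (\<rho> * G)\<^sup>2) * (I\<^sup>2 + R\<^sup>2) = (\<beta>\<^sup>2 / (1 + y)\<^sup>2 + G\<^sup>2) * (y * (1 + y)) * U\<^sup>2"
    by (simp add: assms(5,7) power_mult_distrib power_divide)
  ultimately show "(\<beta> * (I / (1 + y)) + \<rho> * (2 * sqrt (max 0 (1 + (1 - \<beta>\<^sup>2) * Y)) / (1 + Y) * (R / (2 * sqrt Y))))\<^sup>2 \<le> U\<^sup>2"
    using mult_right_mono[OF bound, of "U\<^sup>2"] by simp
qed (fact assms)

text \<open>The rate of growth of \<open>\<beta> z + \<rho> P\<close> is at most the speed. The function \<open>\<bar>B\<bar>\<close> is not differentiable where it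
  vanishes, and a curve may return to the axis infinitely often. Therefore \<open>\<bar>B\<bar>\<close> is replaced by
  \<open>sqrt (\<bar>B\<bar>\<^sup>2 + e\<^sup>2)\<close>, for which the same bound holds, and then \<open>e\<close> tends to \<open>0\<close>.\<close>
lemma calibration_estimate:
  assumes hor: "horizontal_on c a b" and st: "a \<le> s" "s \<le> t" "t \<le> b"
    and z: "continuous_on {a..b} z"
    and lift: "\<And>r. r \<in> {a..b} \<Longrightarrow> coordA (c r) = cmod (coordA (c r)) * cis (- z r / 2)"
    and adm: "\<And>r. r \<in> {s..t} \<Longrightarrow> 1 + (1 - \<beta>\<^sup>2) * (cmod (coordB (c r)))\<^sup>2 \<ge> 0"
    and \<rho>: "\<rho>\<^sup>2 = 1"
  shows "\<beta> * (z t - z s) + \<rho> * (cal_P \<beta> (cmod (coordB (c t))) - cal_P \<beta> (cmod (coordB (c s))))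
    \<le> integral {s..t} (sr_speed c)"
proof -
  obtain S u where S: "finite S"
    and dA: "\<And>t. t \<in> {a..b} - S \<Longrightarrow> ((\<lambda>t. coordA (c t)) has_vector_derivative coordB (c t) * cnj (u t) / 2) (at t)"
    and dB: "\<And>t. t \<in> {a..b} - S \<Longrightarrow> ((\<lambda>t. coordB (c t)) has_vector_derivative coordA (c t) * u t / 2) (at t)"
    and speed: "\<And>t. t \<in> {a..b} - S \<Longrightarrow> sr_speed c t = cmod (u t)"
    using horizontal_onE[OF hor] by blast
  have SL2: "c r \<in> SL2" if "r \<in> {a..b}" for r using hor that by (auto simp: horizontal_on_def)
  have nz: "coordA (c r) \<noteq> 0" if "r \<in> {a..b}" for r
    using SL2_norm_coord[OF SL2[OF that]] by auto
  have "continuous_on {a..b} c" using hor by (simp add: horizontal_on_def piecewise_C1_differentiable_on_def)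
  then have contB: "continuous_on {s..t} (\<lambda>r. coordB (c r))"
    using st by (intro bounded_linear.continuous_on[OF bounded_linear_coord(2)]) (auto intro: continuous_on_subset)
  \<comment> \<open>The regularised modulus of \<open>B\<close>; it is positive for \<open>e > 0\<close>.\<close>
  define X where "X = (\<lambda>e r. sqrt ((cmod (coordB (c r)))\<^sup>2 + e\<^sup>2))"
  have approx: "\<beta> * (z t - z s) + \<rho> * (cal_P \<beta> (X e t) - cal_P \<beta> (X e s)) \<le> integral {s..t} (sr_speed c)"
    if e: "e > 0" for e
  proof -
    have Xpos: "X e r > 0" for r using e by (simp add: X_def add_nonneg_pos)
    define Q where "Q = (\<lambda>r. \<beta> * z r + \<rho> * cal_P \<beta> (X e r))"
    have "\<exists>d. (Q has_vector_derivative d) (at r) \<and> d \<le> sr_speed c r" if r: "r \<in> {s<..<t} - S" for r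
    proof -
      \<comment> \<open>The real and imaginary part of \<open>\<xi>\<close> are the derivatives of \<open>\<bar>B\<bar>\<^sup>2\<close> and, up to the factor \<open>1 + y\<close>, of \<open>z\<close>.\<close>
      define y \<xi> where "y = (cmod (coordB (c r)))\<^sup>2" and "\<xi> = cnj (coordB (c r)) * coordA (c r) * u r"
      have r': "r \<in> {a..b} - S" "a < r" "r < b" "r \<in> {a..b}" using r st by auto
      have q: "(cmod (coordA (c r)))\<^sup>2 = 1 + y" using SL2_norm_coord[OF SL2[OF r'(4)]] by (simp add: y_def)
      have "(z has_real_derivative - 2 * Im (coordB (c r) * cnj (u r) / 2 / coordA (c r))) (at r)"
        by (rule argument_lift_deriv[OF r'(2,3) dA[OF r'(1)] z lift nz])
      also have "- 2 * Im (coordB (c r) * cnj (u r) / 2 / coordA (c r)) = Im \<xi> / (1 + y)"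
      proof -
        have "coordB (c r) * cnj (u r) / 2 / coordA (c r) = cnj \<xi> / (2 * of_real ((cmod (coordA (c r)))\<^sup>2))"
          unfolding complex_norm_square \<xi>_def using nz[OF r'(4)] by simp
        also have "\<dots> = cnj \<xi> / of_real (2 * (1 + y))" unfolding q by simp
        finally have "- 2 * Im (coordB (c r) * cnj (u r) / 2 / coordA (c r)) = - 2 * (- Im \<xi> / (2 * (1 + y)))"
          by (simp only: Im_divide_of_real cnj.sel)
        also have "\<dots> = Im \<xi> / (1 + y)"
          using mult_divide_mult_cancel_left[of 2 "Im \<xi>" "1 + y"] by simp
        finally show ?thesis .
      qed
      finally have dz: "(z has_real_derivative Im \<xi> / (1 + y)) (at r)" .
      have dRe: "((\<lambda>r. Re (coordB (c r))) has_real_derivative Re (coordA (c r) * u r / 2)) (at r)"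
        and dIm: "((\<lambda>r. Im (coordB (c r))) has_real_derivative Im (coordA (c r) * u r / 2)) (at r)"
        using bounded_linear.has_vector_derivative[OF bounded_linear_Re dB[OF r'(1)]]
          bounded_linear.has_vector_derivative[OF bounded_linear_Im dB[OF r'(1)]]
        by (simp_all add: has_real_derivative_iff_has_vector_derivative)
      have dy: "((\<lambda>r. (cmod (coordB (c r)))\<^sup>2 + e\<^sup>2) has_real_derivative Re \<xi>) (at r)"
        unfolding cmod_power2
        using DERIV_add[OF DERIV_add[OF DERIV_power[OF dRe, of 2] DERIV_power[OF dIm, of 2]] DERIV_const[of "e\<^sup>2"]]
        by (rule DERIV_cong) (simp add: \<xi>_def field_simps)
      have dX: "(X e has_real_derivative inverse (sqrt (y + e\<^sup>2)) / 2 * Re \<xi>) (at r)"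
        unfolding X_def y_def
        by (rule DERIV_chain'[OF dy DERIV_real_sqrt]) (use e in \<open>simp add: add_nonneg_pos\<close>)
      let ?d = "\<beta> * (Im \<xi> / (1 + y)) + \<rho> * (2 * sqrt (max 0 (1 + (1 - \<beta>\<^sup>2) * (y + e\<^sup>2))) / (1 + (y + e\<^sup>2)) * (Re \<xi> / (2 * sqrt (y + e\<^sup>2))))"
      have Xsq: "(X e r)\<^sup>2 = y + e\<^sup>2" by (simp add: X_def y_def)
      have "((\<lambda>r. cal_P \<beta> (X e r)) has_real_derivative
          2 * sqrt (max 0 (1 + (1 - \<beta>\<^sup>2) * (X e r)\<^sup>2)) / (1 + (X e r)\<^sup>2) * (inverse (sqrt (y + e\<^sup>2)) / 2 * Re \<xi>)) (at r)"
        by (rule DERIV_chain2[OF cal_P_deriv[OF Xpos] dX])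
      moreover have "inverse (sqrt (y + e\<^sup>2)) / 2 * Re \<xi> = Re \<xi> / (2 * sqrt (y + e\<^sup>2))"
        by (simp only: divide_inverse inverse_mult_distrib mult_ac)
      ultimately have dP: "((\<lambda>r. cal_P \<beta> (X e r)) has_real_derivative
          2 * sqrt (max 0 (1 + (1 - \<beta>\<^sup>2) * (y + e\<^sup>2))) / (1 + (y + e\<^sup>2)) * (Re \<xi> / (2 * sqrt (y + e\<^sup>2)))) (at r)"
        by (simp only: Xsq)
      have "(Q has_real_derivative ?d) (at r)"
        unfolding Q_def by (intro DERIV_add DERIV_cmult dz dP)
      moreover have "?d \<le> cmod (u r)"
      proof (rule calibration_ineq)
        have "(Im \<xi>)\<^sup>2 + (Re \<xi>)\<^sup>2 = (cmod \<xi>)\<^sup>2" by (simp add: cmod_power2)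
        also have "\<dots> = y * (1 + y) * (cmod (u r))\<^sup>2"
          by (simp add: \<xi>_def norm_mult power_mult_distrib q flip: y_def)
        finally show "(Im \<xi>)\<^sup>2 + (Re \<xi>)\<^sup>2 = y * (1 + y) * (cmod (u r))\<^sup>2" .
        show "1 + (1 - \<beta>\<^sup>2) * y \<ge> 0" using adm[of r] r by (simp add: y_def)
      qed (use e \<rho> in \<open>auto simp: y_def add_nonneg_pos\<close>)
      ultimately show ?thesis
        using speed[OF r'(1)] by (auto simp: has_real_derivative_iff_has_vector_derivative)
    qed
    then obtain d where d: "\<And>r. r \<in> {s<..<t} - S \<Longrightarrow> (Q has_vector_derivative d r) (at r) \<and> d r \<le> sr_speed c r"
      by metis
    \<comment> \<open>At the finitely many exceptional times the integrand may be chosen freely; the speed makes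
      the comparison trivial there.\<close>
    define F where "F = (\<lambda>r. if r \<in> {s<..<t} - S then d r else sr_speed c r)"
    have "continuous_on {s..t} Q"
    proof -
      have "continuous_on {0<..} (cal_P \<beta>)"
        by (auto intro!: continuous_at_imp_continuous_on DERIV_isCont cal_P_deriv)
      then have "continuous_on {s..t} (\<lambda>r. cal_P \<beta> (X e r))"
        by (rule continuous_on_compose2) (use Xpos in \<open>auto simp: X_def intro!: continuous_intros contB\<close>)
      moreover have "continuous_on {s..t} z" using z by (rule continuous_on_subset) (use st in auto)
      ultimately show ?thesis unfolding Q_def by (intro continuous_intros)
    qed
    then have "(F has_integral (Q t - Q s)) {s..t}"
      using d by (intro fundamental_theorem_of_calculus_interior_strong[OF S st(2)]) (auto simp: F_def)
    moreover have "(sr_speed c has_integral integral {s..t} (sr_speed c)) {s..t}"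
    proof -
      have "sr_speed c integrable_on {a..b}" using hor by (simp add: horizontal_on_def)
      then show ?thesis using st by (intro integrable_integral) (auto intro: integrable_on_subinterval)
    qed
    ultimately have "Q t - Q s \<le> integral {s..t} (sr_speed c)"
      by (rule has_integral_le) (use d in \<open>auto simp: F_def\<close>)
    then show ?thesis by (simp add: Q_def algebra_simps)
  qed
  have cont: "continuous_on {0..1} (\<lambda>e. cal_P \<beta> (X e r))" for r
  proof -
    have "X e r \<le> sqrt ((cmod (coordB (c r)))\<^sup>2 + 1)" if "e \<in> {0..1}" for e
      using that by (simp add: X_def power_le_one)
    then show ?thesis
      by (intro continuous_on_compose2[OF continuous_on_cal_P[of "sqrt ((cmod (coordB (c r)))\<^sup>2 + 1)"]])
        (auto simp: X_def intro!: continuous_intros)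
  qed
  have "\<beta> * (z t - z s) + \<rho> * (cal_P \<beta> (X 0 t) - cal_P \<beta> (X 0 s)) \<le> integral {s..t} (sr_speed c)"
    by (rule continuous_le_on_closure[of "{0<..1}"])
      (auto intro!: continuous_intros cont approx)
  then show ?thesis by (simp add: X_def)
qed

section \<open>Geodesics as horizontal curves\<close>

lemma scaleR_matrix_mult: "(x *\<^sub>R A) ** B = x *\<^sub>R (A ** B)" "A ** (x *\<^sub>R B) = x *\<^sub>R (A ** B)" for A B :: mat2
  by (simp_all add: scalar_matrix_assoc matrix_scalar_ac flip: scalar_mult_eq_scaleR)

text \<open>The even powers of \<open>M\<close> are multiples of the identity and the odd ones are multiples of \<open>M\<close>.\<close>
lemma mexp_scalar_square:
  fixes M :: mat2
  assumes "M ** M = q *\<^sub>R mat 1"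
  shows "mexp M = cosh_root q *\<^sub>R mat 1 + sinhc_root q *\<^sub>R M"
proof -
  define f where "f = (\<lambda>n. ((**) M ^^ n) (mat 1))"
  have step: "f (Suc (Suc n)) = q *\<^sub>R f n" for n
    by (simp add: f_def matrix_mul_assoc assms scaleR_matrix_mult)
  have ev: "f (2 * n) = q ^ n *\<^sub>R mat 1" for n
    by (induction n) (simp_all add: step, simp add: f_def)
  have od: "f (2 * n + 1) = q ^ n *\<^sub>R M" for n
    by (induction n) (simp_all add: step, simp add: f_def)
  let ?e = "\<lambda>n. if even n then (1 / fact n) *\<^sub>R f n else 0"
  let ?o = "\<lambda>n. if odd n then (1 / fact n) *\<^sub>R f n else 0"
  have "(\<lambda>n. (q ^ n / fact (2 * n)) *\<^sub>R (mat 1 :: mat2)) sums (cosh_root q *\<^sub>R mat 1)"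
    by (intro sums_scaleR_left cosh_root_sums)
  then have "(\<lambda>n. ?e (2 * n)) sums (cosh_root q *\<^sub>R mat 1)" by (simp add: ev)
  then have 1: "?e sums (cosh_root q *\<^sub>R mat 1)"
    by (subst (asm) sums_mono_reindex) (auto simp: strict_mono_def elim!: evenE)
  have "(\<lambda>n. (q ^ n / fact (2 * n + 1)) *\<^sub>R M) sums (sinhc_root q *\<^sub>R M)"
    by (intro sums_scaleR_left sinhc_root_sums)
  then have "(\<lambda>n. ?o (2 * n + 1)) sums (sinhc_root q *\<^sub>R M)" unfolding od by simp
  then have 2: "?o sums (sinhc_root q *\<^sub>R M)"
    by (subst (asm) sums_mono_reindex) (auto simp: strict_mono_def elim!: oddE)
  have "(\<lambda>n. ?e n + ?o n) = (\<lambda>n. (1 / fact n) *\<^sub>R f n)" by auto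
  with sums_add[OF 1 2] show ?thesis by (simp add: mexp_def f_def sums_iff)
qed

lemma coord_uminus [simp]: "coordA (- g) = - coordA g" "coordB (- g) = - coordB g"
  using linear_coord by (simp_all add: linear_neg)

lemma sinhc_root_times: "s * sinhc_root (- s\<^sup>2) = sin s"
  by (cases "s = 0") (auto simp: sinhc_root_eq)

lemma coord_mexp_kappa: "coordA (mexp (\<theta> *\<^sub>R kappa)) = cis (\<theta> / 2)" "coordB (mexp (\<theta> *\<^sub>R kappa)) = 0"
proof -
  have "(\<theta> *\<^sub>R kappa) ** (\<theta> *\<^sub>R kappa) = (- (\<theta> / 2)\<^sup>2) *\<^sub>R mat 1"
    by (rule mat2_eqI) (simp_all add: coord_mult complex_eq_iff power2_eq_square)
  from mexp_scalar_square[OF this]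
  show "coordA (mexp (\<theta> *\<^sub>R kappa)) = cis (\<theta> / 2)" "coordB (mexp (\<theta> *\<^sub>R kappa)) = 0"
    using sinhc_root_times[of "\<theta> / 2"] cosh_root_eq(2)[of "\<theta> / 2"]
    by (simp_all add: complex_eq_iff mult_ac)
qed

lemma coord_geod:
  "coordA (geod \<beta> \<phi> t) = Complex (geo_c \<beta> t) (\<beta> * geo_s \<beta> t) * cis (- \<beta> * t / 2)"
  "coordB (geod \<beta> \<phi> t) = geo_s \<beta> t * cis (\<phi> + \<beta> * t / 2)"
proof -
  define M where "M = t *\<^sub>R (cos \<phi> *\<^sub>R p1 + sin \<phi> *\<^sub>R p2 + \<beta> *\<^sub>R kappa)"
  have M: "coordA M = \<i> * (t * \<beta> / 2)" "coordB M = t / 2 * cis \<phi>"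
    by (simp_all add: M_def complex_eq_iff)
  have "coordA (M ** M) = complex_of_real ((1 - \<beta>\<^sup>2) * t\<^sup>2 / 4)"
    unfolding coord_mult M complex_norm_square[symmetric]
    by (simp add: norm_mult norm_divide power_divide power2_eq_square field_simps)
  moreover have "coordB (M ** M) = 0" unfolding coord_mult M by simp
  ultimately have "M ** M = ((1 - \<beta>\<^sup>2) * t\<^sup>2 / 4) *\<^sub>R mat 1"
    by (intro mat2_eqI) simp_all
  from mexp_scalar_square[OF this]
  have e: "coordA (mexp M) = Complex (geo_c \<beta> t) (\<beta> * geo_s \<beta> t)" "coordB (mexp M) = geo_s \<beta> t * cis \<phi>"
    by (simp_all add: M geo_c_def geo_s_def complex_eq_iff)
  have "geod \<beta> \<phi> t = mexp M ** mexp ((- (t * \<beta>)) *\<^sub>R kappa)" by (simp add: geod_def M_def)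
  then show "coordA (geod \<beta> \<phi> t) = Complex (geo_c \<beta> t) (\<beta> * geo_s \<beta> t) * cis (- \<beta> * t / 2)"
    "coordB (geod \<beta> \<phi> t) = geo_s \<beta> t * cis (\<phi> + \<beta> * t / 2)"
    using coord_mexp_kappa[of "- (t * \<beta>)"]
    by (simp_all add: coord_mult e cis_cnj cis_mult mult_ac)
qed

lemma geod_0 [simp]: "geod \<beta> \<phi> 0 = mat 1"
  by (rule mat2_eqI) (simp_all add: coord_geod complex_eq_iff)

lemma cmod_geo: "(cmod (Complex (geo_c \<beta> t) (\<beta> * geo_s \<beta> t)))\<^sup>2 = 1 + (geo_s \<beta> t)\<^sup>2"
  using geo_c_s[of \<beta> t] by (simp add: cmod_power2 power_mult_distrib algebra_simps)

lemma cmod_coord_geod: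
  "cmod (coordA (geod \<beta> \<phi> t)) = sqrt (1 + (geo_s \<beta> t)\<^sup>2)" "cmod (coordB (geod \<beta> \<phi> t)) = \<bar>geo_s \<beta> t\<bar>"
  unfolding coord_geod cmod_geo[symmetric] by (simp_all add: norm_mult)

lemma geod_SL2: "geod \<beta> \<phi> t \<in> SL2"
  by (simp add: SL2_def det_coord cmod_coord_geod)

lemma coordA_geod_polar:
  assumes "t \<ge> 0"
  shows "coordA (geod \<beta> \<phi> t) = sqrt (1 + (geo_s \<beta> t)\<^sup>2) * cis (- geo_z \<beta> t / 2)"
  unfolding coord_geod geo_polar[OF assms] mult.assoc cis_mult
  by (simp add: geo_psi_def field_simps)

lemma has_vector_derivative_cis_affine:
  "((\<lambda>t. cis (a + b * t)) has_vector_derivative (b * \<i> * cis (a + b * t))) (at t)"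
  unfolding has_vector_derivative_complex_iff
  by (auto intro!: derivative_eq_intros)

text \<open>A geodesic is horizontal, and its control \<open>u\<close> turns with the constant speed \<open>\<beta>\<close>.\<close>
lemma coord_geod_deriv:
  fixes \<beta> \<phi> t :: real
  defines "u \<equiv> cis (\<phi> + \<beta> * t)"
  shows "((\<lambda>t. coordA (geod \<beta> \<phi> t)) has_vector_derivative coordB (geod \<beta> \<phi> t) * cnj u / 2) (at t)"
    "((\<lambda>t. coordB (geod \<beta> \<phi> t)) has_vector_derivative coordA (geod \<beta> \<phi> t) * u / 2) (at t)"
proof -
  define W where "W = (\<lambda>t. Complex (geo_c \<beta> t) (\<beta> * geo_s \<beta> t))"
  have dW: "(W has_vector_derivative Complex ((1 - \<beta>\<^sup>2) / 2 * geo_s \<beta> t) (\<beta> * (geo_c \<beta> t / 2))) (at t)"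
    unfolding has_vector_derivative_complex_iff W_def
    using geo_c_deriv[of \<beta> t] DERIV_cmult[OF geo_s_deriv[of \<beta> t], of \<beta>] by simp
  have dS: "((\<lambda>t. complex_of_real (geo_s \<beta> t)) has_vector_derivative of_real (geo_c \<beta> t / 2)) (at t)"
    by (intro has_vector_derivative_of_real geo_s_deriv)
  have "((\<lambda>t. W t * cis (0 + (- \<beta> / 2) * t)) has_vector_derivative
      W t * ((- \<beta> / 2) * \<i> * cis (0 + (- \<beta> / 2) * t)) +
      Complex ((1 - \<beta>\<^sup>2) / 2 * geo_s \<beta> t) (\<beta> * (geo_c \<beta> t / 2)) * cis (0 + (- \<beta> / 2) * t)) (at t)"
    using has_vector_derivative_mult[OF dW has_vector_derivative_cis_affine[of 0 "- \<beta> / 2" t]] by simp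
  also have "W t * ((- \<beta> / 2) * \<i> * cis (0 + (- \<beta> / 2) * t)) +
      Complex ((1 - \<beta>\<^sup>2) / 2 * geo_s \<beta> t) (\<beta> * (geo_c \<beta> t / 2)) * cis (0 + (- \<beta> / 2) * t)
      = (W t * ((- \<beta> / 2) * \<i>) + Complex ((1 - \<beta>\<^sup>2) / 2 * geo_s \<beta> t) (\<beta> * (geo_c \<beta> t / 2))) * cis (- \<beta> * t / 2)"
    by (simp add: algebra_simps)
  also have "W t * ((- \<beta> / 2) * \<i>) + Complex ((1 - \<beta>\<^sup>2) / 2 * geo_s \<beta> t) (\<beta> * (geo_c \<beta> t / 2)) = of_real (geo_s \<beta> t / 2)"
    by (simp add: W_def complex_eq_iff field_simps power2_eq_square)
  also have "of_real (geo_s \<beta> t / 2) * cis (- \<beta> * t / 2) = coordB (geod \<beta> \<phi> t) * cnj u / 2"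
    by (simp add: coord_geod u_def cis_cnj cis_mult field_simps)
  finally show "((\<lambda>t. coordA (geod \<beta> \<phi> t)) has_vector_derivative coordB (geod \<beta> \<phi> t) * cnj u / 2) (at t)"
    by (simp add: coord_geod W_def)
  have "((\<lambda>t. geo_s \<beta> t * cis (\<phi> + (\<beta> / 2) * t)) has_vector_derivative
      geo_s \<beta> t * ((\<beta> / 2) * \<i> * cis (\<phi> + (\<beta> / 2) * t)) + of_real (geo_c \<beta> t / 2) * cis (\<phi> + (\<beta> / 2) * t)) (at t)"
    using has_vector_derivative_mult[OF dS has_vector_derivative_cis_affine[of \<phi> "\<beta> / 2" t]] by simp
  also have "geo_s \<beta> t * ((\<beta> / 2) * \<i> * cis (\<phi> + (\<beta> / 2) * t)) + of_real (geo_c \<beta> t / 2) * cis (\<phi> + (\<beta> / 2) * t)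
      = (geo_s \<beta> t * ((\<beta> / 2) * \<i>) + of_real (geo_c \<beta> t / 2)) * cis (\<phi> + \<beta> * t / 2)"
    by (simp add: algebra_simps)
  also have "geo_s \<beta> t * ((\<beta> / 2) * \<i>) + of_real (geo_c \<beta> t / 2) = W t / 2"
    by (simp add: W_def complex_eq_iff)
  also have "W t / 2 * cis (\<phi> + \<beta> * t / 2) = coordA (geod \<beta> \<phi> t) * u / 2"
    by (simp add: coord_geod u_def W_def cis_mult mult.assoc) (simp add: field_simps)
  finally show "((\<lambda>t. coordB (geod \<beta> \<phi> t)) has_vector_derivative coordA (geod \<beta> \<phi> t) * u / 2) (at t)"
    by (simp add: coord_geod)
qed

lemma bounded_linear_mat_of: "bounded_linear (\<lambda>p. mat_of (fst p) (snd p))"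
proof -
  have "linear (\<lambda>p. mat_of (fst p) (snd p))"
    by (rule linearI; rule mat2_eqI) (simp_all add: scaleR_conv_of_real[where 'a = complex])
  then show ?thesis by (simp add: linear_conv_bounded_linear)
qed

text \<open>Velocities of geodesics are computed in the complex coordinates and then carried back to
  matrices.\<close>
lemma has_vector_derivative_coordI:
  assumes "((\<lambda>t. coordA (c t)) has_vector_derivative a) (at t)"
    "((\<lambda>t. coordB (c t)) has_vector_derivative b) (at t)"
  shows "(c has_vector_derivative mat_of a b) (at t)"
proof -
  have "((\<lambda>t. (coordA (c t), coordB (c t))) has_vector_derivative (a, b)) (at t)"
    by (rule has_vector_derivative_Pair) (rule assms)+
  from bounded_linear.has_vector_derivative[OF bounded_linear_mat_of this] show ?thesis by simp
qed

text \<open>The factor \<open>l\<close> serves two purposes: with \<open>l = 1\<close> this is the parametrisation by arclength, and with \<open>l\<close> equal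
  to the length it is the parametrisation on the unit interval required by \<open>cc_dist\<close>.\<close>
lemma geod_reparam_deriv:
  "((\<lambda>\<tau>. geod \<beta> \<phi> (l * \<tau>)) has_vector_derivative
     mat_of (coordB (geod \<beta> \<phi> (l * \<tau>)) * cnj (l * cis (\<phi> + \<beta> * (l * \<tau>))) / 2)
            (coordA (geod \<beta> \<phi> (l * \<tau>)) * (l * cis (\<phi> + \<beta> * (l * \<tau>))) / 2)) (at \<tau>)"
proof (rule has_vector_derivative_coordI)
  have l: "((*) l has_vector_derivative l) (at \<tau>)"
    by (auto intro!: derivative_eq_intros simp: has_real_derivative_iff_has_vector_derivative[symmetric])
  show "((\<lambda>\<tau>. coordA (geod \<beta> \<phi> (l * \<tau>))) has_vector_derivative
      coordB (geod \<beta> \<phi> (l * \<tau>)) * cnj (l * cis (\<phi> + \<beta> * (l * \<tau>))) / 2) (at \<tau>)"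
    using vector_diff_chain_at[OF l coord_geod_deriv(1)] by (simp add: o_def scaleR_conv_of_real mult_ac)
  show "((\<lambda>\<tau>. coordB (geod \<beta> \<phi> (l * \<tau>))) has_vector_derivative
      coordA (geod \<beta> \<phi> (l * \<tau>)) * (l * cis (\<phi> + \<beta> * (l * \<tau>))) / 2) (at \<tau>)"
    using vector_diff_chain_at[OF l coord_geod_deriv(2)] by (simp add: o_def scaleR_conv_of_real mult_ac)
qed

lemma sr_speed_geod:
  assumes "l \<ge> 0"
  shows "sr_speed (\<lambda>\<tau>. geod \<beta> \<phi> (l * \<tau>)) \<tau> = l"
proof -
  have "sr_inner (geod \<beta> \<phi> (l * \<tau>)) v v = (cmod (l * cis (\<phi> + \<beta> * (l * \<tau>))))\<^sup>2"
    if "v = vector_derivative (\<lambda>\<tau>. geod \<beta> \<phi> (l * \<tau>)) (at \<tau>)" for v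
    by (rule sr_inner_translate[OF geod_SL2]) (simp_all add: that vector_derivative_at[OF geod_reparam_deriv])
  then show ?thesis using assms by (simp add: sr_speed_def norm_mult)
qed

lemma horizontal_geod:
  assumes "l \<ge> 0"
  shows "horizontal_on (\<lambda>\<tau>. geod \<beta> \<phi> (l * \<tau>)) a b"
  unfolding horizontal_on_def
proof (intro conjI exI[of _ "{}"])
  let ?c = "\<lambda>\<tau>. geod \<beta> \<phi> (l * \<tau>)"
  have cont: "continuous_on A ?c" for A
    by (intro continuous_at_imp_continuous_on ballI has_vector_derivative_continuous[OF geod_reparam_deriv])
  have contc: "continuous_on A (\<lambda>\<tau>. coordA (?c \<tau>))" "continuous_on A (\<lambda>\<tau>. coordB (?c \<tau>))" for A
    using cont by (intro bounded_linear.continuous_on[OF bounded_linear_coord(1)] bounded_linear.continuous_on[OF bounded_linear_coord(2)]; simp)+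
  have contm: "continuous_on A (\<lambda>\<tau>. mat_of (f \<tau>) (h \<tau>))" if "continuous_on A f" "continuous_on A h" for A :: "real set" and f h
    using bounded_linear.continuous_on[OF bounded_linear_mat_of continuous_on_Pair[OF that]] by simp
  have "?c C1_differentiable_on {a..b}"
    unfolding C1_differentiable_on_def
    by (rule exI, rule conjI, rule ballI, rule geod_reparam_deriv) (auto intro!: contm contc continuous_intros)
  then show "?c piecewise_C1_differentiable_on {a..b}"
    by (rule C1_differentiable_imp_piecewise)
  show "?c ` {a..b} \<subseteq> SL2" using geod_SL2 by auto
  show "\<forall>\<tau>\<in>{a..b} - {}. vector_derivative ?c (at \<tau>) \<in> distrib_D (?c \<tau>)"
  proof
    fix \<tau>
    show "vector_derivative ?c (at \<tau>) \<in> distrib_D (?c \<tau>)"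
      unfolding distrib_D_iff vector_derivative_at[OF geod_reparam_deriv]
      by (rule exI[of _ "l * cis (\<phi> + \<beta> * (l * \<tau>))"]) simp
  qed
  show "sr_speed ?c integrable_on {a..b}"
    using sr_speed_geod[OF assms] by (simp add: integrable_const_ivl cong: integrable_cong)
qed simp

lemma sr_length_geod:
  assumes "l \<ge> 0" "a \<le> b"
  shows "integral {a..b} (sr_speed (\<lambda>\<tau>. geod \<beta> \<phi> (l * \<tau>))) = l * (b - a)"
  using assms sr_speed_geod[OF assms(1)] by (simp cong: integral_cong)

lemma cc_dist_le:
  assumes "horizontal_on c 0 1"
  shows "cc_dist (c 0) (c 1) \<le> sr_length c 0 1"
  unfolding cc_dist_def
proof (rule cInf_lower)
  show "bdd_below {sr_length d 0 1 |d. horizontal_on d 0 1 \<and> d 0 = c 0 \<and> d 1 = c 1}"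
    by (rule bdd_belowI[of _ 0]) (auto simp: sr_length_def horizontal_on_def intro!: integral_nonneg sr_speed_nonneg)
qed (use assms in blast)

lemma cc_dist_geod_le:
  assumes "t \<ge> 0"
  shows "cc_dist (mat 1) (geod \<beta> \<phi> t) \<le> t"
  using cc_dist_le[OF horizontal_geod[OF assms], of \<beta> \<phi>] sr_length_geod[OF assms, of 0 1 \<beta> \<phi>]
  by (simp add: sr_length_def)

lemma cc_dist_geod_ge:
  assumes "t \<ge> 0"
    and "\<And>c. horizontal_on c 0 1 \<Longrightarrow> c 0 = mat 1 \<Longrightarrow> c 1 = geod \<beta> \<phi> t \<Longrightarrow> l \<le> sr_length c 0 1"
  shows "l \<le> cc_dist (mat 1) (geod \<beta> \<phi> t)"
  unfolding cc_dist_def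
proof (rule cInf_greatest)
  show "{sr_length c 0 1 |c. horizontal_on c 0 1 \<and> c 0 = mat 1 \<and> c 1 = geod \<beta> \<phi> t} \<noteq> {}"
    using horizontal_geod[OF assms(1), of \<beta> \<phi> 0 1] by fastforce
qed (use assms(2) in auto)

lemma shortest_arc_geod_iff:
  assumes "t \<ge> 0"
  shows "shortest_arc (geod \<beta> \<phi>) 0 t \<longleftrightarrow> cc_dist (mat 1) (geod \<beta> \<phi> t) = t"
  using horizontal_geod[of 1 \<beta> \<phi> 0 t] sr_length_geod[of 1 0 t \<beta> \<phi>] assms
  by (auto simp: shortest_arc_def sr_length_def)

text \<open>The calibration estimate for a geodesic of one curvature and a multiplier \<open>b\<close> that belongs to
  another one. For \<open>s = 0\<close>, \<open>\<rho> = 1\<close> and a time \<open>t\<close> before the turning point it says that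
  \<open>cal_P\<close>, as a function of \<open>b\<close>, lies below its tangent at \<open>\<beta>\<close>.\<close>
lemma geo_calibration:
  assumes "0 \<le> s" "s \<le> t" and adm: "\<And>r. r \<in> {s..t} \<Longrightarrow> 1 + (1 - b\<^sup>2) * (geo_s \<beta> r)\<^sup>2 \<ge> 0" and "\<rho>\<^sup>2 = 1"
  shows "b * (geo_z \<beta> t - geo_z \<beta> s) + \<rho> * (cal_P b \<bar>geo_s \<beta> t\<bar> - cal_P b \<bar>geo_s \<beta> s\<bar>) \<le> t - s"
proof -
  have "b * (geo_z \<beta> t - geo_z \<beta> s) + \<rho> * (cal_P b (cmod (coordB (geod \<beta> 0 (1 * t)))) - cal_P b (cmod (coordB (geod \<beta> 0 (1 * s)))))
     \<le> integral {s..t} (sr_speed (\<lambda>\<tau>. geod \<beta> 0 (1 * \<tau>)))"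
    by (rule calibration_estimate[OF horizontal_geod[of 1 \<beta> 0 0 t]])
      (use assms in \<open>auto intro!: continuous_on_geo_z simp: cmod_coord_geod coordA_geod_polar norm_mult simp del: real_sqrt_mult\<close>)
  then show ?thesis using sr_length_geod[of 1 s t \<beta> 0] assms(2) by (simp add: cmod_coord_geod)
qed

section \<open>Comparison of geodesics with arbitrary curves\<close>

text \<open>For \<open>\<beta> \<le> 1\<close> the projection of the geodesic never returns to its start; for \<open>\<beta> > 1\<close> it is a circle,
  traversed at most once up to the time \<open>t\<close>.\<close>
definition within_first_turn :: "real \<Rightarrow> real \<Rightarrow> bool" where
  "within_first_turn \<beta> t \<longleftrightarrow> 0 \<le> t \<and> (\<beta> \<le> 1 \<or> sqrt (\<beta>\<^sup>2 - 1) * t \<le> 2 * pi)"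

lemma geo_s_nonneg:
  assumes "0 \<le> \<beta>" "within_first_turn \<beta> t"
  shows "0 \<le> geo_s \<beta> t"
proof (cases "\<beta> \<le> 1")
  case True
  then show ?thesis
    using geo_s_mono[of 0 t \<beta>] geo_c_pos_if_le_1[of \<beta>] assms by (auto simp: within_first_turn_def less_imp_le)
next
  case False
  then have "sqrt (\<beta>\<^sup>2 - 1) > 0" using square_gt_1[of \<beta>] by simp
  then show ?thesis
    using geo_elliptic(2)[of \<beta> t] False assms
    by (auto simp: within_first_turn_def intro!: divide_nonneg_nonneg sin_ge_zero)
qed

lemma geo_psi_bounds:
  assumes "0 \<le> \<beta>" "within_first_turn \<beta> t"
  shows "0 \<le> geo_psi \<beta> t" "geo_psi \<beta> t \<le> pi"
proof -
  have t: "t \<ge> 0" using assms by (simp add: within_first_turn_def)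
  show "0 \<le> geo_psi \<beta> t"
    using geo_psi_mono[of \<beta> 0 t] assms t by (cases "\<beta> = 0") (auto simp: geo_psi_def geo_z_def)
  show "geo_psi \<beta> t \<le> pi"
  proof (cases "\<beta> \<le> 1")
    case True
    then show ?thesis using geo_psi_less_pi_half[of t \<beta>] geo_c_pos_if_le_1[of \<beta>] assms t by auto
  next
    case False
    then have "sqrt (\<beta>\<^sup>2 - 1) > 0" using square_gt_1[of \<beta>] by simp
    then have "t \<le> 2 * pi / sqrt (\<beta>\<^sup>2 - 1)" using False assms by (auto simp: within_first_turn_def field_simps)
    then show ?thesis using geo_psi_mono[of \<beta> t "2 * pi / sqrt (\<beta>\<^sup>2 - 1)"] geo_psi_half_turn(2)[of \<beta>] False t by auto
  qed
qed

text \<open>The function \<open>b \<mapsto> 2 \<pi> (b - sqrt (b\<^sup>2 - 1))\<close> is convex, with derivative minus the area of the full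
  circle; this is the tangent inequality at \<open>b'\<close>.\<close>
lemma turning_ineq:
  fixes b b' :: real
  assumes "b > 1" "b' > 1"
  defines "\<omega> \<equiv> sqrt (b\<^sup>2 - 1)" and "\<omega>' \<equiv> sqrt (b'\<^sup>2 - 1)"
  shows "2 * pi / \<omega>' \<le> b * (2 * pi * (b' / \<omega>' - 1)) + 2 * pi * (b - \<omega>)"
proof -
  have w: "\<omega> > 0" "\<omega>\<^sup>2 = b\<^sup>2 - 1" "\<omega>' > 0" "\<omega>'\<^sup>2 = b'\<^sup>2 - 1"
    using square_gt_1[of b] square_gt_1[of b'] assms by (simp_all add: \<omega>_def \<omega>'_def)
  have "\<omega> * \<omega>' \<le> b * b' - 1"
  proof (rule power2_le_imp_le)
    have "(\<omega> * \<omega>')\<^sup>2 = (b\<^sup>2 - 1) * (b'\<^sup>2 - 1)" by (simp add: power_mult_distrib w)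
    also have "\<dots> \<le> (b * b' - 1)\<^sup>2"
      using zero_le_power2[of "b - b'"] by (simp add: power2_eq_square algebra_simps)
    finally show "(\<omega> * \<omega>')\<^sup>2 \<le> (b * b' - 1)\<^sup>2" .
    show "0 \<le> b * b' - 1" using mult_mono[of 1 b 1 b'] assms by simp
  qed
  then have "1 / \<omega>' \<le> b * b' / \<omega>' - \<omega>" using w by (simp add: field_simps)
  then have "2 * pi * (1 / \<omega>') \<le> 2 * pi * (b * b' / \<omega>' - \<omega>)" by (intro mult_left_mono) auto
  then show ?thesis by (simp add: algebra_simps)
qed

text \<open>Here \<open>X\<close> stands for the largest value of \<open>\<bar>B\<bar>\<close> on a competing curve. If the geodesic is still moving
  away from the axis and its own multiplier is usable up to \<open>X\<close>, this multiplier is the right one.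
  Otherwise the multiplier is \<open>b = sqrt (1 + 1 / X\<^sup>2)\<close>, for which circles turn back
  exactly at \<open>X\<close>: then \<open>2 cal_P b X\<close> is the explicit value for a full circle, to which
  \<open>turning_ineq\<close> applies, and \<open>cal_P b (geo_s \<beta> t)\<close> is bounded by the calibration of the given geodesic.
  If the geodesic is moving back to the axis, the calibrated piece is the rest of its circle.\<close>
lemma competitor_bound:
  assumes b1: "0 \<le> \<beta>" and t1: "within_first_turn \<beta> t" and X: "0 < X" "geo_s \<beta> t \<le> X"
  obtains b where "0 \<le> b" "0 < \<beta> \<Longrightarrow> 0 < b" "1 + (1 - b\<^sup>2) * X\<^sup>2 \<ge> 0"
    "t \<le> b * geo_z \<beta> t + 2 * cal_P b X - cal_P b (geo_s \<beta> t)"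
proof -
  have t0: "t \<ge> 0" using t1 by (simp add: within_first_turn_def)
  have x0: "0 \<le> geo_s \<beta> t" using geo_s_nonneg[OF b1 t1] .
  define b where "b = sqrt (1 + 1 / X\<^sup>2)"
  have b2: "b\<^sup>2 = 1 + 1 / X\<^sup>2" by (simp add: b_def)
  have b: "b > 1" using X by (simp add: b_def)
  have wb: "sqrt (b\<^sup>2 - 1) = 1 / X" using X by (simp add: b2 real_sqrt_divide)
  have admb: "1 + (1 - b\<^sup>2) * X\<^sup>2 = 0" using X by (simp add: b2)
  have PX: "2 * cal_P b X = 2 * pi * (b - sqrt (b\<^sup>2 - 1))"
    using cal_P_turning[OF b] X by (simp add: wb)
  have adm: "1 + (1 - b\<^sup>2) * s\<^sup>2 \<ge> 0" if "0 \<le> s" "s \<le> X" for s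
    using admissible_mono[of s X b] that admb by simp
  define \<omega> where "\<omega> = sqrt (\<beta>\<^sup>2 - 1)"
  have e: "\<omega> > 0" "\<omega>\<^sup>2 = \<beta>\<^sup>2 - 1" "geo_s \<beta> s = sin (\<omega> * s / 2) / \<omega>" "geo_c \<beta> s = cos (\<omega> * s / 2)" if "\<beta> > 1" for s
    using that square_gt_1[of \<beta>] geo_elliptic[of \<beta> s] by (auto simp: \<omega>_def)
  have turn: "2 * pi / \<omega> \<le> b * geo_z \<beta> (2 * pi / \<omega>) + 2 * cal_P b X" if "\<beta> > 1"
    using turning_ineq[OF b that] geo_z_turn(2)[OF that] PX by (simp add: \<omega>_def)
  show thesis
  proof (cases "\<beta> \<le> 1 \<or> \<omega> * t \<le> pi")
    case True
    have C: "geo_c \<beta> r \<ge> 0" if r: "r \<in> {0..t}" for r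
    proof (cases "\<beta> \<le> 1")
      case True then show ?thesis using geo_c_pos_if_le_1[of \<beta> r] b1 by simp
    next
      case False
      then have w: "\<beta> > 1" by simp
      then have "0 \<le> \<omega> * r" "\<omega> * r \<le> \<omega> * t" "\<omega> * t \<le> pi" using True r e(1) False by auto
      then show ?thesis unfolding e(4)[OF w] by (intro cos_ge_zero) auto
    qed
    show thesis
    proof (cases "1 + (1 - \<beta>\<^sup>2) * X\<^sup>2 \<ge> 0")
      case True
      have "cal_P \<beta> (geo_s \<beta> t) \<le> cal_P \<beta> X" using cal_P_mono x0 X by blast
      moreover have "t = \<beta> * geo_z \<beta> t + cal_P \<beta> (geo_s \<beta> t)"
        using outgoing_time_eq[OF t0 C] by blast
      ultimately show thesis using True b1 by (intro that[of \<beta>]) auto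
    next
      case False
      have w: "\<beta> > 1"
      proof (rule ccontr)
        assume "\<not> \<beta> > 1"
        then have "\<beta>\<^sup>2 \<le> 1" using b1 by (simp add: power_le_one)
        with False show False by simp
      qed
      have "(b\<^sup>2 - 1) * X\<^sup>2 < (\<beta>\<^sup>2 - 1) * X\<^sup>2" using False admb by (simp add: algebra_simps)
      then have "b\<^sup>2 < \<beta>\<^sup>2" using X by simp
      then have "b < \<beta>" using b1 by (rule power2_less_imp_less)
      have tw: "\<omega> * t \<le> pi" using True w by auto
      have 1: "b * geo_z \<beta> t + cal_P b (geo_s \<beta> t) \<le> t"
      proof -
        have "1 + (1 - b\<^sup>2) * (geo_s \<beta> r)\<^sup>2 \<ge> 0" if "r \<in> {0..t}" for r
          using geo_s_mono[of 0 r \<beta>] geo_s_mono[of r t \<beta>] C that X by (intro adm) auto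
        \<comment> \<open>The tangent inequality for \<open>cal_P\<close> at \<open>\<beta>\<close>, evaluated at the smaller multiplier \<open>b\<close>.\<close>
        from geo_calibration[of 0 t b \<beta> 1, OF _ t0 this] show ?thesis using x0 by simp
      qed
      have half: "t \<le> pi / \<omega>" using tw e(1)[OF w] by (simp add: field_simps)
      \<comment> \<open>From \<open>t\<close> to the turning point the area grows at most at the rate \<open>1 / \<beta>\<close>.\<close>
      have 2: "\<beta> * (geo_z \<beta> (pi / \<omega>) - geo_z \<beta> t) \<le> pi / \<omega> - t"
      proof -
        have "1 + (1 - \<beta>\<^sup>2) * (geo_s \<beta> r)\<^sup>2 \<ge> 0" for r
        proof -
          have "1 + (1 - \<beta>\<^sup>2) * (geo_s \<beta> r)\<^sup>2 = (geo_c \<beta> r)\<^sup>2" using geo_c_s[of \<beta> r] by simp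
          then show ?thesis by simp
        qed
        then have "\<beta> * (geo_z \<beta> (pi / \<omega>) - geo_z \<beta> t) + (cal_P \<beta> \<bar>geo_s \<beta> (pi / \<omega>)\<bar> - cal_P \<beta> \<bar>geo_s \<beta> t\<bar>) \<le> pi / \<omega> - t"
          using geo_calibration[of t "pi / \<omega>" \<beta> \<beta> 1, OF t0 half] by simp
        moreover have "geo_s \<beta> t \<le> geo_s \<beta> (pi / \<omega>)"
          using e(1)[OF w] e(3)[OF w] by (simp add: divide_right_mono)
        then have "cal_P \<beta> \<bar>geo_s \<beta> t\<bar> \<le> cal_P \<beta> \<bar>geo_s \<beta> (pi / \<omega>)\<bar>" using x0 by (intro cal_P_mono) auto
        ultimately show ?thesis by linarith
      qed
      have "b * (geo_z \<beta> (pi / \<omega>) - geo_z \<beta> t) \<le> \<beta> * (geo_z \<beta> (pi / \<omega>) - geo_z \<beta> t)"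
        using \<open>b < \<beta>\<close> geo_z_mono[OF b1 t0 half] by (intro mult_right_mono) auto
      with 2 have 3: "b * geo_z \<beta> (pi / \<omega>) - b * geo_z \<beta> t \<le> pi / \<omega> - t" by (simp add: right_diff_distrib)
      have "geo_z \<beta> (2 * pi / \<omega>) = 2 * geo_z \<beta> (pi / \<omega>)" using geo_z_turn[OF w] by (simp add: \<omega>_def)
      then have "2 * (pi / \<omega>) \<le> 2 * (b * geo_z \<beta> (pi / \<omega>)) + 2 * cal_P b X" using turn[OF w] by simp
      with 1 3 have "t \<le> b * geo_z \<beta> t + 2 * cal_P b X - cal_P b (geo_s \<beta> t)" by linarith
      then show thesis using b admb by (intro that[of b]) auto
    qed
  next
    case False
    then have w: "\<beta> > 1" and tw: "pi \<le> \<omega> * t" by auto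
    have tT: "t \<le> 2 * pi / \<omega>"
      using t1 w e(1)[OF w] by (auto simp: within_first_turn_def \<omega>_def field_simps)
    have "1 + (1 - b\<^sup>2) * (geo_s \<beta> r)\<^sup>2 \<ge> 0" if r: "r \<in> {t..2 * pi / \<omega>}" for r
    proof (rule adm)
      have r1: "\<omega> * t \<le> \<omega> * r" "\<omega> * r \<le> 2 * pi" using r e(1)[OF w] by (auto simp: field_simps)
      \<comment> \<open>After the turning point the geodesic approaches the axis, so its remaining part stays below \<open>X\<close>.\<close>
      have "sin (pi - \<omega> * r / 2) \<le> sin (pi - \<omega> * t / 2)"
        using r1 tw by (intro sin_monotone_2pi_le) auto
      then have "geo_s \<beta> r \<le> geo_s \<beta> t" using e(1)[OF w] unfolding e(3)[OF w] by (simp add: divide_right_mono)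
      with X show "geo_s \<beta> r \<le> X" by simp
      show "0 \<le> geo_s \<beta> r"
        using r1 w b1 r t0 by (intro geo_s_nonneg) (auto simp: within_first_turn_def \<omega>_def)
    qed
    \<comment> \<open>The rest of the circle, read towards the axis, bounds \<open>cal_P b (geo_s \<beta> t)\<close>.\<close>
    from geo_calibration[of t "2 * pi / \<omega>" b \<beta> "-1", OF t0 tT this]
    have "b * (geo_z \<beta> (2 * pi / \<omega>) - geo_z \<beta> t) + cal_P b (geo_s \<beta> t) \<le> 2 * pi / \<omega> - t"
      using x0 e(1)[OF w] e(3)[OF w, of "2 * pi / \<omega>"] by simp
    with turn[OF w] have "t \<le> b * geo_z \<beta> t + 2 * cal_P b X - cal_P b (geo_s \<beta> t)"
      by (simp add: right_diff_distrib)
    then show thesis using b admb by (intro that[of b]) auto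
  qed
qed

text \<open>The range of the parameter \<open>q\<close> in the next lemma: on it the modulus of the cosine of \<open>geo_psi\<close> is at
  most \<open>1\<close>, so that the arccosine is meaningful.\<close>
lemma cosh_root_le:
  assumes "0 \<le> x" "q \<le> (arsinh x)\<^sup>2" "- pi\<^sup>2 \<le> q"
  shows "(cosh_root q)\<^sup>2 \<le> 1 + x\<^sup>2"
proof (cases q rule: real_cases_square)
  case (2 s)
  have a: "arsinh x \<ge> 0" using assms(1) arsinh_real_neg_iff[of x] by linarith
  then have "s \<le> arsinh x" using assms(2) 2 power2_le_imp_le by blast
  then have "sinh s \<le> x" using sinh_real_le_iff[of s "arsinh x"] by (simp del: sinh_real_le_iff)
  moreover have "0 \<le> sinh s" using 2 by simp
  ultimately have "(sinh s)\<^sup>2 \<le> x\<^sup>2" by (intro power_mono)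
  then show ?thesis using 2 by (simp add: cosh_root_eq cosh_square_eq)
next
  case (3 s)
  then show ?thesis by (simp add: cosh_root_eq) (smt (verit) cos_squared_eq zero_le_power2)
qed simp

text \<open>For \<open>x = 0\<close> a full circle of suitable curvature does it. For \<open>x > 0\<close> fix \<open>x\<close> and let
  \<open>q = (1 - \<beta>\<^sup>2) t\<^sup>2 / 4\<close> vary. Then \<open>t\<close>, \<open>\<beta>\<close> and the area are continuous functions of \<open>q\<close>. At
  \<open>q = (arsinh x)\<^sup>2\<close> the geodesic is the straight one and its area is \<open>0\<close>; for \<open>q\<close> close to \<open>- \<pi>\<^sup>2\<close> it
  is almost a full circle, and the area is as large as desired.\<close>
lemma geodesic_through:
  assumes "0 \<le> x" "0 \<le> w"
  obtains \<beta> t where "0 \<le> \<beta>" "within_first_turn \<beta> t" "geo_s \<beta> t = x" "geo_z \<beta> t = w"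
proof (cases "x = 0")
  case True
  show thesis
  proof (cases "w = 0")
    case True
    with \<open>x = 0\<close> show thesis by (intro that[of 0 0]) (auto simp: within_first_turn_def)
  next
    case False
    \<comment> \<open>The ratio \<open>\<beta> / sqrt (\<beta>\<^sup>2 - 1)\<close> of the circle that encloses the area \<open>w\<close>.\<close>
    define k where "k = 1 + w / (2 * pi)"
    have k: "k > 1" using False assms by (simp add: k_def)
    then have k2: "k\<^sup>2 - 1 > 0" using square_gt_1[of k] by simp
    define \<beta> where "\<beta> = k / sqrt (k\<^sup>2 - 1)"
    have b2: "\<beta>\<^sup>2 - 1 = 1 / (k\<^sup>2 - 1)" using k2 by (simp add: \<beta>_def power_divide field_simps)
    have b: "\<beta> > 0" using k k2 by (simp add: \<beta>_def)
    have "\<beta>\<^sup>2 > 1\<^sup>2" using b2 k2 by (metis diff_gt_0_iff_gt one_power2 zero_less_divide_1_iff)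
    then have b1: "\<beta> > 1" using b by (intro power2_less_imp_less[of 1 \<beta>]) auto
    have w': "sqrt (\<beta>\<^sup>2 - 1) = 1 / sqrt (k\<^sup>2 - 1)" by (simp add: b2 real_sqrt_divide)
    have "\<beta> / sqrt (\<beta>\<^sup>2 - 1) = k" using k2 unfolding w' by (simp add: \<beta>_def)
    then have "geo_z \<beta> (2 * pi / sqrt (\<beta>\<^sup>2 - 1)) = w" using geo_z_turn(2)[OF b1] by (simp add: k_def)
    moreover have "geo_s \<beta> (2 * pi / sqrt (\<beta>\<^sup>2 - 1)) = x"
      using geo_elliptic(2)[of \<beta>] b1 k2 \<open>x = 0\<close> by (simp add: w')
    moreover have "within_first_turn \<beta> (2 * pi / sqrt (\<beta>\<^sup>2 - 1))"
      using k2 by (simp add: within_first_turn_def w')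
    ultimately show thesis using b1 by (intro that[of \<beta>]) auto
  qed
next
  case False
  with assms have x: "x > 0" by simp
  define qm where "qm = (arsinh x)\<^sup>2"
  have a: "arsinh x > 0" using x by simp
  define T where "T = (\<lambda>q. 2 * x / sinhc_root q)"
  define B where "B = (\<lambda>q. sqrt (1 - q * (sinhc_root q)\<^sup>2 / x\<^sup>2))"
  define F where "F = (\<lambda>q. B q * T q - 2 * arccos (cosh_root q / sqrt (1 + x\<^sup>2)))"
  have ratio: "\<bar>cosh_root q / sqrt (1 + x\<^sup>2)\<bar> \<le> 1" if "- pi\<^sup>2 < q" "q \<le> qm" for q
  proof -
    have "(cosh_root q / sqrt (1 + x\<^sup>2))\<^sup>2 \<le> 1"
      using cosh_root_le[of x q] x that by (simp add: qm_def power_divide)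
    then show ?thesis by (simp add: abs_square_le_1)
  qed
  \<comment> \<open>A value of \<open>q\<close> at which the time \<open>T q\<close> is at least \<open>w + 2 \<pi>\<close>; there \<open>\<beta> \<ge> 1\<close>.\<close>
  obtain ql where ql: "- pi\<^sup>2 < ql" "ql < 0" "sinhc_root ql \<le> 2 * x / (w + 2 * pi)"
  proof -
    have "sinhc_root (- pi\<^sup>2) = 0" using sinhc_root_eq(2)[of pi] by simp
    moreover have "2 * x / (w + 2 * pi) > 0" using x assms by (simp add: add_nonneg_pos)
    ultimately obtain d where d: "d > 0" "\<And>q. \<bar>q + pi\<^sup>2\<bar> < d \<Longrightarrow> \<bar>sinhc_root q\<bar> < 2 * x / (w + 2 * pi)"
      using isCont_sinhc_root[of "- pi\<^sup>2"] unfolding continuous_at_eps_delta dist_real_def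
      by (metis diff_minus_eq_add diff_zero)
    define q where "q = - pi\<^sup>2 + min (d / 2) 1"
    have "pi\<^sup>2 > 1" using pi_gt3 by (simp add: one_less_power)
    then show thesis using d(1) d(2)[of q] by (intro that[of q]) (auto simp: q_def min_def)
  qed
  have ql_qm: "ql \<le> qm" unfolding qm_def using ql(2) zero_le_power2[of "arsinh x"] by linarith
  have "\<exists>q\<ge>ql. q \<le> qm \<and> F q = w"
  proof (rule IVT2')
    have cs: "cosh_root qm = sqrt (1 + x\<^sup>2)"
      by (simp add: qm_def cosh_root_eq cosh_arsinh_real add.commute)
    have "sinhc_root qm = x / arsinh x" using a by (simp add: qm_def sinhc_root_eq)
    then have "B qm = 0" using x a by (simp add: B_def qm_def power_divide)
    then show "F qm \<le> w" using assms by (simp add: F_def cs)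
    have sp: "sinhc_root ql > 0" using sinhc_root_pos ql by simp
    have "w + 2 * pi \<le> T ql" using ql(3) sp assms by (simp add: T_def field_simps add_nonneg_pos)
    moreover have "B ql \<ge> 1" using ql(2) by (simp add: B_def mult_nonpos_nonneg divide_nonpos_nonneg)
    then have "B ql * T ql \<ge> 1 * T ql" using sp x by (intro mult_right_mono) (simp_all add: T_def)
    moreover have "arccos (cosh_root ql / sqrt (1 + x\<^sup>2)) \<le> pi"
      using abs_le_D1[OF ratio[OF ql(1) ql_qm]] abs_le_D2[OF ratio[OF ql(1) ql_qm]]
      by (intro arccos_ubound) linarith+
    ultimately show "w \<le> F ql" by (simp add: F_def)
    show "ql \<le> qm" by (rule ql_qm)
    have nz: "sinhc_root q \<noteq> 0" if "q \<in> {ql..qm}" for q using sinhc_root_pos[of q] ql that by auto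
    have c: "continuous_on A sinhc_root" "continuous_on A cosh_root" for A
      by (auto intro!: continuous_at_imp_continuous_on isCont_sinhc_root isCont_cosh_root)
    have "- 1 \<le> cosh_root q / sqrt (1 + x\<^sup>2)" "cosh_root q / sqrt (1 + x\<^sup>2) \<le> 1" if "q \<in> {ql..qm}" for q
      using ratio[of q] that ql(1) unfolding abs_le_iff by auto
    then show "continuous_on {ql..qm} F"
      unfolding F_def B_def T_def using nz x
      by (intro continuous_intros c) auto
  qed
  then obtain q where q: "ql \<le> q" "q \<le> qm" "F q = w" by blast
  have sp: "sinhc_root q > 0" using sinhc_root_pos[of q] ql q by simp
  have Bnn: "1 - q * (sinhc_root q)\<^sup>2 / x\<^sup>2 \<ge> 0"
    using cosh_root_le[of x q] cosh_root_sinhc_root[of q] x q ql by (simp add: qm_def field_simps)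
  have B: "0 \<le> B q" "(B q)\<^sup>2 = 1 - q * (sinhc_root q)\<^sup>2 / x\<^sup>2" using Bnn by (simp_all add: B_def)
  have T: "T q > 0" using sp x by (simp add: T_def)
  have qe: "(1 - (B q)\<^sup>2) * (T q)\<^sup>2 / 4 = q" using sp x by (simp add: B T_def power_divide power_mult_distrib)
  have s: "geo_s (B q) (T q) = x" using sp by (simp add: geo_s_def qe) (simp add: T_def)
  have wf: "within_first_turn (B q) (T q)"
  proof (cases "B q \<le> 1")
    case False
    then have "(B q)\<^sup>2 - 1 > 0" using square_gt_1[of "B q"] by simp
    then have "(sqrt ((B q)\<^sup>2 - 1) * T q)\<^sup>2 = - 4 * q" using qe by (simp add: power_mult_distrib algebra_simps)
    also have "\<dots> \<le> (2 * pi)\<^sup>2" using q ql by (simp add: power_mult_distrib)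
    finally have "sqrt ((B q)\<^sup>2 - 1) * T q \<le> 2 * pi" by (rule power2_le_imp_le) simp
    then show ?thesis using T by (simp add: within_first_turn_def)
  qed (use T in \<open>simp add: within_first_turn_def\<close>)
  have "cos (geo_psi (B q) (T q)) = cosh_root q / sqrt (1 + x\<^sup>2)"
    using geo_cos_sin_psi(1)[of "T q" "B q"] T by (simp add: s) (simp add: geo_c_def qe)
  then have "geo_psi (B q) (T q) = arccos (cosh_root q / sqrt (1 + x\<^sup>2))"
    using geo_psi_bounds[OF B(1) wf] by (metis arccos_cos)
  then have "geo_z (B q) (T q) = F q" by (simp add: F_def geo_psi_def field_simps)
  with q(3) B(1) wf s show thesis by (intro that) auto
qed

section \<open>The distance and the cut time\<close>

text \<open>If \<open>geo_z\<close> were constant on an interval, then \<open>geo_s\<close> would vanish there together with its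
  derivative, against \<open>geo_c_s\<close>.\<close>
lemma geo_z_strict_mono:
  assumes "\<beta> > 0" "0 \<le> s" "s < t"
  shows "geo_z \<beta> s < geo_z \<beta> t"
proof (rule ccontr)
  assume "\<not> geo_z \<beta> s < geo_z \<beta> t"
  then have ts: "geo_z \<beta> t \<le> geo_z \<beta> s" by simp
  have const: "geo_z \<beta> r = geo_z \<beta> s" if "r \<in> {s..t}" for r
  proof (rule antisym)
    have "geo_z \<beta> r \<le> geo_z \<beta> t" by (rule geo_z_mono) (use that assms in auto)
    with ts show "geo_z \<beta> r \<le> geo_z \<beta> s" by linarith
    show "geo_z \<beta> s \<le> geo_z \<beta> r" by (rule geo_z_mono) (use that assms in auto)
  qed
  have S0: "geo_s \<beta> r = 0" if r: "r \<in> {s<..<t}" for r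
  proof -
    have "eventually (\<lambda>x. x \<in> {s<..<t}) (nhds r)" using r by (intro eventually_nhds_in_open) auto
    then have "eventually (\<lambda>x. geo_z \<beta> x = geo_z \<beta> s) (nhds r)"
      by (rule eventually_mono) (rule const, simp)
    then have "(geo_z \<beta> has_real_derivative 0) (at r)"
      using DERIV_cong_ev[OF refl, of "geo_z \<beta>" "\<lambda>_. geo_z \<beta> s" r 0 0] by simp
    then have "\<beta> * (geo_s \<beta> r)\<^sup>2 / (1 + (geo_s \<beta> r)\<^sup>2) = 0"
      using DERIV_unique[OF geo_z_deriv] r assms(2) by fastforce
    then show ?thesis using assms(1) by simp
  qed
  define m where "m = (s + t) / 2"
  have m: "m \<in> {s<..<t}" using assms by (simp add: m_def)
  have "eventually (\<lambda>x. x \<in> {s<..<t}) (nhds m)" using m by (intro eventually_nhds_in_open) auto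
  then have "eventually (\<lambda>x. geo_s \<beta> x = 0) (nhds m)"
    by (rule eventually_mono) (rule S0)
  then have "(geo_s \<beta> has_real_derivative 0) (at m)"
    using DERIV_cong_ev[OF refl, of "geo_s \<beta>" "\<lambda>_. 0" m 0 0] by simp
  then have "geo_c \<beta> m = 0" using DERIV_unique[OF _ geo_s_deriv] by fastforce
  with geo_c_s[of \<beta> m] S0[OF m] show False by simp
qed

lemma coordA_geod_lift:
  assumes "t \<ge> 0"
  shows "coordA (geod \<beta> \<phi> t) = cmod (coordA (geod \<beta> \<phi> t)) * cis (- geo_z \<beta> t / 2)"
  unfolding cmod_coord_geod by (rule coordA_geod_polar[OF assms])

lemma horizontal_on_lift:
  assumes "horizontal_on c a b" "c a = mat 1"
  obtains z where "continuous_on {a..b} z" "z a = 0"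
    "\<And>r. r \<in> {a..b} \<Longrightarrow> coordA (c r) = cmod (coordA (c r)) * cis (- z r / 2)"
proof -
  have "continuous_on {a..b} c"
    using assms by (simp add: horizontal_on_def piecewise_C1_differentiable_on_def)
  then have "continuous_on {a..b} (\<lambda>r. coordA (c r))"
    by (rule bounded_linear.continuous_on[OF bounded_linear_coord(1)])
  moreover have "coordA (c r) \<noteq> 0" if "r \<in> {a..b}" for r
  proof -
    have "c r \<in> SL2" using that assms(1) by (auto simp: horizontal_on_def)
    from SL2_norm_coord[OF this] show ?thesis by auto
  qed
  moreover have "contractible {a..b}" by (simp add: convex_imp_contractible)
  ultimately obtain g where g: "continuous_on {a..b} g" "\<And>r. r \<in> {a..b} \<Longrightarrow> coordA (c r) = exp (g r)"
    using continuous_logarithm_on_contractible[of "{a..b}" "\<lambda>r. coordA (c r)"] by metis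
  show thesis
  proof (rule that[of "\<lambda>r. - 2 * (Im (g r) - Im (g a))"])
    fix r assume r: "r \<in> {a..b}"
    then have "exp (g a) = 1" using g(2)[of a] assms(2) by simp
    then have "cis (Im (g a)) = 1" by (metis exp_eq_polar mult.left_neutral norm_exp_eq_Re norm_one of_real_1)
    then have "cis (Im (g r) - Im (g a)) = cis (Im (g r))" by (simp flip: cis_divide)
    moreover have "coordA (c r) = cmod (coordA (c r)) * cis (Im (g r))"
      unfolding g(2)[OF r] norm_exp_eq_Re by (rule exp_eq_polar)
    moreover have "- (- 2 * (Im (g r) - Im (g a))) / 2 = Im (g r) - Im (g a)" by simp
    ultimately show "coordA (c r) = cmod (coordA (c r)) * cis (- (- 2 * (Im (g r) - Im (g a))) / 2)"
      by (simp only:)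
  qed (auto intro!: continuous_intros g(1))
qed

text \<open>The curve is split at the point farthest from the axis. The radial part counts with the sign \<open>+\<close>
  before it and with the sign \<open>-\<close> after it, and the area part counts with the sign of the final
  area. The multiplier comes from \<open>competitor_bound\<close>. Since it is positive, a larger area
  makes the estimate strict.\<close>
lemma length_lower_bound:
  assumes hor: "horizontal_on c a b" and ab: "a \<le> b" and start: "c a = mat 1"
    and z: "continuous_on {a..b} z" "z a = 0"
    and lift: "\<And>r. r \<in> {a..b} \<Longrightarrow> coordA (c r) = cmod (coordA (c r)) * cis (- z r / 2)"
    and \<beta>: "0 \<le> \<beta>" "within_first_turn \<beta> t"
    and s_end: "cmod (coordB (c b)) = geo_s \<beta> t" and z_end: "geo_z \<beta> t \<le> \<bar>z b\<bar>" and zpos: "0 < geo_z \<beta> t"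
  shows "t \<le> sr_length c a b" "geo_z \<beta> t < \<bar>z b\<bar> \<Longrightarrow> t < sr_length c a b"
proof -
  let ?B = "\<lambda>r. cmod (coordB (c r))" and ?L = "sr_length c a b"
  have \<beta>pos: "\<beta> > 0" using \<beta>(1) zpos by (cases "\<beta> = 0") (auto simp: geo_z_def)
  have "continuous_on {a..b} c"
    using hor by (simp add: horizontal_on_def piecewise_C1_differentiable_on_def)
  then have "continuous_on {a..b} ?B"
    by (intro continuous_on_norm bounded_linear.continuous_on[OF bounded_linear_coord(2)])
  then obtain m where m: "m \<in> {a..b}" "\<And>r. r \<in> {a..b} \<Longrightarrow> ?B r \<le> ?B m"
    using continuous_attains_sup[of "{a..b}" ?B] ab by auto
  have est: "b' * \<bar>z b\<bar> + 2 * cal_P b' (?B m) - cal_P b' (geo_s \<beta> t) \<le> ?L"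
    if adm: "1 + (1 - b'\<^sup>2) * (?B m)\<^sup>2 \<ge> 0" for b'
  proof -
    \<comment> \<open>The multiplier with the sign of the final area.\<close>
    define \<sigma> where "\<sigma> = (if z b < 0 then - b' else b')"
    have \<sigma>: "\<sigma>\<^sup>2 = b'\<^sup>2" "\<sigma> * z b = b' * \<bar>z b\<bar>" "cal_P \<sigma> = cal_P b'"
      by (auto simp: \<sigma>_def fun_eq_iff)
    have adm': "1 + (1 - \<sigma>\<^sup>2) * (?B r)\<^sup>2 \<ge> 0" if "r \<in> {a..b}" for r
      using admissible_mono[OF _ m(2)[OF that] adm] by (simp add: \<sigma>(1))
    have "\<sigma> * (z m - z a) + 1 * (cal_P \<sigma> (?B m) - cal_P \<sigma> (?B a)) \<le> integral {a..m} (sr_speed c)"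
      by (rule calibration_estimate[OF hor _ _ _ z(1) lift]) (use m adm' in auto)
    moreover have "\<sigma> * (z b - z m) + (- 1) * (cal_P \<sigma> (?B b) - cal_P \<sigma> (?B m)) \<le> integral {m..b} (sr_speed c)"
      by (rule calibration_estimate[OF hor _ _ _ z(1) lift]) (use m adm' in auto)
    moreover have "integral {a..m} (sr_speed c) + integral {m..b} (sr_speed c) = ?L"
      unfolding sr_length_def using hor m by (intro Henstock_Kurzweil_Integration.integral_combine) (auto simp: horizontal_on_def)
    moreover have "\<sigma> * (z m - z a) + \<sigma> * (z b - z m) = b' * \<bar>z b\<bar>"
      using \<sigma>(2) z(2) by (simp add: right_diff_distrib)
    ultimately show ?thesis using start s_end by (simp add: \<sigma>(3))
  qed
  \<comment> \<open>A curve that stays on the axis encloses no area: otherwise every multiplier would be admissible,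
    and its length would exceed every bound.\<close>
  have "?B m > 0"
  proof (rule ccontr)
    assume "\<not> ?B m > 0"
    then have B0: "?B m = 0" by simp
    then have "geo_s \<beta> t = 0" using m(2)[of b] ab s_end norm_ge_zero[of "coordB (c b)"] by simp
    then have "b' * \<bar>z b\<bar> \<le> ?L" for b' using est[of b'] B0 by simp
    from this[of "(?L + 1) / \<bar>z b\<bar>"] show False using zpos z_end by simp
  qed
  moreover have "geo_s \<beta> t \<le> ?B m" using m(2)[of b] ab s_end by simp
  ultimately obtain b' where b': "0 < b'" "1 + (1 - b'\<^sup>2) * (?B m)\<^sup>2 \<ge> 0"
    "t \<le> b' * geo_z \<beta> t + 2 * cal_P b' (?B m) - cal_P b' (geo_s \<beta> t)"
    using competitor_bound[OF \<beta>] \<beta>pos by metis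
  have "b' * geo_z \<beta> t \<le> b' * \<bar>z b\<bar>" using b'(1) z_end by simp
  with est[OF b'(2)] b'(3) show "t \<le> ?L" by linarith
  assume "geo_z \<beta> t < \<bar>z b\<bar>"
  then have "b' * geo_z \<beta> t < b' * \<bar>z b\<bar>" using b'(1) by simp
  with est[OF b'(2)] b'(3) show "t < ?L" by linarith
qed

lemma geo_z_abs: "\<bar>geo_z \<beta> t\<bar> = geo_z \<bar>\<beta>\<bar> t" if "t \<ge> 0"
  using geo_z_nonneg[of \<beta> t] geo_z_nonneg[of "- \<beta>" t] that by (cases "\<beta> \<ge> 0") (auto simp: abs_if)

text \<open>A competing curve ends at the same \<open>A\<close>, so the cosines of half the final areas agree. As \<open>geo_z\<close> is
  at most \<open>2 \<pi>\<close>, it is the smallest absolute value compatible with this cosine.\<close>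
lemma cc_dist_geod_eq:
  assumes "\<beta> \<noteq> 0" "0 < t" "within_first_turn \<bar>\<beta>\<bar> t" "geo_z \<bar>\<beta>\<bar> t \<le> 2 * pi"
  shows "cc_dist (mat 1) (geod \<beta> \<phi> t) = t"
proof (rule antisym)
  show "cc_dist (mat 1) (geod \<beta> \<phi> t) \<le> t" using assms by (intro cc_dist_geod_le) simp
  show "t \<le> cc_dist (mat 1) (geod \<beta> \<phi> t)"
  proof (rule cc_dist_geod_ge)
    fix c assume c: "horizontal_on c 0 1" "c 0 = mat 1" "c 1 = geod \<beta> \<phi> t"
    obtain z where z: "continuous_on {0..1} z" "z 0 = 0"
      "\<And>r. r \<in> {0..1} \<Longrightarrow> coordA (c r) = cmod (coordA (c r)) * cis (- z r / 2)"
      using horizontal_on_lift[OF c(1,2)] by blast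
    let ?N = "sqrt (1 + (geo_s \<beta> t)\<^sup>2)"
    have "?N * cis (- z 1 / 2) = ?N * cis (- geo_z \<beta> t / 2)"
      using z(3)[of 1] coordA_geod_polar[of t \<beta> \<phi>] assms(2) unfolding c(3) cmod_coord_geod by simp
    then have "cis (- z 1 / 2) = cis (- geo_z \<beta> t / 2)"
      by (metis mult_left_cancel of_real_eq_0_iff one_plus_square_pos(2) real_sqrt_eq_zero_cancel_iff)
    then have "cos (z 1 / 2) = cos (geo_z \<beta> t / 2)" by (metis cis.sel(1) cos_minus minus_divide_left)
    then have cos_eq: "cos (\<bar>z 1\<bar> / 2) = cos (geo_z \<bar>\<beta>\<bar> t / 2)"
      using geo_z_abs[of t \<beta>] assms(2) by (metis abs_divide abs_numeral cos_abs_real less_imp_le)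
    have z1: "geo_z \<bar>\<beta>\<bar> t \<le> \<bar>z 1\<bar>"
    proof (rule ccontr)
      assume "\<not> geo_z \<bar>\<beta>\<bar> t \<le> \<bar>z 1\<bar>"
      then have "cos (geo_z \<bar>\<beta>\<bar> t / 2) < cos (\<bar>z 1\<bar> / 2)"
        using assms by (intro cos_monotone_0_pi) auto
      with cos_eq show False by simp
    qed
    have "0 < geo_z \<bar>\<beta>\<bar> t" using geo_z_strict_mono[of "\<bar>\<beta>\<bar>" 0 t] assms by simp
    moreover have "cmod (coordB (c 1)) = geo_s \<bar>\<beta>\<bar> t"
      using geo_s_nonneg[OF _ assms(3)] by (simp add: c(3) cmod_coord_geod)
    ultimately show "t \<le> sr_length c 0 1"
      using length_lower_bound(1)[OF c(1) _ c(2) z _ assms(3) _ z1] by simp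
  qed (use assms in simp)
qed

text \<open>The value \<open>\<bar>B\<bar>\<close> and the real part of \<open>A\<close> determine a point up to a rotation and the sign of the
  imaginary part of \<open>A\<close>; the rotation is matched by \<open>\<phi>\<close> and the sign by that of \<open>\<beta>\<close>.\<close>
lemma geod_reaches:
  assumes g: "g \<in> SL2" and t: "0 \<le> t" and s: "geo_s \<beta> t = cmod (coordB g)"
    and z: "0 \<le> geo_z \<beta> t" "geo_z \<beta> t \<le> 2 * pi"
    and c: "cmod (coordA g) * cos (geo_z \<beta> t / 2) = Re (coordA g)"
  shows "cc_dist (mat 1) g \<le> t"
proof -
  have N: "cmod (coordA g) = sqrt (1 + (geo_s \<beta> t)\<^sup>2)"
    unfolding s SL2_norm_coord[OF g, symmetric] by simp
  define \<sigma> where "\<sigma> = (if Im (coordA g) > 0 then - 1 else 1 :: real)"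
  have \<sigma>: "geo_z (\<sigma> * \<beta>) t = \<sigma> * geo_z \<beta> t" "geo_s (\<sigma> * \<beta>) t = geo_s \<beta> t" by (simp_all add: \<sigma>_def)
  have "(cmod (coordA g) * sin (geo_z \<beta> t / 2))\<^sup>2 = (Im (coordA g))\<^sup>2"
  proof -
    have "(cmod (coordA g) * sin (geo_z \<beta> t / 2))\<^sup>2 = (cmod (coordA g))\<^sup>2 - (cmod (coordA g) * cos (geo_z \<beta> t / 2))\<^sup>2"
      by (simp add: power_mult_distrib sin_squared_eq right_diff_distrib)
    then show ?thesis by (simp add: c cmod_power2)
  qed
  moreover have "0 \<le> cmod (coordA g) * sin (geo_z \<beta> t / 2)" using z by (intro mult_nonneg_nonneg sin_ge_zero) auto
  ultimately have sn: "cmod (coordA g) * sin (geo_z \<beta> t / 2) = \<bar>Im (coordA g)\<bar>"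
    by (metis abs_of_nonneg real_sqrt_abs)
  define \<phi> where "\<phi> = Arg (coordB g) - \<sigma> * \<beta> * t / 2"
  have "geod (\<sigma> * \<beta>) \<phi> t = g"
  proof (rule mat2_eqI)
    show "coordA (geod (\<sigma> * \<beta>) \<phi> t) = coordA g"
      unfolding coordA_geod_polar[OF t] \<sigma> N[symmetric]
      using c sn by (auto simp: complex_eq_iff \<sigma>_def)
    show "coordB (geod (\<sigma> * \<beta>) \<phi> t) = coordB g"
      unfolding coord_geod \<sigma> s by (simp add: \<phi>_def rcis_cmod_Arg flip: rcis_def)
  qed
  then show ?thesis using cc_dist_geod_le[OF t, of "\<sigma> * \<beta>" \<phi>] by simp
qed

text \<open>Let \<open>w\<close> be the area in the interval from \<open>0\<close> to \<open>2 \<pi>\<close> with the same cosine as the area of the given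
  arc; a geodesic of area \<open>w\<close> reaches the same end point at a time \<open>t1\<close>. If the given arc has area
  above \<open>2 \<pi>\<close>, the strict part of \<open>length_lower_bound\<close> gives \<open>t1 < T\<close>. Otherwise the areas agree, but the
  arc has returned to the axis at the time \<open>2 \<pi> / \<omega>\<close>; calibrating its parts separately, with a change
  of the sign of the radial part at each return, beats the bound for \<open>t1\<close> by a positive multiple
  of \<open>cal_P\<close>.\<close>
lemma cc_dist_geod_less:
  assumes \<beta>: "\<beta> \<noteq> 0" and T: "0 < T"
    and late: "2 * pi < geo_z \<bar>\<beta>\<bar> T \<or> \<bar>\<beta>\<bar> > 1 \<and> 2 * pi / sqrt (\<beta>\<^sup>2 - 1) < T"
  shows "cc_dist (mat 1) (geod \<beta> \<phi> T) < T"
proof -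
  define g where "g = geod \<beta> \<phi> T"
  define b where "b = \<bar>\<beta>\<bar>"
  have b: "b > 0" "b\<^sup>2 = \<beta>\<^sup>2" "geo_s b = geo_s \<beta>" using \<beta> by (simp_all add: b_def fun_eq_iff)
  have g: "g \<in> SL2" by (simp add: g_def geod_SL2)
  define x where "x = cmod (coordB g)"
  have x: "x = \<bar>geo_s b T\<bar>" "x \<ge> 0" by (simp_all add: x_def g_def cmod_coord_geod b)
  define w where "w = 2 * arccos (cos (geo_z b T / 2))"
  have w: "0 \<le> w" "w \<le> 2 * pi" "cos (w / 2) = cos (geo_z b T / 2)"
    by (auto simp: w_def intro: arccos_lbound arccos_ubound)
  obtain \<beta>1 t1 where 1: "0 \<le> \<beta>1" "within_first_turn \<beta>1 t1" "geo_s \<beta>1 t1 = x" "geo_z \<beta>1 t1 = w"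
    using geodesic_through[OF x(2) w(1)] by blast
  have t1: "t1 \<ge> 0" using 1(2) by (simp add: within_first_turn_def)
  have cz: "cos (geo_z b T / 2) = cos (geo_z \<beta> T / 2)"
    using geo_z_abs[of T \<beta>] T by (metis abs_divide abs_numeral b_def cos_abs_real less_imp_le)
  have "cmod (coordA g) * cos (w / 2) = Re (coordA g)"
    unfolding w(3) cz g_def cmod_coord_geod by (subst coordA_geod_polar) (use T in auto)
  then have "cc_dist (mat 1) g \<le> t1"
    using geod_reaches[OF g t1, of \<beta>1] 1 w x_def by simp
  moreover have "t1 < T"
  proof -
    have less: "t < T" if "0 \<le> \<beta>'" "within_first_turn \<beta>' t" "geo_s \<beta>' t = x" "0 < geo_z \<beta>' t" "geo_z \<beta>' t < geo_z b T" for \<beta>' t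
    proof -
      have "horizontal_on (geod \<beta> \<phi>) 0 T" using horizontal_geod[of 1 \<beta> \<phi> 0 T] by simp
      moreover have "sr_length (geod \<beta> \<phi>) 0 T = T"
        using sr_length_geod[of 1 0 T \<beta> \<phi>] T by (simp add: sr_length_def)
      moreover have "coordA (geod \<beta> \<phi> r) = cmod (coordA (geod \<beta> \<phi> r)) * cis (- geo_z \<beta> r / 2)" if "r \<in> {0..T}" for r
        by (rule coordA_geod_lift) (use that in auto)
      moreover have "cmod (coordB (geod \<beta> \<phi> T)) = geo_s \<beta>' t" using that(3) by (simp add: x_def g_def)
      moreover have "geo_z \<beta>' t < \<bar>geo_z \<beta> T\<bar>" using that(5) geo_z_abs[of T \<beta>] T by (simp add: b_def)
      ultimately show ?thesis
        using length_lower_bound(2)[of "geod \<beta> \<phi>" 0 T "geo_z \<beta>" \<beta>' t] that(1,2,4) T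
          continuous_on_geo_z[of T \<beta>] geod_0 geo_z_0
        by (metis less_eq_real_def)
    qed
    show ?thesis
    proof (cases "2 * pi < geo_z b T")
      case True
      show ?thesis
      proof (cases "w = 0")
        case False
        then show ?thesis using less[of \<beta>1 t1] 1 w True by simp
      next
        case True
        \<comment> \<open>The straight geodesic has multiplier \<open>0\<close> and gives no strict inequality, so it is compared with
          a geodesic of area \<open>2 \<pi>\<close> over the same distance.\<close>
        obtain \<beta>2 t2 where 2: "0 \<le> \<beta>2" "within_first_turn \<beta>2 t2" "geo_s \<beta>2 t2 = x" "geo_z \<beta>2 t2 = 2 * pi"
          using geodesic_through[OF x(2), of "2 * pi"] by auto
        have t2: "t2 \<ge> 0" using 2(2) by (simp add: within_first_turn_def)
        have "t2 < T" using less[of \<beta>2 t2] 2 \<open>2 * pi < geo_z b T\<close> by simp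
        moreover have "t1 \<le> t2"
        proof (cases "t1 = 0")
          case False
          then have "\<beta>1 = 0" using geo_z_strict_mono[of \<beta>1 0 t1] 1 t1 True by (cases "\<beta>1 = 0") auto
          then have "t1 = cal_P 0 x"
            using outgoing_time_eq[of t1 0] t1 1(3) geo_c_pos_if_le_1[of 0] by (simp add: less_imp_le)
          also have "\<dots> \<le> t2"
            using geo_calibration[of 0 t2 0 \<beta>2 1] t2 2(3) x(2) by (simp add: add_nonneg_nonneg)
          finally show ?thesis .
        qed (use t2 in simp)
        ultimately show ?thesis by simp
      qed
    next
      case False
      then have b1: "b > 1" and T0: "2 * pi / sqrt (b\<^sup>2 - 1) < T" using late by (auto simp: b_def)
      define \<omega> where "\<omega> = sqrt (b\<^sup>2 - 1)"
      have om: "\<omega> > 0" "\<omega>\<^sup>2 = b\<^sup>2 - 1" using square_gt_1[OF b1] by (simp_all add: \<omega>_def)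
      have e: "geo_s b r = sin (\<omega> * r / 2) / \<omega>" for r using geo_elliptic(2)[of b r] b1 by (simp add: \<omega>_def)
      have "geo_z b T > 0" using geo_z_strict_mono[of b 0 T] b T by simp
      then have w_eq: "w = geo_z b T" using False by (simp add: w_def arccos_cos)
      have xX: "x \<le> 1 / \<omega>" using om(1) by (simp add: x e abs_divide divide_right_mono)
      then obtain b' where b': "1 + (1 - b'\<^sup>2) * (1 / \<omega>)\<^sup>2 \<ge> 0"
        "t1 \<le> b' * geo_z b T + 2 * cal_P b' (1 / \<omega>) - cal_P b' x"
        using competitor_bound[OF 1(1,2), of "1 / \<omega>"] om(1) unfolding 1(3,4) w_eq by auto
      have cal: "b' * (geo_z b t - geo_z b s) + \<rho> * (cal_P b' \<bar>geo_s b t\<bar> - cal_P b' \<bar>geo_s b s\<bar>) \<le> t - s"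
        if "0 \<le> s" "s \<le> t" "\<rho>\<^sup>2 = 1" for s t \<rho>
      proof (rule geo_calibration[OF that(1,2) _ that(3)])
        fix r
        have "\<bar>geo_s b r\<bar> \<le> 1 / \<omega>" using om(1) by (simp add: e abs_divide divide_right_mono)
        then show "1 + (1 - b'\<^sup>2) * (geo_s b r)\<^sup>2 \<ge> 0"
          using admissible_mono[of "\<bar>geo_s b r\<bar>" "1 / \<omega>" b'] b'(1) by simp
      qed
      have s1: "geo_s b (pi / \<omega>) = 1 / \<omega>" and s2: "geo_s b (2 * pi / \<omega>) = 0" and s3: "\<bar>geo_s b (3 * pi / \<omega>)\<bar> = 1 / \<omega>"
        using om(1) sin_3over2_pi by (simp_all add: e)
      have c1: "b' * geo_z b (pi / \<omega>) + cal_P b' (1 / \<omega>) \<le> pi / \<omega>"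
        using cal[of 0 "pi / \<omega>" 1] om(1) by (simp add: s1)
      have c2: "b' * (geo_z b (2 * pi / \<omega>) - geo_z b (pi / \<omega>)) + cal_P b' (1 / \<omega>) \<le> 2 * pi / \<omega> - pi / \<omega>"
        using cal[of "pi / \<omega>" "2 * pi / \<omega>" "-1"] om(1) by (simp add: s1 s2 divide_right_mono)
      show ?thesis
      proof (cases "x = 0")
        case False
        have "b' * (geo_z b T - geo_z b (2 * pi / \<omega>)) + cal_P b' x \<le> T - 2 * pi / \<omega>"
          using cal[of "2 * pi / \<omega>" T 1] om(1) T0 by (simp add: s2 x flip: \<omega>_def)
        moreover have "cal_P b' x > 0"
          using False x(2) admissible_mono[OF x(2) xX b'(1)] by (intro cal_P_pos) auto
        ultimately show ?thesis using c1 c2 b'(2) by (simp add: right_diff_distrib)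
      next
        case True
        \<comment> \<open>The arc ends on the axis, hence it contains at least a second circle.\<close>
        have T3: "3 * pi / \<omega> \<le> T"
        proof (rule ccontr)
          assume "\<not> 3 * pi / \<omega> \<le> T"
          then have "pi < \<omega> * T / 2" "\<omega> * T / 2 < 2 * pi" using T0 om(1) by (auto simp: field_simps simp flip: \<omega>_def)
          then have "sin (\<omega> * T / 2) < 0" by (rule sin_lt_zero)
          with True om(1) show False by (simp add: x e)
        qed
        have "b' * (geo_z b (3 * pi / \<omega>) - geo_z b (2 * pi / \<omega>)) + cal_P b' (1 / \<omega>) \<le> 3 * pi / \<omega> - 2 * pi / \<omega>"
          using cal[of "2 * pi / \<omega>" "3 * pi / \<omega>" 1] om(1) unfolding s3 s2 by (simp add: divide_right_mono)
        moreover have "b' * (geo_z b T - geo_z b (3 * pi / \<omega>)) + cal_P b' (1 / \<omega>) \<le> T - 3 * pi / \<omega>"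
          using cal[of "3 * pi / \<omega>" T "-1"] om(1) T3 True x(1) unfolding s3 by simp
        moreover have "cal_P b' (1 / \<omega>) > 0" using om(1) b'(1) by (intro cal_P_pos) auto
        ultimately show ?thesis using c1 c2 b'(2) True by (simp add: right_diff_distrib)
      qed
    qed
  qed
  ultimately show ?thesis by (simp add: g_def)
qed

text \<open>Thus the first time at which the circle closes or the area is \<open>2 \<pi>\<close> is the cut time.\<close>
lemma noncontinuable_time_eq:
  assumes nc: "noncontinuable_shortest_arc (geod \<beta> \<phi>) T" and \<beta>: "\<beta> \<noteq> 0"
    and C: "0 < C" "within_first_turn \<bar>\<beta>\<bar> C" "geo_z \<bar>\<beta>\<bar> C \<le> 2 * pi"
    and cut: "geo_z \<bar>\<beta>\<bar> C = 2 * pi \<or> \<bar>\<beta>\<bar> > 1 \<and> C = 2 * pi / sqrt (\<beta>\<^sup>2 - 1)"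
  shows "T = C"
proof (rule antisym)
  have T: "T > 0" "cc_dist (mat 1) (geod \<beta> \<phi> T) = T"
    using nc shortest_arc_geod_iff[of T] by (auto simp: noncontinuable_shortest_arc_def)
  show "T \<le> C"
  proof (rule ccontr)
    assume "\<not> T \<le> C"
    then have "2 * pi < geo_z \<bar>\<beta>\<bar> T \<or> \<bar>\<beta>\<bar> > 1 \<and> 2 * pi / sqrt (\<beta>\<^sup>2 - 1) < T"
      using cut geo_z_strict_mono[of "\<bar>\<beta>\<bar>" C T] C(1) \<beta> by auto
    from cc_dist_geod_less[OF \<beta> T(1) this, of \<phi>] T(2) show False by simp
  qed
  show "C \<le> T"
    using nc shortest_arc_geod_iff[of C] cc_dist_geod_eq[OF \<beta> C, of \<phi>] C(1)
    by (force simp: noncontinuable_shortest_arc_def)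
qed

section \<open>Equations and bounds for the cut time\<close>

text \<open>At these two values of \<open>\<bar>\<beta>\<bar>\<close> the full circle, respectively the half circle, encloses the area \<open>2 \<pi>\<close>.
  All comparisons with them are made between squares.\<close>
lemma threshold_squares:
  "(2 / sqrt 3)\<^sup>2 = (4 / 3 :: real)" "(3 / (2 * sqrt 2))\<^sup>2 = (9 / 8 :: real)"
  by (simp_all add: power_divide power_mult_distrib)

lemma less_iff_square: "0 \<le> x \<Longrightarrow> 0 \<le> y \<Longrightarrow> x < y \<longleftrightarrow> x\<^sup>2 < y\<^sup>2" for x y :: real
  by (metis power2_less_imp_less power_strict_mono zero_less_numeral)

text \<open>For these curvatures the full circle closes before the area exceeds \<open>2 \<pi>\<close>.\<close>
lemma cut_time_on_axis:
  assumes "noncontinuable_shortest_arc (geod \<beta> \<phi>) T" "\<bar>\<beta>\<bar> \<ge> 2 / sqrt 3"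
  shows "T = 2 * pi / sqrt (\<beta>\<^sup>2 - 1)"
proof -
  define b where "b = \<bar>\<beta>\<bar>"
  have "(2 / sqrt 3)\<^sup>2 \<le> b\<^sup>2" using assms(2) unfolding b_def by (intro power_mono) auto
  then have b2: "b\<^sup>2 \<ge> 4 / 3" by (simp only: threshold_squares)
  have b1: "b > 1" using b2 less_iff_square[of 1 b] by (simp add: b_def)
  define \<omega> where "\<omega> = sqrt (b\<^sup>2 - 1)"
  have w: "\<omega> > 0" "\<omega>\<^sup>2 = b\<^sup>2 - 1" using b2 by (simp_all add: \<omega>_def)
  have "b \<le> 2 * \<omega>"
    by (rule power2_le_imp_le) (use w b2 in \<open>simp_all add: power_mult_distrib\<close>)
  then have "b / \<omega> \<le> 2" using w(1) by (simp add: field_simps)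
  then have "2 * pi * (b / \<omega> - 1) \<le> 2 * pi * 1" by (intro mult_left_mono) auto
  then have "geo_z b (2 * pi / \<omega>) \<le> 2 * pi" using geo_z_turn(2)[OF b1] by (simp add: \<omega>_def)
  moreover have "within_first_turn b (2 * pi / \<omega>)" using w(1) by (simp add: within_first_turn_def \<omega>_def)
  ultimately show ?thesis
    using noncontinuable_time_eq[OF assms(1), of "2 * pi / \<omega>"] b1 w(1) by (auto simp: b_def \<omega>_def)
qed

text \<open>For these curvatures the area grows beyond \<open>2 \<pi>\<close> within the first turn, so that it takes the value
  \<open>2 \<pi>\<close> before the circle closes.\<close>
lemma cut_time_opposite:
  assumes nc: "noncontinuable_shortest_arc (geod \<beta> \<phi>) T" and \<beta>: "\<beta> \<noteq> 0" "\<bar>\<beta>\<bar> < 2 / sqrt 3"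
  shows "T > 0" "within_first_turn \<bar>\<beta>\<bar> T" "geo_z \<bar>\<beta>\<bar> T = 2 * pi"
    "\<bar>\<beta>\<bar> > 1 \<Longrightarrow> sqrt (\<beta>\<^sup>2 - 1) * T < 2 * pi"
proof -
  define b where "b = \<bar>\<beta>\<bar>"
  have b: "b > 0" using \<beta> by (simp add: b_def)
  define \<omega> where "\<omega> = sqrt (b\<^sup>2 - 1)"
  have w: "\<omega> > 0" "\<omega>\<^sup>2 = b\<^sup>2 - 1" if "b > 1" using square_gt_1[OF that] by (simp_all add: \<omega>_def)
  have "\<exists>M\<ge>0. 2 * pi < geo_z b M \<and> within_first_turn b M"
  proof (cases "b \<le> 1")
    case True
    have "geo_psi b (3 * pi / b) < pi / 2"
      using geo_psi_less_pi_half[of "3 * pi / b" b] geo_c_pos_if_le_1[of b] True b by auto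
    then have "2 * pi < geo_z b (3 * pi / b)" using b by (simp add: geo_psi_def)
    then show ?thesis using True b by (intro exI[of _ "3 * pi / b"]) (auto simp: within_first_turn_def)
  next
    case False
    then have b1: "b > 1" by simp
    have "b\<^sup>2 < (2 / sqrt 3)\<^sup>2" using \<beta>(2) b unfolding b_def by (intro power_strict_mono) auto
    then have "b\<^sup>2 < 4 / 3" by (simp only: threshold_squares)
    then have "2 * \<omega> < b"
      using w[OF b1] b less_iff_square[of "2 * \<omega>" b] by (simp add: power_mult_distrib)
    then have "b / \<omega> > 2" using w[OF b1] by (simp add: field_simps)
    then have "2 * pi * (b / \<omega> - 1) > 2 * pi * 1" by (intro mult_strict_left_mono) auto
    then show ?thesis using geo_z_turn(2)[OF b1] w[OF b1]
      by (intro exI[of _ "2 * pi / \<omega>"]) (auto simp: within_first_turn_def \<omega>_def)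
  qed
  then obtain M where M: "M \<ge> 0" "2 * pi < geo_z b M" "within_first_turn b M" by blast
  then obtain C where C: "0 \<le> C" "C \<le> M" "geo_z b C = 2 * pi"
    using IVT'[of "geo_z b" 0 "2 * pi" M] continuous_on_geo_z by auto
  have "C \<noteq> M" using C M by auto
  then have CM: "C < M" using C by simp
  have "C \<noteq> 0" using C by auto
  then have C0: "C > 0" using C by simp
  have wf: "b \<le> 1 \<or> \<omega> * C < 2 * pi"
  proof (cases "b \<le> 1")
    case False
    then have "\<omega> * C < \<omega> * M" using CM w by simp
    also have "\<omega> * M \<le> 2 * pi" using M(3) False by (simp add: within_first_turn_def \<omega>_def)
    finally show ?thesis by simp
  qed simp
  then have "within_first_turn b C" using C by (auto simp: within_first_turn_def \<omega>_def)
  moreover from this have "T = C"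
    using noncontinuable_time_eq[OF nc \<beta>(1) C0] C(3) by (simp add: b_def)
  ultimately show "T > 0" "within_first_turn \<bar>\<beta>\<bar> T" "geo_z \<bar>\<beta>\<bar> T = 2 * pi"
    "\<bar>\<beta>\<bar> > 1 \<Longrightarrow> sqrt (\<beta>\<^sup>2 - 1) * T < 2 * pi"
    using C C0 wf by (auto simp: b_def \<omega>_def)
qed

text \<open>Since \<open>z = \<beta> t - 2 geo_psi\<close>, the area \<open>2 \<pi>\<close> means that the angle \<open>\<beta> t / 2\<close> is opposite to the angle
  \<open>geo_psi\<close>, whose cosine and sine are known.\<close>
lemma opposite_angle:
  assumes "t \<ge> 0" "geo_z \<beta> t = 2 * pi"
  shows "\<beta> * t / 2 = pi + geo_psi \<beta> t"
    and "cos (\<beta> * t / 2) = - geo_c \<beta> t / sqrt (1 + (geo_s \<beta> t)\<^sup>2)"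
    and "sin (\<beta> * t / 2) = - (\<beta> * geo_s \<beta> t) / sqrt (1 + (geo_s \<beta> t)\<^sup>2)"
proof -
  show e: "\<beta> * t / 2 = pi + geo_psi \<beta> t" using assms by (simp add: geo_psi_def field_simps)
  let ?N = "sqrt (1 + (geo_s \<beta> t)\<^sup>2)"
  have N: "?N > 0" by simp
  show "cos (\<beta> * t / 2) = - geo_c \<beta> t / ?N" "sin (\<beta> * t / 2) = - (\<beta> * geo_s \<beta> t) / ?N"
    unfolding e geo_cos_sin_psi[OF assms(1)] using N by simp_all
qed

text \<open>The form of the equations in terms of the slope \<open>r\<close> of the vector \<open>(geo_c, \<beta> geo_s)\<close>; it is \<open>t / 2\<close>,
  \<open>k tanh x\<close> or \<open>k tan x\<close> according to the size of \<open>\<beta>\<close>. The sign depends on the side of the turning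
  point on which the cut occurs.\<close>
lemma opposite_angle_slope:
  assumes t: "t \<ge> 0" "geo_z \<beta> t = 2 * pi" and r: "\<beta> * geo_s \<beta> t = geo_c \<beta> t * r"
  shows "geo_c \<beta> t > 0 \<Longrightarrow> cos (\<beta> * t / 2) = - 1 / sqrt (1 + r\<^sup>2)"
    "geo_c \<beta> t > 0 \<Longrightarrow> sin (\<beta> * t / 2) = - r / sqrt (1 + r\<^sup>2)"
    "geo_c \<beta> t < 0 \<Longrightarrow> cos (\<beta> * t / 2) = 1 / sqrt (1 + r\<^sup>2)"
    "geo_c \<beta> t < 0 \<Longrightarrow> sin (\<beta> * t / 2) = r / sqrt (1 + r\<^sup>2)"
proof -
  have "1 + (geo_s \<beta> t)\<^sup>2 = (geo_c \<beta> t)\<^sup>2 + (\<beta> * geo_s \<beta> t)\<^sup>2"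
    using geo_c_s[of \<beta> t] by (simp add: power_mult_distrib algebra_simps)
  also have "\<dots> = (geo_c \<beta> t)\<^sup>2 * (1 + r\<^sup>2)" unfolding r by (simp add: power_mult_distrib algebra_simps)
  finally have N: "sqrt (1 + (geo_s \<beta> t)\<^sup>2) = \<bar>geo_c \<beta> t\<bar> * sqrt (1 + r\<^sup>2)"
    by (simp add: real_sqrt_mult)
  note cs = opposite_angle(2,3)[OF t, unfolded r N]
  show "geo_c \<beta> t > 0 \<Longrightarrow> cos (\<beta> * t / 2) = - 1 / sqrt (1 + r\<^sup>2)"
    "geo_c \<beta> t > 0 \<Longrightarrow> sin (\<beta> * t / 2) = - r / sqrt (1 + r\<^sup>2)"
    "geo_c \<beta> t < 0 \<Longrightarrow> cos (\<beta> * t / 2) = 1 / sqrt (1 + r\<^sup>2)"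
    "geo_c \<beta> t < 0 \<Longrightarrow> sin (\<beta> * t / 2) = r / sqrt (1 + r\<^sup>2)"
    unfolding cs by simp_all
qed

lemma cut_parabolic:
  assumes "0 < t" "geo_z 1 t = 2 * pi"
  shows "2 * pi < t" "t < 3 * pi"
    "cos (t / 2) = - 1 / sqrt (1 + (t / 2)\<^sup>2)" "sin (t / 2) = - (t / 2) / sqrt (1 + (t / 2)\<^sup>2)"
proof -
  have "0 < geo_psi 1 t" using geo_psi_strict_mono[of 1 0 t] assms by simp
  moreover have "geo_psi 1 t < pi / 2"
    using geo_psi_less_pi_half[of t 1] geo_c_pos_if_le_1[of 1] assms by auto
  ultimately show "2 * pi < t" "t < 3 * pi" using opposite_angle(1)[of t 1] assms by auto
  have "geo_c 1 t = 1" "geo_s 1 t = t / 2" using geo_parabolic[of 1 t] by auto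
  then show "cos (t / 2) = - 1 / sqrt (1 + (t / 2)\<^sup>2)" "sin (t / 2) = - (t / 2) / sqrt (1 + (t / 2)\<^sup>2)"
    using opposite_angle_slope(1,2)[of t 1 "t / 2"] assms by auto
qed

lemma cut_hyperbolic:
  fixes b t :: real
  defines "k \<equiv> b / sqrt (1 - b\<^sup>2)" and "x \<equiv> t * sqrt (1 - b\<^sup>2) / 2"
  assumes b: "0 < b" "b < 1" and t: "0 < t" "geo_z b t = 2 * pi"
  shows "2 * pi / b < t" "t < 3 * pi / b" "x = t / (2 * sqrt (1 + k\<^sup>2))"
    "cos (k * x) = - 1 / sqrt (1 + k\<^sup>2 * (tanh x)\<^sup>2)"
    "sin (k * x) = - (k * tanh x) / sqrt (1 + k\<^sup>2 * (tanh x)\<^sup>2)"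
proof -
  have "0 < geo_psi b t" using geo_psi_strict_mono[of b 0 t] b t by simp
  moreover have "geo_psi b t < pi / 2"
    using geo_psi_less_pi_half[of t b] geo_c_pos_if_le_1[of b] b t by auto
  ultimately have "2 * pi < b * t" "b * t < 3 * pi" using opposite_angle(1)[of t b] t by auto
  then show "2 * pi / b < t" "t < 3 * pi / b" using b by (simp_all add: field_simps)
  define \<nu> where "\<nu> = sqrt (1 - b\<^sup>2)"
  have nu: "\<nu> > 0" "\<nu>\<^sup>2 = 1 - b\<^sup>2" using b less_iff_square[of b 1] by (simp_all add: \<nu>_def)
  have "1 + k\<^sup>2 = (1 / \<nu>)\<^sup>2" unfolding k_def \<nu>_def[symmetric] power_divide using nu by (simp add: field_simps)
  then have "sqrt (1 + k\<^sup>2) = 1 / \<nu>" using nu(1) by (simp only: real_sqrt_abs) simp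
  then show "x = t / (2 * sqrt (1 + k\<^sup>2))" by (simp add: x_def \<nu>_def)
  have e: "geo_c b t = cosh x" "geo_s b t = sinh x / \<nu>"
    using geo_hyperbolic[of b t] b by (simp_all add: x_def \<nu>_def mult.commute)
  have kx: "k * x = b * t / 2" using nu(1) by (simp add: k_def x_def \<nu>_def)
  have "b * geo_s b t = geo_c b t * (k * tanh x)"
    unfolding e k_def \<nu>_def[symmetric] tanh_def by simp
  from opposite_angle_slope(1,2)[OF _ t(2) this] t
  show "cos (k * x) = - 1 / sqrt (1 + k\<^sup>2 * (tanh x)\<^sup>2)"
    "sin (k * x) = - (k * tanh x) / sqrt (1 + k\<^sup>2 * (tanh x)\<^sup>2)"
    unfolding kx by (simp_all add: e power_mult_distrib)
qed

text \<open>Comparing \<open>2 \<pi>\<close> with the area of the half circle tells whether the cut occurs before or after the turning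
  point, that is, whether \<open>x\<close> is in the first or in the second quadrant. In the first quadrant
  \<open>geo_psi\<close> exceeds \<open>x\<close> because \<open>tan geo_psi = (b / \<omega>) tan x\<close> with \<open>b > \<omega>\<close>, and in the second
  it is smaller. By \<open>opposite_angle\<close> this is a comparison of \<open>t (b - \<omega>)\<close> with \<open>2 \<pi>\<close>, and
  \<open>(b - \<omega>) (b + \<omega>) = 1\<close> turns it into the bound \<open>2 \<pi> (b + \<omega>)\<close>.\<close>
lemma cut_elliptic:
  fixes b t :: real
  defines "k \<equiv> b / sqrt (b\<^sup>2 - 1)" and "x \<equiv> t * sqrt (b\<^sup>2 - 1) / 2"
  assumes b: "1 < b" and t: "0 < t" "sqrt (b\<^sup>2 - 1) * t < 2 * pi" "geo_z b t = 2 * pi"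
  shows "x = t / (2 * sqrt (k\<^sup>2 - 1))"
    and "b\<^sup>2 = 9 / 8 \<Longrightarrow> t = pi / sqrt (b\<^sup>2 - 1)"
    and "b\<^sup>2 < 9 / 8 \<Longrightarrow> 2 * pi * (b + sqrt (b\<^sup>2 - 1)) < t \<and> t < 3 * pi / b \<and> tan x > 0 \<and>
      cos (k * x) = - 1 / sqrt (1 + k\<^sup>2 * (tan x)\<^sup>2) \<and> sin (k * x) = - (k * tan x) / sqrt (1 + k\<^sup>2 * (tan x)\<^sup>2)"
    and "b\<^sup>2 > 9 / 8 \<Longrightarrow> 3 * pi / b < t \<and> t < 2 * pi * (b + sqrt (b\<^sup>2 - 1)) \<and> tan x < 0 \<and>
      cos (k * x) = 1 / sqrt (1 + k\<^sup>2 * (tan x)\<^sup>2) \<and> sin (k * x) = k * tan x / sqrt (1 + k\<^sup>2 * (tan x)\<^sup>2)"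
proof -
  define \<omega> where "\<omega> = sqrt (b\<^sup>2 - 1)"
  have w: "\<omega> > 0" "\<omega>\<^sup>2 = b\<^sup>2 - 1" using square_gt_1[OF b] by (simp_all add: \<omega>_def)
  have "k\<^sup>2 - 1 = (1 / \<omega>)\<^sup>2" unfolding k_def \<omega>_def[symmetric] power_divide using w by (simp add: field_simps)
  then have "sqrt (k\<^sup>2 - 1) = 1 / \<omega>" using w(1) by (simp only: real_sqrt_abs) simp
  then show "x = t / (2 * sqrt (k\<^sup>2 - 1))" by (simp add: x_def \<omega>_def)
  have e: "geo_c b t = cos x" "geo_s b t = sin x / \<omega>"
    using geo_elliptic[of b t] b by (simp_all add: x_def \<omega>_def mult.commute)
  \<comment> \<open>In terms of the curve, \<open>k x\<close> is the angle of \<open>opposite_angle\<close>.\<close>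
  have kx: "k * x = b * t / 2" using w(1) by (simp add: k_def x_def \<omega>_def)
  have x: "0 < x" "x < pi" using t w(1) by (simp_all add: x_def \<omega>_def mult.commute)
  have slope: "b * geo_s b t = geo_c b t * (k * tan x)" if "cos x \<noteq> 0"
    unfolding e k_def \<omega>_def[symmetric] tan_def using that by simp
  have half: "geo_z b (pi / \<omega>) = pi * (b / \<omega> - 1)" using geo_z_turn(1)[OF b] by (simp add: \<omega>_def)
  have half_iff: "2 * pi < geo_z b (pi / \<omega>) \<longleftrightarrow> b\<^sup>2 < 9 / 8" "2 * pi = geo_z b (pi / \<omega>) \<longleftrightarrow> b\<^sup>2 = 9 / 8"
  proof -
    have "2 * pi < pi * (b / \<omega> - 1) \<longleftrightarrow> 2 < b / \<omega> - 1" "2 * pi = pi * (b / \<omega> - 1) \<longleftrightarrow> 2 = b / \<omega> - 1"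
      using mult_less_cancel_left_pos[OF pi_gt_zero, of 2 "b / \<omega> - 1"]
        mult_cancel_left[of pi 2 "b / \<omega> - 1"] by (auto simp: mult.commute)
    moreover have "2 < b / \<omega> - 1 \<longleftrightarrow> 3 * \<omega> < b" "2 = b / \<omega> - 1 \<longleftrightarrow> 3 * \<omega> = b"
      using w(1) by (auto simp: field_simps)
    moreover have "3 * \<omega> < b \<longleftrightarrow> (3 * \<omega>)\<^sup>2 < b\<^sup>2" "3 * \<omega> = b \<longleftrightarrow> (3 * \<omega>)\<^sup>2 = b\<^sup>2"
      using w(1) b less_iff_square[of "3 * \<omega>" b] power2_eq_iff_nonneg[of "3 * \<omega>" b] by simp_all
    moreover have "(3 * \<omega>)\<^sup>2 = 9 * b\<^sup>2 - 9" by (simp add: power_mult_distrib w)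
    ultimately show "2 * pi < geo_z b (pi / \<omega>) \<longleftrightarrow> b\<^sup>2 < 9 / 8" "2 * pi = geo_z b (pi / \<omega>) \<longleftrightarrow> b\<^sup>2 = 9 / 8"
      unfolding half by auto
  qed
  have mono: "t < pi / \<omega> \<longleftrightarrow> geo_z b t < geo_z b (pi / \<omega>)" "t = pi / \<omega> \<longleftrightarrow> geo_z b t = geo_z b (pi / \<omega>)"
    using geo_z_strict_mono[of b t "pi / \<omega>"] geo_z_strict_mono[of b "pi / \<omega>" t] b t w(1)
    by (cases t "pi / \<omega>" rule: linorder_cases; force)+
  show "t = pi / sqrt (b\<^sup>2 - 1)" if "b\<^sup>2 = 9 / 8"
    using mono(2) half_iff(2) t(3) that by (simp add: \<omega>_def)
  have ang: "b * t / 2 = pi + geo_psi b t" using opposite_angle(1)[of t b] t by simp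
  \<comment> \<open>So the sign of \<open>sin (geo_psi b t - x)\<close> is the sign of \<open>geo_psi b t - x\<close>.\<close>
  have near: "\<bar>geo_psi b t - x\<bar> < pi / 2"
    using geo_elliptic_psi[OF b, of t] t by (simp add: x_def mult.commute)
  let ?N = "sqrt (1 + (geo_s b t)\<^sup>2)"
  have "?N * sin (geo_psi b t - x) = b * geo_s b t * cos x - geo_c b t * sin x"
    using geo_cos_sin_psi[of t b] t by (simp add: sin_diff algebra_simps)
  also have "\<dots> = (b / \<omega> - 1) * (sin x * cos x)" by (simp add: e algebra_simps)
  finally have sin_diff: "?N * sin (geo_psi b t - x) = (b / \<omega> - 1) * (sin x * cos x)" .
  have "\<omega> < b" using w b less_iff_square[of \<omega> b] by simp
  then have gap: "b / \<omega> - 1 > 0" using w(1) by simp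
  have inv: "(b - \<omega>) * (b + \<omega>) = 1" using w(2) by (simp add: algebra_simps power2_eq_square)
  have sinx: "sin x > 0" using x by (rule sin_gt_zero)
  have psi_x: "geo_psi b t - x = t * (b - \<omega>) / 2 - pi" using ang by (simp add: x_def \<omega>_def algebra_simps)
  show "2 * pi * (b + sqrt (b\<^sup>2 - 1)) < t \<and> t < 3 * pi / b \<and> tan x > 0 \<and>
      cos (k * x) = - 1 / sqrt (1 + k\<^sup>2 * (tan x)\<^sup>2) \<and> sin (k * x) = - (k * tan x) / sqrt (1 + k\<^sup>2 * (tan x)\<^sup>2)"
    if "b\<^sup>2 < 9 / 8"
  proof -
    have "t < pi / \<omega>" using mono(1) half_iff(1) t(3) that by simp
    then have x2: "x < pi / 2" using w(1) by (simp add: x_def \<omega>_def field_simps)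
    then have cosx: "cos x > 0" using x by (intro cos_gt_zero) auto
    have "geo_psi b t < geo_psi b (pi / \<omega>)" using geo_psi_strict_mono[of b t] \<open>t < pi / \<omega>\<close> b t by simp
    then have "geo_psi b t < pi / 2" using geo_psi_half_turn(1)[OF b] by (simp add: \<omega>_def)
    then have 1: "t < 3 * pi / b" using ang b by (simp add: field_simps)
    have "?N * sin (geo_psi b t - x) > 0" unfolding sin_diff using gap sinx cosx by simp
    then have "sin (geo_psi b t - x) > 0" by (simp add: zero_less_mult_iff)
    then have "geo_psi b t - x > 0" using near sin_ge_zero[of "x - geo_psi b t"]
      by (smt (verit) pi_half_less_two pi_gt_zero sin_minus field_sum_of_halves)
    then have "2 * pi < t * (b - \<omega>)" unfolding psi_x by simp
    then have "2 * pi * (b + \<omega>) < t * (b - \<omega>) * (b + \<omega>)" using b w(1) by (intro mult_strict_right_mono) auto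
    then have 2: "2 * pi * (b + \<omega>) < t" by (simp add: inv mult.assoc)
    have "tan x > 0" using sinx cosx by (simp add: tan_def)
    moreover have "geo_c b t > 0" using cosx by (simp add: e)
    ultimately show ?thesis
      using 1 2 opposite_angle_slope(1,2)[OF _ t(3) slope] t(1) cosx
      unfolding kx \<omega>_def[symmetric] by (simp add: power_mult_distrib)
  qed
  show "3 * pi / b < t \<and> t < 2 * pi * (b + sqrt (b\<^sup>2 - 1)) \<and> tan x < 0 \<and>
      cos (k * x) = 1 / sqrt (1 + k\<^sup>2 * (tan x)\<^sup>2) \<and> sin (k * x) = k * tan x / sqrt (1 + k\<^sup>2 * (tan x)\<^sup>2)"
    if "b\<^sup>2 > 9 / 8"
  proof -
    have "\<not> t < pi / \<omega>" "t \<noteq> pi / \<omega>" using mono half_iff t(3) that by auto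
    then have t': "pi / \<omega> < t" by simp
    then have x2: "pi / 2 < x" using w(1) by (simp add: x_def \<omega>_def field_simps)
    then have cosx: "cos x < 0" using x cos_monotone_0_pi[of "pi / 2" x] by simp
    have "geo_psi b (pi / \<omega>) < geo_psi b t" using geo_psi_strict_mono[of b "pi / \<omega>" t] t' b w(1) by simp
    then have "geo_psi b t > pi / 2" using geo_psi_half_turn(1)[OF b] by (simp add: \<omega>_def)
    then have 1: "3 * pi / b < t" using ang b by (simp add: field_simps)
    have "?N * sin (geo_psi b t - x) < 0" unfolding sin_diff using gap sinx cosx by (simp add: mult_pos_neg)
    then have "sin (geo_psi b t - x) < 0" by (simp add: mult_less_0_iff)
    then have "geo_psi b t - x < 0" using near sin_ge_zero[of "geo_psi b t - x"]
      by (smt (verit) pi_half_less_two pi_gt_zero field_sum_of_halves)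
    then have "t * (b - \<omega>) < 2 * pi" unfolding psi_x by simp
    then have "t * (b - \<omega>) * (b + \<omega>) < 2 * pi * (b + \<omega>)" using b w(1) by (intro mult_strict_right_mono) auto
    then have 2: "t < 2 * pi * (b + \<omega>)" by (simp add: inv mult.assoc)
    have "tan x < 0" using sinx cosx by (simp add: tan_def divide_pos_neg)
    moreover have "geo_c b t < 0" using cosx by (simp add: e)
    ultimately show ?thesis
      using 1 2 opposite_angle_slope(3,4)[OF _ t(3) slope] t(1) cosx
      unfolding kx \<omega>_def[symmetric] by (simp add: power_mult_distrib)
  qed
qed

theorem theorem6:
  fixes \<beta> \<phi> T :: real
  assumes "\<beta> \<noteq> 0"
    and "noncontinuable_shortest_arc (geod \<beta> \<phi>) T"
  shows
    "(\<bar>\<beta>\<bar> \<ge> 2 / sqrt 3 \<longrightarrow> T = 2 * pi / sqrt (\<beta>\<^sup>2 - 1)) \<and>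
     (\<beta>\<^sup>2 = 1 \<longrightarrow>
        2 * pi < T \<and> T < 3 * pi \<and>
        cos (T / 2) = -1 / sqrt (1 + (T / 2)\<^sup>2) \<and>
        sin (T / 2) = - (T / 2) / sqrt (1 + (T / 2)\<^sup>2)) \<and>
     (\<beta>\<^sup>2 < 1 \<longrightarrow>
        2 * pi / \<bar>\<beta>\<bar> < T \<and> T < 3 * pi / \<bar>\<beta>\<bar> \<and>
        (let k = \<bar>\<beta>\<bar> / sqrt (1 - \<beta>\<^sup>2); x = T * sqrt (1 - \<beta>\<^sup>2) / 2 in
           x = T / (2 * sqrt (1 + k\<^sup>2)) \<and>
           cos (k * x) = -1 / sqrt (1 + k\<^sup>2 * (tanh x)\<^sup>2) \<and>
           sin (k * x) = - (k * tanh x) / sqrt (1 + k\<^sup>2 * (tanh x)\<^sup>2))) \<and>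
     (\<bar>\<beta>\<bar> = 3 / (2 * sqrt 2) \<longrightarrow> T = 2 * sqrt 2 * pi) \<and>
     (3 / (2 * sqrt 2) < \<bar>\<beta>\<bar> \<and> \<bar>\<beta>\<bar> < 2 / sqrt 3 \<longrightarrow>
        3 * pi / \<bar>\<beta>\<bar> < T \<and>
        T < 2 * pi * (\<bar>\<beta>\<bar> + sqrt (\<beta>\<^sup>2 - 1)) \<and>
        2 * pi * (\<bar>\<beta>\<bar> + sqrt (\<beta>\<^sup>2 - 1)) < 4 * pi / \<bar>\<beta>\<bar> \<and>
        (let k = \<bar>\<beta>\<bar> / sqrt (\<beta>\<^sup>2 - 1); x = T * sqrt (\<beta>\<^sup>2 - 1) / 2 in
           x = T / (2 * sqrt (k\<^sup>2 - 1)) \<and>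
           cos (k * x) = 1 / sqrt (1 + k\<^sup>2 * (tan x)\<^sup>2) \<and>
           sin (k * x) = k * tan x / sqrt (1 + k\<^sup>2 * (tan x)\<^sup>2) \<and>
           k * tan x / sqrt (1 + k\<^sup>2 * (tan x)\<^sup>2) < 0)) \<and>
     (1 < \<bar>\<beta>\<bar> \<and> \<bar>\<beta>\<bar> < 3 / (2 * sqrt 2) \<longrightarrow>
        2 * pi / \<bar>\<beta>\<bar> < 2 * pi * (\<bar>\<beta>\<bar> + sqrt (\<beta>\<^sup>2 - 1)) \<and>
        2 * pi * (\<bar>\<beta>\<bar> + sqrt (\<beta>\<^sup>2 - 1)) < T \<and>
        T < 3 * pi / \<bar>\<beta>\<bar> \<and>
        (let k = \<bar>\<beta>\<bar> / sqrt (\<beta>\<^sup>2 - 1); x = T * sqrt (\<beta>\<^sup>2 - 1) / 2 in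
           x = T / (2 * sqrt (k\<^sup>2 - 1)) \<and>
           cos (k * x) = -1 / sqrt (1 + k\<^sup>2 * (tan x)\<^sup>2) \<and>
           sin (k * x) = - (k * tan x) / sqrt (1 + k\<^sup>2 * (tan x)\<^sup>2) \<and>
           - (k * tan x) / sqrt (1 + k\<^sup>2 * (tan x)\<^sup>2) < 0))"
proof -
  define b where "b = \<bar>\<beta>\<bar>"
  have b: "b > 0" "\<beta>\<^sup>2 = b\<^sup>2" using assms(1) by (simp_all add: b_def)
  have late: "T = 2 * pi / sqrt (b\<^sup>2 - 1)" if "b \<ge> 2 / sqrt 3"
    using cut_time_on_axis[OF assms(2)] that by (simp add: b_def)
  have early: "T > 0" "geo_z b T = 2 * pi" "b > 1 \<Longrightarrow> sqrt (b\<^sup>2 - 1) * T < 2 * pi" if "b < 2 / sqrt 3"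
    using cut_time_opposite[OF assms(2,1)] that by (auto simp: b_def)
  have sq_axis: "b < 2 / sqrt 3 \<longleftrightarrow> b\<^sup>2 < 4 / 3"
    using less_iff_square[of b "2 / sqrt 3"] b unfolding threshold_squares by simp
  have sq_half: "b < 3 / (2 * sqrt 2) \<longleftrightarrow> b\<^sup>2 < 9 / 8" "3 / (2 * sqrt 2) < b \<longleftrightarrow> 9 / 8 < b\<^sup>2"
    using less_iff_square[of b "3 / (2 * sqrt 2)"] less_iff_square[of "3 / (2 * sqrt 2)" b] b
    unfolding threshold_squares by simp_all
  have P: "2 * pi < T \<and> T < 3 * pi \<and> cos (T / 2) = -1 / sqrt (1 + (T / 2)\<^sup>2) \<and>
        sin (T / 2) = - (T / 2) / sqrt (1 + (T / 2)\<^sup>2)" if "b\<^sup>2 = 1"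
  proof -
    have "b = 1" using that b by (simp add: power2_eq_1_iff)
    then show ?thesis using early cut_parabolic[of T] sq_axis by simp
  qed
  have H: "2 * pi / b < T \<and> T < 3 * pi / b \<and>
        (let k = b / sqrt (1 - b\<^sup>2); x = T * sqrt (1 - b\<^sup>2) / 2 in
           x = T / (2 * sqrt (1 + k\<^sup>2)) \<and>
           cos (k * x) = -1 / sqrt (1 + k\<^sup>2 * (tanh x)\<^sup>2) \<and>
           sin (k * x) = - (k * tanh x) / sqrt (1 + k\<^sup>2 * (tanh x)\<^sup>2))" if "b\<^sup>2 < 1"
  proof -
    have "b < 1" using that b less_iff_square[of b 1] by simp
    moreover have "b < 2 / sqrt 3" using that sq_axis by simp
    ultimately show ?thesis using cut_hyperbolic[of b T] early b by (simp add: Let_def)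
  qed
  have E: "T = 2 * sqrt 2 * pi" if "b = 3 / (2 * sqrt 2)"
  proof -
    have b2: "b\<^sup>2 = 9 / 8" unfolding that threshold_squares ..
    then have "b > 1" using b less_iff_square[of 1 b] by simp
    then have "T = pi / sqrt (b\<^sup>2 - 1)" using cut_elliptic(2)[of b T] early sq_axis b2 by simp
    also have "sqrt (b\<^sup>2 - 1) = 1 / (2 * sqrt 2)"
      by (rule real_sqrt_unique) (simp_all add: b2 power_divide power_mult_distrib)
    finally show ?thesis by simp
  qed
  have L: "3 * pi / b < T \<and> T < 2 * pi * (b + sqrt (b\<^sup>2 - 1)) \<and>
        2 * pi * (b + sqrt (b\<^sup>2 - 1)) < 4 * pi / b \<and>
        (let k = b / sqrt (b\<^sup>2 - 1); x = T * sqrt (b\<^sup>2 - 1) / 2 in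
           x = T / (2 * sqrt (k\<^sup>2 - 1)) \<and>
           cos (k * x) = 1 / sqrt (1 + k\<^sup>2 * (tan x)\<^sup>2) \<and>
           sin (k * x) = k * tan x / sqrt (1 + k\<^sup>2 * (tan x)\<^sup>2) \<and>
           k * tan x / sqrt (1 + k\<^sup>2 * (tan x)\<^sup>2) < 0)" if "3 / (2 * sqrt 2) < b" "b < 2 / sqrt 3"
  proof -
    have b2: "9 / 8 < b\<^sup>2" "b\<^sup>2 < 4 / 3" using that sq_half sq_axis by simp_all
    then have b1: "b > 1" using b less_iff_square[of 1 b] by simp
    define \<omega> where "\<omega> = sqrt (b\<^sup>2 - 1)"
    have w: "\<omega> > 0" "\<omega>\<^sup>2 = b\<^sup>2 - 1" using square_gt_1[OF b1] by (simp_all add: \<omega>_def)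
    \<comment> \<open>The claim \<open>b (b + \<omega>) < 2\<close> becomes an equality at \<open>b\<^sup>2 = 4 / 3\<close>.\<close>
    have "(b * \<omega>)\<^sup>2 = b\<^sup>2 * (b\<^sup>2 - 1)" by (simp add: power_mult_distrib w)
    also have "\<dots> < 4 / 3 * (1 / 3)" using b2 by (intro mult_strict_mono) auto
    also have "\<dots> = (2 / 3)\<^sup>2" by (simp add: power2_eq_square)
    finally have "b * \<omega> < 2 / 3" by (rule power2_less_imp_less) simp
    then have "b * (b + \<omega>) < 2" using b2(2) by (simp add: power2_eq_square algebra_simps)
    then have "2 * pi * (b * (b + \<omega>)) < 2 * pi * 2" by (intro mult_strict_left_mono) auto
    then have "2 * pi * (b + \<omega>) < 4 * pi / b" using b by (simp add: field_simps)
    moreover have "b / \<omega> * y / sqrt (1 + (b / \<omega>)\<^sup>2 * y\<^sup>2) < 0" if "y < 0" for y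
      using that w(1) b by (intro divide_neg_pos mult_pos_neg) (auto intro!: add_pos_nonneg)
    ultimately show ?thesis
      using cut_elliptic(1,4)[of b T] early b1 that b2 unfolding Let_def \<omega>_def by blast
  qed
  have M: "2 * pi / b < 2 * pi * (b + sqrt (b\<^sup>2 - 1)) \<and> 2 * pi * (b + sqrt (b\<^sup>2 - 1)) < T \<and> T < 3 * pi / b \<and>
        (let k = b / sqrt (b\<^sup>2 - 1); x = T * sqrt (b\<^sup>2 - 1) / 2 in
           x = T / (2 * sqrt (k\<^sup>2 - 1)) \<and>
           cos (k * x) = -1 / sqrt (1 + k\<^sup>2 * (tan x)\<^sup>2) \<and>
           sin (k * x) = - (k * tan x) / sqrt (1 + k\<^sup>2 * (tan x)\<^sup>2) \<and>
           - (k * tan x) / sqrt (1 + k\<^sup>2 * (tan x)\<^sup>2) < 0)" if "1 < b" "b < 3 / (2 * sqrt 2)"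
  proof -
    have b2: "b\<^sup>2 < 9 / 8" using that sq_half by simp
    define \<omega> where "\<omega> = sqrt (b\<^sup>2 - 1)"
    have w: "\<omega> > 0" using square_gt_1[OF that(1)] by (simp add: \<omega>_def)
    have "1 * 1 < b * (b + \<omega>)" using w that(1) by (intro mult_strict_mono) auto
    then have "2 * pi * (1 * 1) < 2 * pi * (b * (b + \<omega>))" by (intro mult_strict_left_mono) auto
    then have "2 * pi / b < 2 * pi * (b + \<omega>)" using b by (simp add: field_simps)
    moreover have "- (b / \<omega> * y) / sqrt (1 + (b / \<omega>)\<^sup>2 * y\<^sup>2) < 0" if "0 < y" for y
      using that w b by (intro divide_neg_pos) (auto intro!: add_pos_nonneg)
    moreover have "b < 2 / sqrt 3" using b2 sq_axis by simp
    ultimately show ?thesis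
      using cut_elliptic(1,3)[of b T] early that b2 unfolding Let_def \<omega>_def by blast
  qed
  show ?thesis
    unfolding b_def[symmetric] b(2) using late P H E L M by blast
qed

end
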